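(* Consider the sparsified MIS algorithm described in the context, run on an $n$-node graph of maximum degree $\Delta$, with $C$ a sufficiently large constant. For each node $v$, during $T=c\log\Delta$ iterations, for a sufficiently large constant $c$, with probability at least $1-1/\Delta^{C}$ either $v$ or a neighbor of $v$ is added to the independent set; this guarantee holds independent of the randomness outside the $2$-hop neighborhood of $v$. Furthermore, letting $B$ be the set of nodes remaining after $T$ iterations, with probability at least $1-1/n^{10}$ the following hold: (1) each connected component of the subgraph induced by $B$ has $O(\log_\Delta n\cdot \Delta^4)$ nodes; (2) $|B|\le n/\Delta^{10}$; (3) if $\Delta>n^{\alpha/4}$, then $B$ is empty.
   Context: Sparsified MIS algorithm on a graph $G$ with maximum degree $\Delta$, with parameters a constant $\alpha\in(0,1)$ and a large constant $C$: let $k=12C\log\Delta$ and $R=\alpha\sqrt{\log\Delta}/10$. Every node $v$ starts with $p_0(v)=1/2$. Iterations $t=1,2,\dots$ are grouped into phases $s=0,1,\dots$ of $R$ consecutive iterations; iteration $t=sR+i$ is the $i$-th iteration ($1\le i\le R$) of phase $s$. In iteration $t$: each remaining node $u$ is independently sampled in each of $k$ repetitions, with probability $p_{t-1}(u)$ in each repetition; for $j=1,\dots,k$ let $\hat d^{\,j}(v)$ be the number of remaining neighbors of $v$ sampled in repetition $j$, and let $\hat d_{t-1}(v)$ be the median of $\hat d^{\,1}(v),\dots,\hat d^{\,k}(v)$. If $i=1$ and $\hat d_{t-1}(v)\ge 2^{\alpha\sqrt{\log\Delta}/5}$, then $v$ is stalling for all iterations of this phase. Round 1: $p_t(v)=p_{t-1}(v)/2$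 if $\hat d_{t-1}(v)\ge 2$ or $v$ is stalling, and $p_t(v)=\min\{2p_{t-1}(v),1/2\}$ otherwise. Round 2 (only if $v$ is not stalling): $v$ marks itself with probability $p_t(v)$; if $v$ is marked and no neighbor of $v$ is marked, $v$ joins the independent set, and then $v$ and all its neighbors are removed from the graph. A node is "remaining" if it has not been removed. *)

theory Defs
  imports "HOL-Probability.Probability"
begin

section \<open>Finite simple graphs\<close>

text \<open>A graph is given by its vertex set and its adjacency relation; the neighbours of
  \<open>v\<close> are \<open>E `` {v}\<close>.\<close>

definition simple_graph :: "nat set \<Rightarrow> nat rel \<Rightarrow> bool" where
  "simple_graph V E \<longleftrightarrow> finite V \<and> E \<subseteq> V \<times> V \<and> sym E \<and> irrefl E"

definition max_degree :: "nat set \<Rightarrow> nat rel \<Rightarrow> nat" where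
  "max_degree V E = Max ((\<lambda>v. card (E `` {v})) ` V)"

text \<open>Nodes at distance at most 2, including \<open>v\<close> itself.\<close>

definition two_hop :: "nat rel \<Rightarrow> nat \<Rightarrow> nat set" where
  "two_hop E v = {v} \<union> E `` {v} \<union> E `` (E `` {v})"

definition induced_components :: "nat rel \<Rightarrow> nat set \<Rightarrow> nat set set" where
  "induced_components E B = (\<lambda>u. (Restr E B)\<^sup>* `` {u}) ` B"

section \<open>Parameters\<close>

text \<open>Logarithms are to base 2. Quantities that have to be integers (number of repetitions,
  phase length, number of iterations) are rounded up, so all of them are positive
  for \<open>\<Delta> \<ge> 2\<close> and positive constants.\<close>

definition num_reps :: "real \<Rightarrow> nat \<Rightarrow> nat" where
  "num_reps C \<Delta> = nat \<lceil>12 * C * log 2 (real \<Delta>)\<rceil>"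

definition phase_length :: "real \<Rightarrow> nat \<Rightarrow> nat" where
  "phase_length \<alpha> \<Delta> = nat \<lceil>\<alpha> * sqrt (log 2 (real \<Delta>)) / 10\<rceil>"

definition stall_threshold :: "real \<Rightarrow> nat \<Rightarrow> real" where
  "stall_threshold \<alpha> \<Delta> = 2 powr (\<alpha> * sqrt (log 2 (real \<Delta>)) / 5)"

definition num_iterations :: "real \<Rightarrow> nat \<Rightarrow> nat" where
  "num_iterations c \<Delta> = nat \<lceil>c * log 2 (real \<Delta>)\<rceil>"

section \<open>Random coins\<close>

text \<open>Node \<open>u\<close> owns, for every iteration \<open>t\<close>, the independent uniform \<open>[0,1]\<close> variables
  \<open>\<omega> (u, t, j)\<close>: for \<open>1 \<le> j \<le> k\<close> it decides the sampling of \<open>u\<close> in repetition \<open>j\<close>, and for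
  \<open>j = 0\<close> the marking of \<open>u\<close>. An event of probability \<open>p\<close> happens iff its coin is below \<open>p\<close>.\<close>

type_synonym coins = "nat \<times> nat \<times> nat \<Rightarrow> real"

definition coin_index :: "nat set \<Rightarrow> nat \<Rightarrow> nat \<Rightarrow> (nat \<times> nat \<times> nat) set" where
  "coin_index U T k = U \<times> {1..T} \<times> {0..k}"

definition coin_space :: "nat set \<Rightarrow> nat \<Rightarrow> nat \<Rightarrow> coins measure" where
  "coin_space U T k = Pi\<^sub>M (coin_index U T k) (\<lambda>_. uniform_measure lborel {0..1})"

section \<open>The sparsified MIS algorithm\<close>

text \<open>For a list of even length, the mean of the two middle entries.\<close>

definition median :: "real list \<Rightarrow> real" where
  "median xs = (let ys = sort xs; m = length xs
                in (ys ! ((m - 1) div 2) + ys ! (m div 2)) / 2)"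

record mis_state =
  prb :: "nat \<Rightarrow> real"
  remaining :: "nat set"
  stalling :: "nat set"
  indep :: "nat set"

definition init_state :: "nat set \<Rightarrow> mis_state" where
  "init_state V = \<lparr>prb = (\<lambda>_. 1 / 2), remaining = V, stalling = {}, indep = {}\<rparr>"

definition sampled_nbrs :: "nat rel \<Rightarrow> coins \<Rightarrow> nat \<Rightarrow> mis_state \<Rightarrow> nat \<Rightarrow> nat \<Rightarrow> nat" where
  "sampled_nbrs E \<omega> t S v j =
     card {u \<in> E `` {v}. u \<in> remaining S \<and> \<omega> (u, t, j) < prb S u}"

definition deg_estimate :: "nat rel \<Rightarrow> nat \<Rightarrow> coins \<Rightarrow> nat \<Rightarrow> mis_state \<Rightarrow> nat \<Rightarrow> real" where
  "deg_estimate E k \<omega> t S v =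
     median (map (\<lambda>j. real (sampled_nbrs E \<omega> t S v j)) [1..<k + 1])"

text \<open>Iteration \<open>t \<ge> 1\<close>. Writing \<open>t = s * R + i\<close> with \<open>1 \<le> i \<le> R\<close>, the iteration is the
  first of its phase (\<open>i = 1\<close>) iff \<open>R\<close> divides \<open>t - 1\<close>.\<close>

definition mis_step ::
  "nat rel \<Rightarrow> real \<Rightarrow> real \<Rightarrow> nat \<Rightarrow> coins \<Rightarrow> nat \<Rightarrow> mis_state \<Rightarrow> mis_state" where
  "mis_step E \<alpha> C \<Delta> \<omega> t S =
    (let d = deg_estimate E (num_reps C \<Delta>) \<omega> t S;
         stall = (if phase_length \<alpha> \<Delta> dvd t - 1
                  then {v \<in> remaining S. d v \<ge> stall_threshold \<alpha> \<Delta>}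
                  else stalling S);
         p = (\<lambda>v. if d v \<ge> 2 \<or> v \<in> stall then prb S v / 2 else min (2 * prb S v) (1 / 2));
         marked = {v \<in> remaining S. v \<notin> stall \<and> \<omega> (v, t, 0) < p v};
         joined = {v \<in> marked. E `` {v} \<inter> marked = {}}
     in \<lparr>prb = p,
         remaining = remaining S - (joined \<union> E `` joined),
         stalling = stall,
         indep = indep S \<union> joined\<rparr>)"

primrec mis_run ::
  "nat set \<Rightarrow> nat rel \<Rightarrow> real \<Rightarrow> real \<Rightarrow> nat \<Rightarrow> coins \<Rightarrow> nat \<Rightarrow> mis_state" where
  "mis_run V E \<alpha> C \<Delta> \<omega> 0 = init_state V"
| "mis_run V E \<alpha> C \<Delta> \<omega> (Suc t) =
     mis_step E \<alpha> C \<Delta> \<omega> (Suc t) (mis_run V E \<alpha> C \<Delta> \<omega> t)"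

text \<open>\<open>v\<close> or a neighbour of \<open>v\<close> is added to the independent set in the first \<open>T\<close> iterations.\<close>

definition covered ::
  "nat set \<Rightarrow> nat rel \<Rightarrow> real \<Rightarrow> real \<Rightarrow> nat \<Rightarrow> nat \<Rightarrow> nat \<Rightarrow> coins \<Rightarrow> bool" where
  "covered V E \<alpha> C \<Delta> T v \<omega> \<longleftrightarrow>
     insert v (E `` {v}) \<inter> indep (mis_run V E \<alpha> C \<Delta> \<omega> T) \<noteq> {}"

end

theory Submission
  imports Defs
begin

text \<open>
  For a node \<open>v\<close>, let \<open>d\<close> be the sum of the probabilities of its remaining neighbours, and consider
  \<open>\<Psi> = - log p(v) + 4 * max (level d) (phase_rest / 2)\<close>, where \<open>level d = max 0 (log (64 * d))\<close> and
  \<open>phase_rest\<close> is the number of iterations for which \<open>v\<close> will still be stalling. An iteration is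
  golden if \<open>v\<close> or one of its neighbours joins with constant probability: either \<open>v\<close> marks
  itself with probability \<open>1/2\<close> and \<open>d\<close> is small, or a tenth of \<open>d\<close> comes from neighbours of
  small degree that do not halve. Unless some degree estimate is far off, \<open>\<Psi>\<close> drops by 1 in every
  iteration that is not golden and rises by at most 5 in a golden one. A staller starts its phase with
  \<open>level d \<ge> 2 * R\<close>, which pays for the halvings that continue after \<open>d\<close> has collapsed.

  Hence \<open>2 powr (\<theta> * (t + \<Psi>))\<close>, on the event that \<open>v\<close> remains, is a supermartingale for small
  \<open>\<theta>\<close>, up to an error from wrong estimates: these have probability \<open>\<Delta> powr (- \<Omega> C)\<close>, and \<open>\<Psi>\<close> is
  bounded. Within an iteration these quantities are conditionally independent for nodes with disjoint
  2-hop neighbourhoods, so \<open>m\<close> such nodes all remain with probability at most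
  \<open>\<Delta> powr (- C * m)\<close>, whatever the coins elsewhere. If \<open>n ^ 11 \<le> \<Delta> powr C\<close>, a union bound shows
  that no node remains. Otherwise, a large component contains many such nodes that lie on a short walk
  with steps of length at most 5, a large remainder contains many such nodes, and union bounds over the
  walks and over the sets of nodes suffice.
\<close>

section \<open>Discretised coins\<close>

text \<open>All probabilities in a run are powers of 1/2 with exponent at most \<open>T + 1\<close>,
  so a uniform coin is only ever compared with finitely many dyadic thresholds and may be rounded to
  a grid of resolution \<open>L \<ge> T + 1\<close>. On finitely supported coins every expectation
  is a finite sum: measurability is never an issue and averaging in stages is free. The obstacle to
  independence is that the marking of a node at distance 2 depends on estimates that read coins at
  distance 3. Averaging over the marking coins alone replaces the weight of a node by a bound that
  sees the sampling coins only through the correctness of estimates at the node and its neighbours,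
  and these read nothing beyond distance 2. The error caused by wrong estimates is carried as an
  additive term inside each factor, so that a product over many nodes keeps its product form through
  all iterations. Relative to the gain, this error grows with the number of iterations; the bound is
  therefore taken at a fixed horizon, and later iterations can only remove more nodes.\<close>

definition grid :: "nat \<Rightarrow> real pmf" where
  "grid L = map_pmf (\<lambda>i. real i / 2 ^ L) (pmf_of_set {..<2 ^ L})"

lemma finite_set_grid: "finite (set_pmf (grid L))"
proof -
  have "set_pmf (pmf_of_set {..<2 ^ L}) = {..<(2::nat) ^ L}"
    by (rule set_pmf_of_set) (simp_all add: lessThan_empty_iff)
  thus ?thesis unfolding grid_def by simp
qed

lemma prob_grid_less:
  assumes "i \<le> L"
  shows "measure_pmf.prob (grid L) {..<(1/2)^i} = (1/2)^i"
proof -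
  have eq: "{..<2 ^ L} \<inter> (\<lambda>m. real m / 2 ^ L) -` {..<(1/2)^i} = {..<(2::nat) ^ (L - i)}"
  proof -
    have e: "(2::real)^L = 2^(L-i) * 2^i" using assms by (simp flip: power_add)
    have "real m / 2 ^ L < (1/2)^i \<longleftrightarrow> m < 2^(L-i)" for m
    proof -
      have "real m / 2 ^ L < (1/2)^i \<longleftrightarrow> real m < 2^(L-i)"
        unfolding e by (simp add: field_simps power_divide)
      also have "\<dots> \<longleftrightarrow> m < 2^(L-i)"
        by (metis of_nat_less_iff of_nat_numeral of_nat_power)
      finally show ?thesis .
    qed
    moreover have "m < 2 ^ L" if "m < 2^(L-i)" for m :: nat
    proof -
      have "(2::nat)^(L-i) \<le> 2^L" by (intro power_increasing) auto
      with that show ?thesis by (rule less_le_trans)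
    qed
    ultimately show ?thesis
      unfolding set_eq_iff Int_iff lessThan_iff vimage_eq by blast
  qed
  have "measure_pmf.prob (grid L) {..<(1/2)^i} =
      real (card {..<(2::nat) ^ (L - i)}) / real (card {..<(2::nat) ^ L})"
  proof -
    have "measure_pmf.prob (pmf_of_set {..<(2::nat) ^ L}) ((\<lambda>m. real m / 2 ^ L) -` {..<(1/2)^i}) =
        real (card ({..<2 ^ L} \<inter> (\<lambda>m. real m / 2 ^ L) -` {..<(1/2)^i})) / real (card {..<(2::nat) ^ L})"
      by (rule measure_pmf_of_set) (simp_all add: lessThan_empty_iff)
    thus ?thesis unfolding grid_def measure_map_pmf eq .
  qed
  also have "\<dots> = 2 ^ (L - i) / 2 ^ L" by simp
  also have "\<dots> = (1/2)^i" using assms by (simp add: power_diff power_one_over)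
  finally show ?thesis .
qed

section \<open>Expectations over finite products of finitely supported distributions\<close>

lemma integrable_Pi_pmf:
  fixes f :: "_ \<Rightarrow> real"
  assumes "finite I" "\<And>x. x \<in> I \<Longrightarrow> finite (set_pmf (p x))"
  shows "integrable (measure_pmf (Pi_pmf I d p)) f"
  by (rule integrable_measure_pmf_finite)
     (use assms in \<open>auto simp: set_Pi_pmf intro!: finite_PiE_dflt\<close>)

lemma expectation_bind_pmf_finite:
  fixes h :: "_ \<Rightarrow> real"
  assumes "finite (set_pmf M)" "\<And>x. x \<in> set_pmf M \<Longrightarrow> finite (set_pmf (N x))"
  shows "measure_pmf.expectation (bind_pmf M N) h =
    measure_pmf.expectation M (\<lambda>x. measure_pmf.expectation (N x) h)"
proof -
  have "measure_pmf.expectation (bind_pmf M N) h =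
      (\<Sum>a\<in>set_pmf M. pmf M a *\<^sub>R measure_pmf.expectation (N a) h)"
    by (rule pmf_expectation_bind) (use assms in auto)
  also have "\<dots> = measure_pmf.expectation M (\<lambda>x. measure_pmf.expectation (N x) h)"
    by (subst integral_measure_pmf[of "set_pmf M"]) (use assms in auto)
  finally show ?thesis .
qed

text \<open>Fubini for coins: the outer average fixes those off \<open>J\<close>, the inner one
  redraws those in \<open>J\<close>. Later \<open>J\<close> is either the set of marking coins of
  one iteration or the set of all its coins.\<close>

lemma expectation_Pi_pmf_split:
  fixes h :: "_ \<Rightarrow> real"
  assumes I: "finite I" "J \<subseteq> I" and p: "\<And>x. x \<in> I \<Longrightarrow> finite (set_pmf (p x))"
  shows "measure_pmf.expectation (Pi_pmf I d p) h =
    measure_pmf.expectation (Pi_pmf (I - J) d p) (\<lambda>g.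
      measure_pmf.expectation (Pi_pmf J d p) (\<lambda>f. h (override_on g f J)))"
proof -
  have fin: "finite (set_pmf (Pi_pmf A d p))" if "A \<subseteq> I" for A
    using that I p by (subst set_Pi_pmf) (auto intro!: finite_PiE_dflt intro: finite_subset)
  have J: "finite J" using I finite_subset by blast
  have "Pi_pmf (J \<union> (I - J)) d p = map_pmf (\<lambda>(f,g) x. if x \<in> J then f x else g x)
             (pair_pmf (Pi_pmf J d p) (Pi_pmf (I - J) d p))"
    by (rule Pi_pmf_union) (use I J in auto)
  also have "J \<union> (I - J) = I" using I by auto
  also have "(pair_pmf (Pi_pmf J d p) (Pi_pmf (I - J) d p)) =
      Pi_pmf (I - J) d p \<bind> (\<lambda>g. Pi_pmf J d p \<bind> (\<lambda>f. return_pmf (f,g)))"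
    unfolding pair_pmf_def by (rule bind_commute_pmf)
  finally have "Pi_pmf I d p = Pi_pmf (I - J) d p \<bind> (\<lambda>g. map_pmf (\<lambda>f. override_on g f J) (Pi_pmf J d p))"
    by (simp add: map_bind_pmf map_pmf_def bind_assoc_pmf bind_return_pmf override_on_def)
  thus ?thesis
    by (simp, subst expectation_bind_pmf_finite) (auto intro!: fin finite_imageI I(2))
qed

text \<open>Factors that read disjoint sets of coordinates are independent. The induction peels off
  one factor: averaging over \<open>J a\<close> leaves the other factors untouched. Each mean is
  estimated on its own index set \<open>J v\<close>, and nonnegativity allows the bounds to be
  multiplied.\<close>

lemma expectation_prod_disjoint_le:
  fixes h :: "'v \<Rightarrow> ('i \<Rightarrow> 'a) \<Rightarrow> real"
  assumes A: "finite A" and I: "finite I" and p: "\<And>x. x \<in> I \<Longrightarrow> finite (set_pmf (p x))"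
    and J: "\<And>v. v \<in> A \<Longrightarrow> J v \<subseteq> I" "disjoint_family_on J A"
    and nonneg: "\<And>v f. v \<in> A \<Longrightarrow> 0 \<le> h v f"
    and local: "\<And>v f g. v \<in> A \<Longrightarrow> (\<And>x. x \<in> J v \<Longrightarrow> f x = g x) \<Longrightarrow> h v f = h v g"
    and bound: "\<And>v. v \<in> A \<Longrightarrow> measure_pmf.expectation (Pi_pmf (J v) d p) (h v) \<le> c v"
  shows "measure_pmf.expectation (Pi_pmf I d p) (\<lambda>f. \<Prod>v\<in>A. h v f) \<le> (\<Prod>v\<in>A. c v)"
  using A I p J nonneg local bound
proof (induction A arbitrary: I rule: finite_induct)
  case empty
  show ?case by simp
next
  case (insert a A)
  have Ja: "J a \<subseteq> I" by (rule insert.prems(3)) simp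
  have intg: "integrable (measure_pmf (Pi_pmf I' d p)) f" if "I' \<subseteq> I" for I' and f :: "_ \<Rightarrow> real"
    using that insert.prems(1,2) by (intro integrable_Pi_pmf) (auto intro: finite_subset)
  have "0 \<le> measure_pmf.expectation (Pi_pmf (J a) d p) (h a)"
    by (rule Bochner_Integration.integral_nonneg) (rule insert.prems(5), simp)
  also have "\<dots> \<le> c a" by (rule insert.prems(7)) simp
  finally have c: "0 \<le> c a" .
  have disj: "J a \<inter> J v = {}" if "v \<in> A" for v
    by (rule disjoint_family_onD[OF insert.prems(4)]) (use insert.hyps that in auto)
  have "measure_pmf.expectation (Pi_pmf I d p) (\<lambda>f. \<Prod>v\<in>insert a A. h v f) =
     measure_pmf.expectation (Pi_pmf (I - J a) d p) (\<lambda>g.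
      measure_pmf.expectation (Pi_pmf (J a) d p) (\<lambda>f. \<Prod>v\<in>insert a A. h v (override_on g f (J a))))"
    by (rule expectation_Pi_pmf_split) (use insert.prems(1,2) Ja in auto)
  also have "\<dots> = measure_pmf.expectation (Pi_pmf (I - J a) d p) (\<lambda>g.
      measure_pmf.expectation (Pi_pmf (J a) d p) (\<lambda>f. h a f * (\<Prod>v\<in>A. h v g)))"
  proof -
    have "(\<Prod>v\<in>insert a A. h v (override_on g f (J a))) = h a f * (\<Prod>v\<in>A. h v g)" for f g
    proof -
      have "h a (override_on g f (J a)) = h a f"
        by (rule insert.prems(6)) simp_all
      moreover have "h v (override_on g f (J a)) = h v g" if "v \<in> A" for v
        by (rule insert.prems(6)) (use that disj in \<open>auto simp: override_on_def\<close>)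
      ultimately show ?thesis using insert.hyps by simp
    qed
    thus ?thesis by simp
  qed
  also have "\<dots> = measure_pmf.expectation (Pi_pmf (J a) d p) (h a) *
      measure_pmf.expectation (Pi_pmf (I - J a) d p) (\<lambda>g. \<Prod>v\<in>A. h v g)"
    by simp
  also have "\<dots> \<le> c a * (\<Prod>v\<in>A. c v)"
  proof (rule mult_mono)
    show "measure_pmf.expectation (Pi_pmf (J a) d p) (h a) \<le> c a" by (rule insert.prems(7)) simp
    show "measure_pmf.expectation (Pi_pmf (I - J a) d p) (\<lambda>g. \<Prod>v\<in>A. h v g) \<le> (\<Prod>v\<in>A. c v)"
    proof (rule insert.IH)
      show "J v \<subseteq> I - J a" if "v \<in> A" for v using insert.prems(3)[of v] disj[OF that] that by auto
      show "disjoint_family_on J A" using insert.prems(4) by (auto simp: disjoint_family_on_def)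
      show "h v f = h v g" if "v \<in> A" "\<And>x. x \<in> J v \<Longrightarrow> f x = g x" for v f g
        by (rule insert.prems(6)[OF insertI2[OF that(1)] that(2)])
      show "finite (I - J a)" using insert.prems(1) by simp
      show "finite (set_pmf (p x))" if "x \<in> I - J a" for x using that insert.prems(2) by simp
      show "0 \<le> h v f" if "v \<in> A" for v f using that insert.prems(5) by simp
      show "measure_pmf.expectation (Pi_pmf (J v) d p) (h v) \<le> c v" if "v \<in> A" for v
        using that insert.prems(7) by simp
    qed
    show "0 \<le> measure_pmf.expectation (Pi_pmf (I - J a) d p) (\<lambda>g. \<Prod>v\<in>A. h v g)"
      by (intro Bochner_Integration.integral_nonneg prod_nonneg) (use insert.prems(5) in auto)
  qed (use c in auto)
  finally show ?case using insert.hyps by simp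
qed

section \<open>Rounding uniform coins to the grid\<close>

definition unit_coin :: "real measure" where "unit_coin = uniform_measure lborel {0..1}"

lemma prob_space_unit_coin: "prob_space unit_coin"
  unfolding unit_coin_def by (rule prob_space_uniform_measure) auto

definition grid_index :: "nat \<Rightarrow> real \<Rightarrow> nat" where
  "grid_index L x = nat \<lfloor>2 ^ L * x\<rfloor>"

lemma grid_index_grid: "grid_index L (real i / 2 ^ L) = i"
  by (simp add: grid_index_def)

lemma distr_grid_index:
  "distr unit_coin (count_space UNIV) (grid_index L) = measure_pmf (pmf_of_set {..<2 ^ L})"
  (is "?D = _")
proof (rule measure_eqI_countable[where A = UNIV])
  fix i :: nat
  have meas[measurable]: "grid_index L \<in> borel \<rightarrow>\<^sub>M count_space UNIV"
    unfolding grid_index_def by measurable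
  have sing: "grid_index L -` {i} \<in> sets borel" for i
    using measurable_sets[OF meas, of "{i}"] by simp
  have D: "emeasure ?D {i} = emeasure lborel ({0..1} \<inter> grid_index L -` {i})"
    by (subst emeasure_distr) (use sing in \<open>auto simp: unit_coin_def divide_ennreal_def\<close>)
  show "emeasure ?D {i} = emeasure (measure_pmf (pmf_of_set {..<2 ^ L})) {i}"
  proof (cases "i < 2 ^ L")
    case True
    have il: "real i < 2 ^ L" by (metis True of_nat_less_iff of_nat_numeral of_nat_power)
    have "{0..1} \<inter> grid_index L -` {i} = {real i / 2 ^ L ..< (real i + 1) / 2 ^ L}"
    proof (intro set_eqI iffI)
      fix x assume "x \<in> {0..1} \<inter> grid_index L -` {i}"
      hence x: "0 \<le> x" "x \<le> 1" "nat \<lfloor>2 ^ L * x\<rfloor> = i" by (auto simp: grid_index_def)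
      hence "\<lfloor>2 ^ L * x\<rfloor> = int i" by (smt (verit) int_nat_eq mult_nonneg_nonneg zero_le_floor zero_le_power)
      hence "real i \<le> 2 ^ L * x" "2 ^ L * x < real i + 1" by linarith+
      thus "x \<in> {real i / 2 ^ L ..< (real i + 1) / 2 ^ L}" by (auto simp: field_simps)
    next
      fix x assume "x \<in> {real i / 2 ^ L ..< (real i + 1) / 2 ^ L}"
      hence x: "real i \<le> 2 ^ L * x" "2 ^ L * x < real i + 1" by (auto simp: field_simps)
      have "real i + 1 \<le> 2 ^ L" using True
        by (metis Suc_leI of_nat_Suc of_nat_le_iff of_nat_numeral of_nat_power add.commute)
      hence "2 ^ L * x < 2 ^ L * 1" using x by linarith
      hence "x < 1" by (subst (asm) mult_less_cancel_left_pos) auto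
      moreover have "0 \<le> 2 ^ L * x" using x by linarith
      hence "0 \<le> x" by (smt (verit) zero_less_power zero_le_mult_iff)
      moreover have "\<lfloor>2 ^ L * x\<rfloor> = int i" using x by linarith
      ultimately show "x \<in> {0..1} \<inter> grid_index L -` {i}" by (simp add: grid_index_def)
    qed
    thus ?thesis using True
      by (simp add: D emeasure_pmf_single diff_divide_distrib[symmetric] divide_right_mono)
         (subst pmf_of_set, auto simp: lessThan_empty_iff)
  next
    case False
    have "2 ^ L \<le> real i" using False
      by (metis linorder_not_less of_nat_le_iff of_nat_numeral of_nat_power)
    \<comment> \<open>Only the right endpoint of the interval can reach an index of
      \<open>2 ^ L\<close> or more, and it is a null set.\<close>
    have "{0..1} \<inter> grid_index L -` {i} \<subseteq> {1}"
    proof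
      fix x assume "x \<in> {0..1} \<inter> grid_index L -` {i}"
      hence x: "0 \<le> x" "x \<le> 1" "nat \<lfloor>2 ^ L * x\<rfloor> = i" by (auto simp: grid_index_def)
      hence "\<lfloor>2 ^ L * x\<rfloor> = int i" by (smt (verit) int_nat_eq mult_nonneg_nonneg zero_le_floor zero_le_power)
      hence "real i \<le> 2 ^ L * x" by linarith
      hence "2 ^ L * 1 \<le> 2 ^ L * x" using \<open>2 ^ L \<le> real i\<close> by linarith
      hence "1 \<le> x" by (subst (asm) mult_le_cancel_left_pos) auto
      thus "x \<in> {1}" using x by auto
    qed
    hence "emeasure lborel ({0..1} \<inter> grid_index L -` {i}) \<le> emeasure lborel {1::real}"
      by (intro emeasure_mono) auto
    hence "emeasure lborel ({0..1} \<inter> grid_index L -` {i}) = 0" by simp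
    thus ?thesis using False
      by (simp add: D emeasure_pmf_single) (subst pmf_of_set, auto simp: lessThan_empty_iff)
  qed
qed auto

definition coins_pmf :: "nat \<Rightarrow> 'i set \<Rightarrow> ('i \<Rightarrow> real) pmf" where
  "coins_pmf L I = Pi_pmf I 0 (\<lambda>_. grid L)"

text \<open>\<open>Q\<close> is not assumed measurable: it factors through the rounding map, whose
  target is a discrete space. Both measures are pushed to that space, where they agree because
  rounded coins are independent and uniform.\<close>

lemma measure_PiM_unit_coin:
  assumes I: "finite I"
    and Q: "\<And>\<omega> \<omega>'. (\<And>x. x \<in> I \<Longrightarrow> grid_index L (\<omega> x) = grid_index L (\<omega>' x)) \<Longrightarrow> Q \<omega> = Q \<omega>'"
  shows "measure (Pi\<^sub>M I (\<lambda>_. unit_coin)) {\<omega> \<in> space (Pi\<^sub>M I (\<lambda>_. unit_coin)). Q \<omega>}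
    = measure_pmf.prob (coins_pmf L I) {\<omega>. Q \<omega>}"
proof -
  define G where "G = (pmf_of_set {..<2 ^ L} :: nat pmf)"
  define real_coins where "real_coins = (\<lambda>(g :: 'a \<Rightarrow> nat) x. real (g x) / 2 ^ L)"
  define X where "X = {g \<in> PiE I (\<lambda>_. UNIV). Q (real_coins g)}"
  let ?P = "Pi\<^sub>M I (\<lambda>_. unit_coin)"
  let ?N = "Pi\<^sub>M I (\<lambda>_. count_space (UNIV :: nat set))"
  have N: "?N = count_space (PiE I (\<lambda>_. UNIV))"
    by (rule count_space_PiM_finite) (use I in auto)
  have meas: "grid_index L \<in> unit_coin \<rightarrow>\<^sub>M count_space UNIV"
    unfolding grid_index_def unit_coin_def by measurable
  have m: "compose I (grid_index L) \<in> ?P \<rightarrow>\<^sub>M ?N"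
    unfolding compose_def
    by (rule measurable_restrict)
       (use meas in \<open>auto intro: measurable_compose[OF measurable_component_singleton]\<close>)
  have "distr ?P ?N (compose I (grid_index L)) =
      Pi\<^sub>M I (\<lambda>_. distr unit_coin (count_space UNIV) (grid_index L))"
  proof -
    have "distr ?P (Pi\<^sub>M I (\<lambda>_. measure_pmf G)) (compose I (grid_index L)) =
      Pi\<^sub>M I (\<lambda>_. distr unit_coin (measure_pmf G) (grid_index L))"
      by (rule distr_PiM_finite_prob_space')
         (use I meas in \<open>auto simp: prob_space_unit_coin measure_pmf.prob_space_axioms\<close>)
    moreover have "distr ?P (Pi\<^sub>M I (\<lambda>_. measure_pmf G)) (compose I (grid_index L)) =
        distr ?P ?N (compose I (grid_index L))"
      by (rule distr_cong) (auto intro!: sets_PiM_cong)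
    moreover have "distr unit_coin (measure_pmf G) (grid_index L) =
        distr unit_coin (count_space UNIV) (grid_index L)"
      by (rule distr_cong) auto
    ultimately show ?thesis by simp
  qed
  also have "\<dots> = Pi\<^sub>M I (\<lambda>_. measure_pmf G)"
    by (simp add: distr_grid_index G_def)
  \<comment> \<open>Functions drawn from \<open>Pi_pmf\<close> are 0 outside \<open>I\<close>, while
    elements of the product space are \<open>undefined\<close> there; \<open>restrict\<close>
    mediates. The empty index set is treated separately because the product characterisation of
    independence is applied with \<open>I\<close> nonempty.\<close>
  also have "\<dots> = distr (measure_pmf (Pi_pmf I 0 (\<lambda>_. G))) ?N (\<lambda>f. restrict f I)"
  proof (cases "I = {}")
    case False
    have rv: "measure_pmf.random_variable (Pi_pmf I 0 (\<lambda>_. G)) (count_space UNIV) (\<lambda>f. f i)" for i by simp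
    have "distr (measure_pmf (Pi_pmf I 0 (\<lambda>_. G))) ?N (\<lambda>f. restrict f I) =
        Pi\<^sub>M I (\<lambda>i. distr (measure_pmf (Pi_pmf I 0 (\<lambda>_. G))) (count_space UNIV) (\<lambda>f. f i))"
      using indep_vars_Pi_pmf[OF I, of 0 "\<lambda>_. G"]
      by (subst (asm) prob_space.indep_vars_iff_distr_eq_PiM'[OF measure_pmf.prob_space_axioms False]) auto
    also have "\<dots> = Pi\<^sub>M I (\<lambda>_. measure_pmf G)"
    proof (rule PiM_cong)
      fix i assume "i \<in> I"
      have "distr (measure_pmf (Pi_pmf I 0 (\<lambda>_. G))) (count_space UNIV) (\<lambda>f. f i) =
          measure_pmf (map_pmf (\<lambda>f. f i) (Pi_pmf I 0 (\<lambda>_. G)))"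
        by (simp add: map_pmf_rep_eq)
      also have "\<dots> = measure_pmf G" using I \<open>i \<in> I\<close> by (simp add: Pi_pmf_component)
      finally show "distr (measure_pmf (Pi_pmf I 0 (\<lambda>_. G))) (count_space UNIV) (\<lambda>f. f i) = measure_pmf G" .
    qed simp
    finally show ?thesis by simp
  next
    case True
    have "distr (measure_pmf (return_pmf (\<lambda>_. 0 :: nat))) (count_space {\<lambda>_ :: 'a. undefined :: nat}) (\<lambda>_ _. undefined)
       = count_space {\<lambda>_ :: 'a. undefined :: nat}"
      by (rule measure_eqI_countable[where A = "{\<lambda>_. undefined}"])
         (auto simp: emeasure_distr measure_pmf.emeasure_space_1[of "return_pmf (\<lambda>_. 0)", simplified])
    thus ?thesis using True by (simp add: PiM_empty restrict_def)
  qed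
  finally have eq: "distr ?P ?N (compose I (grid_index L)) =
      distr (measure_pmf (Pi_pmf I 0 (\<lambda>_. G))) ?N (\<lambda>f. restrict f I)" .
  have X: "X \<in> sets ?N" unfolding N X_def by auto
  have "measure ?P {\<omega> \<in> space ?P. Q \<omega>} = measure ?P (compose I (grid_index L) -` X \<inter> space ?P)"
  proof -
    have "Q \<omega> \<longleftrightarrow> compose I (grid_index L) \<omega> \<in> X" if "\<omega> \<in> space ?P" for \<omega>
    proof -
      have "compose I (grid_index L) \<omega> \<in> PiE I (\<lambda>_. UNIV)" by (auto simp: compose_def)
      moreover have "Q \<omega> = Q (real_coins (compose I (grid_index L) \<omega>))"
        by (rule Q) (auto simp: real_coins_def grid_index_grid compose_def)
      ultimately show ?thesis by (auto simp: X_def)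
    qed
    thus ?thesis by (intro arg_cong[where f = "measure ?P"]) auto
  qed
  also have "\<dots> = measure (distr ?P ?N (compose I (grid_index L))) X"
    by (rule measure_distr[symmetric, OF m X])
  also have "\<dots> = measure_pmf.prob (Pi_pmf I 0 (\<lambda>_. G)) ((\<lambda>f. restrict f I) -` X)"
    unfolding eq by (subst measure_distr) (use X in \<open>auto simp: N\<close>)
  also have "(\<lambda>f. restrict f I) -` X = {g. Q (real_coins g)}"
  proof -
    have "Q (real_coins (restrict f I)) = Q (real_coins f)" for f
      by (rule Q) (auto simp: real_coins_def)
    thus ?thesis by (auto simp: X_def)
  qed
  also have "measure_pmf.prob (Pi_pmf I 0 (\<lambda>_. G)) {g. Q (real_coins g)} =
      measure_pmf.prob (coins_pmf L I) {\<omega>. Q \<omega>}"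
  proof -
    have "coins_pmf L I = map_pmf (\<lambda>h. (\<lambda>i. real i / 2 ^ L) \<circ> h) (Pi_pmf I 0 (\<lambda>_. G))"
      unfolding coins_pmf_def grid_def G_def by (rule Pi_pmf_map) (use I in auto)
    thus ?thesis by (simp add: measure_map_pmf vimage_def real_coins_def comp_def)
  qed
  finally show ?thesis .
qed

text \<open>For \<open>i \<le> L\<close> the threshold \<open>(1/2)^i\<close> is itself a grid
  point, so rounding down never moves a coin across it.\<close>

lemma less_half_power_grid_index:
  assumes "grid_index L x = grid_index L y" "i \<le> L"
  shows "x < (1/2)^i \<longleftrightarrow> y < (1/2)^i"
proof -
  have "z < (1/2)^i \<longleftrightarrow> grid_index L z < 2 ^ (L - i)" for z :: real
  proof -
    have e: "(2::real)^L = 2^(L-i) * 2^i" using assms(2) by (simp flip: power_add)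
    have "z < (1/2)^i \<longleftrightarrow> 2 ^ i * z < 1" by (simp add: power_divide field_simps)
    also have "\<dots> \<longleftrightarrow> 2 ^ (L - i) * (2 ^ i * z) < 2 ^ (L - i) * 1" by (subst mult_less_cancel_left_pos) auto
    also have "\<dots> \<longleftrightarrow> 2 ^ L * z < 2 ^ (L - i)" by (simp add: e mult.assoc)
    also have "\<dots> \<longleftrightarrow> \<lfloor>2 ^ L * z\<rfloor> < 2 ^ (L - i)" by (simp add: floor_less_iff)
    also have "\<dots> \<longleftrightarrow> nat \<lfloor>2 ^ L * z\<rfloor> < nat (2 ^ (L - i))" by (simp only: zless_nat_conj) simp
    also have "nat (2 ^ (L - i)) = (2 :: nat) ^ (L - i)" by (simp add: nat_power_eq)
    finally show ?thesis by (simp add: grid_index_def)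
  qed
  thus ?thesis using assms(1) by simp
qed

text \<open>Makes statements about a free run instances of statements with coins
  \<open>\<xi>\<close> fixed outside \<open>U\<close>, by taking \<open>\<xi>\<close> to be
  \<open>undefined\<close> everywhere.\<close>

lemma override_on_coin_space:
  "\<omega> \<in> space (coin_space U T k) \<Longrightarrow> override_on (\<lambda>_. undefined) \<omega> (coin_index U T k) = \<omega>"
  by (auto simp: coin_space_def space_PiM PiE_def extensional_def override_on_def fun_eq_iff)

section \<open>Degree estimates and marking\<close>

text \<open>The upper of the two middle entries is at least their mean, so every sorted entry from
  position \<open>k div 2\<close> on reaches \<open>\<tau>\<close>, which is at least half of
  them.\<close>

lemma median_ge_card:
  assumes "\<tau> \<le> median (map g [1..<k+1])" "1 \<le> k"
  shows "k \<le> 2 * card {j \<in> {1..k}. \<tau> \<le> g j}"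
proof -
  define xs where "xs = map g [1..<k+1]"
  define ys where "ys = sort xs"
  have len: "length xs = k" "length ys = k" by (auto simp: xs_def ys_def)
  have mono: "ys ! i \<le> ys ! j" if "i \<le> j" "j < k" for i j
    using that len by (auto simp: ys_def intro: sorted_nth_mono)
  have "ys ! ((k - 1) div 2) \<le> ys ! (k div 2)" using assms(2) by (intro mono) auto
  moreover have "median xs = (ys ! ((k - 1) div 2) + ys ! (k div 2)) / 2"
    by (simp add: median_def Let_def ys_def len)
  ultimately have \<tau>: "\<tau> \<le> ys ! (k div 2)" using assms(1) by (simp add: xs_def)
  have "k - k div 2 = card {k div 2..<k}" by simp
  also have "\<dots> \<le> card {i. i < length ys \<and> \<tau> \<le> ys ! i}"
    using \<tau> mono by (intro card_mono) (auto simp: len intro: order_trans)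
  also have "\<dots> = length (filter (\<lambda>x. \<tau> \<le> x) ys)" by (simp add: length_filter_conv_card)
  also have "\<dots> = length (filter (\<lambda>x. \<tau> \<le> x) xs)"
    unfolding ys_def by (metis mset_filter mset_sort size_mset)
  also have "\<dots> = card {j \<in> {1..k}. \<tau> \<le> g j}"
    unfolding xs_def filter_map length_map comp_def
    by (subst distinct_card[symmetric]) (auto intro!: arg_cong[where f = card])
  finally show ?thesis by simp
qed

text \<open>Mirror image: the lower middle entry is below \<open>\<tau>\<close>, and so are the
  entries before it; these are \<open>(k - 1) div 2 + 1\<close> in number, at least half for either
  parity of \<open>k\<close>.\<close>

lemma median_less_card:
  assumes "median (map g [1..<k+1]) < \<tau>" "1 \<le> k"
  shows "k \<le> 2 * card {j \<in> {1..k}. g j < \<tau>}"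
proof -
  define xs where "xs = map g [1..<k+1]"
  define ys where "ys = sort xs"
  have len: "length xs = k" "length ys = k" by (auto simp: xs_def ys_def)
  have mono: "ys ! i \<le> ys ! j" if "i \<le> j" "j < k" for i j
    using that len by (auto simp: ys_def intro: sorted_nth_mono)
  have "ys ! ((k - 1) div 2) \<le> ys ! (k div 2)" using assms(2) by (intro mono) auto
  moreover have "median xs = (ys ! ((k - 1) div 2) + ys ! (k div 2)) / 2"
    by (simp add: median_def Let_def ys_def len)
  ultimately have \<tau>: "ys ! ((k - 1) div 2) < \<tau>" using assms(1) by (simp add: xs_def)
  have "k \<le> 2 * card {0..<(k - 1) div 2 + 1}" using assms(2) by simp
  also have "card {0..<(k - 1) div 2 + 1} \<le> card {i. i < length ys \<and> ys ! i < \<tau>}"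
    using \<tau> mono[of _ "(k - 1) div 2"] assms(2)
    by (intro card_mono) (auto simp: len less_Suc_eq_le intro!: le_less_trans[OF _ \<tau>])
  also have "\<dots> = length (filter (\<lambda>x. x < \<tau>) ys)" by (simp add: length_filter_conv_card)
  also have "\<dots> = length (filter (\<lambda>x. x < \<tau>) xs)"
    unfolding ys_def by (metis mset_filter mset_sort size_mset)
  also have "\<dots> = card {j \<in> {1..k}. g j < \<tau>}"
    unfolding xs_def filter_map length_map comp_def
    by (subst distinct_card[symmetric]) (auto intro!: arg_cong[where f = card])
  finally show ?thesis by simp
qed

lemma integrable_coins_pmf [simp]:
  fixes f :: "_ \<Rightarrow> real"
  shows "finite I \<Longrightarrow> integrable (measure_pmf (coins_pmf L I)) f"
  unfolding coins_pmf_def by (rule integrable_Pi_pmf) (auto simp: finite_set_grid)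

lemma prob_coins_less:
  assumes "finite I" "x \<in> I" "i \<le> L"
  shows "measure_pmf.prob (coins_pmf L I) {f. f x < (1/2)^i} = (1/2)^i"
proof -
  have "map_pmf (\<lambda>f. f x) (coins_pmf L I) = grid L"
    unfolding coins_pmf_def using assms by (subst Pi_pmf_component) auto
  hence "measure_pmf.prob (map_pmf (\<lambda>f. f x) (coins_pmf L I)) {..<(1/2)^i} = (1/2)^i"
    using assms by (simp add: prob_grid_less)
  thus ?thesis by (simp add: measure_map_pmf vimage_def)
qed

lemma expectation_coins_if:
  assumes "finite I"
  shows "measure_pmf.expectation (coins_pmf L I) (\<lambda>f. if b f then c else d) =
    d + (c - d) * measure_pmf.prob (coins_pmf L I) {f. b f}"
proof -
  have "(\<lambda>f. if b f then c else d) = (\<lambda>f. d + (c - d) * indicator {f. b f} f)"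
    by (auto simp: indicator_def)
  thus ?thesis using assms by simp
qed

lemma prob_coins_markov:
  fixes h :: "_ \<Rightarrow> real"
  assumes "finite I" "0 < a" "\<And>f. 0 \<le> h f" "\<And>f. Q f \<Longrightarrow> a \<le> h f"
  shows "measure_pmf.prob (coins_pmf L I) {f. Q f} \<le>
    measure_pmf.expectation (coins_pmf L I) h / a"
proof -
  have "measure_pmf.prob (coins_pmf L I) {f. Q f} =
      measure_pmf.expectation (coins_pmf L I) (indicator {f. Q f})" by simp
  also have "\<dots> \<le> measure_pmf.expectation (coins_pmf L I) (\<lambda>f. h f / a)"
    by (intro integral_mono integrable_coins_pmf assms(1))
       (use assms(2-4) in \<open>auto simp: indicator_def field_simps\<close>)
  finally show ?thesis by simp
qed

text \<open>Majority amplification: \<open>16 ^ #bad\<close> has mean at most \<open>2 ^ k\<close>, and is at least \<open>4 ^ k\<close> when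
  half of the repetitions are bad.\<close>

lemma prob_half_bad:
  assumes I: "finite I" "\<And>j. j \<in> {1..k} \<Longrightarrow> J j \<subseteq> I" "disjoint_family_on J {1..k}"
    and local: "\<And>j f g. j \<in> {1..k} \<Longrightarrow> (\<And>x. x \<in> J j \<Longrightarrow> f x = g x) \<Longrightarrow> bad j f = bad j g"
    and prob: "\<And>j. j \<in> {1..k} \<Longrightarrow> measure_pmf.prob (coins_pmf L (J j)) {f. bad j f} \<le> 1/16"
  shows "measure_pmf.prob (coins_pmf L I) {f. k \<le> 2 * card {j \<in> {1..k}. bad j f}} \<le> (1/2)^k"
proof -
  define h where "h = (\<lambda>j f. if bad j f then 16 else 1 :: real)"
  have prod: "(\<Prod>j\<in>{1..k}. h j f) = 4 ^ (2 * card {j \<in> {1..k}. bad j f})" for f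
  proof -
    have "(\<Prod>j\<in>{1..k}. h j f) = (\<Prod>j\<in>{j \<in> {1..k}. bad j f}. 16)"
      unfolding h_def by (subst prod.If_cases) (auto simp: Int_def)
    thus ?thesis by (simp add: power_mult)
  qed
  have "measure_pmf.prob (coins_pmf L I) {f. k \<le> 2 * card {j \<in> {1..k}. bad j f}} \<le>
      measure_pmf.expectation (coins_pmf L I) (\<lambda>f. \<Prod>j\<in>{1..k}. h j f) / 4 ^ k"
    unfolding prod by (intro prob_coins_markov I power_increasing) auto
  also have "measure_pmf.expectation (coins_pmf L I) (\<lambda>f. \<Prod>j\<in>{1..k}. h j f) \<le> (\<Prod>j\<in>{1..k}. 2)"
    unfolding coins_pmf_def
  proof (rule expectation_prod_disjoint_le)
    show "h j f = h j g" if "j \<in> {1..k}" "\<And>x. x \<in> J j \<Longrightarrow> f x = g x" for j f g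
      using local[OF that] by (simp add: h_def)
    show "measure_pmf.expectation (Pi_pmf (J j) 0 (\<lambda>_. grid L)) (h j) \<le> 2" if "j \<in> {1..k}" for j
    proof -
      have "finite (J j)" using I(1) I(2)[OF that] finite_subset by blast
      thus ?thesis using prob[OF that]
        unfolding h_def coins_pmf_def[symmetric] by (subst expectation_coins_if) auto
    qed
  qed (use I in \<open>auto simp: finite_set_grid h_def\<close>)
  also have "(\<Prod>j\<in>{1..k}. 2 :: real) / 4 ^ k = (1/2)^k"
    by (simp flip: power_divide)
  finally show ?thesis by (simp add: divide_right_mono)
qed

section \<open>Sampled counts and their medians\<close>

definition count_below :: "nat set \<Rightarrow> (nat \<Rightarrow> real) \<Rightarrow> nat \<Rightarrow> coins \<Rightarrow> nat \<Rightarrow> nat" where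
  "count_below N p t f j = card {u \<in> N. f (u, t, j) < p u}"

lemma count_below_cong:
  "(\<And>u. u \<in> N \<Longrightarrow> f (u, t, j) = g (u, t, j)) \<Longrightarrow> count_below N p t f j = count_below N p t g j"
  unfolding count_below_def by (rule arg_cong[where f = card]) auto

text \<open>Markov's inequality. The mean count is exactly the sum of \<open>p\<close>, because the
  grid resolves each threshold \<open>p u\<close>.\<close>

lemma prob_count_ge:
  fixes \<tau> :: real
  assumes N: "finite N" and p: "\<And>u. u \<in> N \<Longrightarrow> \<exists>i\<le>L. p u = (1/2)^i" and "0 < \<tau>"
  shows "measure_pmf.prob (coins_pmf L (N \<times> {t} \<times> {j})) {f. \<tau> \<le> real (count_below N p t f j)} \<le> (\<Sum>u\<in>N. p u) / \<tau>"
proof -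
  let ?I = "N \<times> {t} \<times> {j}"
  have "measure_pmf.prob (coins_pmf L ?I) {f. \<tau> \<le> real (count_below N p t f j)} \<le>
      measure_pmf.expectation (coins_pmf L ?I) (\<lambda>f. real (count_below N p t f j)) / \<tau>"
    by (rule prob_coins_markov) (use assms in auto)
  also have "measure_pmf.expectation (coins_pmf L ?I) (\<lambda>f. real (count_below N p t f j)) =
      measure_pmf.expectation (coins_pmf L ?I) (\<lambda>f. \<Sum>u\<in>N. if f (u, t, j) < p u then 1 else 0)"
    using N by (simp add: count_below_def sum.If_cases Int_def)
  also have "\<dots> =
      (\<Sum>u\<in>N. measure_pmf.prob (coins_pmf L ?I) {f. f (u, t, j) < p u})"
    using N by (subst Bochner_Integration.integral_sum) (auto simp: expectation_coins_if)
  also have "\<dots> = (\<Sum>u\<in>N. p u)"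
  proof (rule sum.cong[OF refl])
    fix u assume u: "u \<in> N"
    then obtain i where "i \<le> L" "p u = (1/2)^i" using p by blast
    with u N show "measure_pmf.prob (coins_pmf L ?I) {f. f (u, t, j) < p u} = p u"
      by (simp add: prob_coins_less)
  qed
  finally show ?thesis .
qed

text \<open>An exponential moment with base 1/2: \<open>(1/2) ^ count\<close> has mean at most
  \<open>exp (- 5)\<close>, which is at most 1/32, but is at least 1/2 when the count is at most 1.
  The quotient 1/16 is the failure rate that majority amplification accepts; this is why the degree
  has to be at least 10.\<close>

lemma prob_count_less_2:
  assumes N: "finite N" and p: "\<And>u. u \<in> N \<Longrightarrow> \<exists>i\<le>L. p u = (1/2)^i" and "10 \<le> (\<Sum>u\<in>N. p u)"
  shows "measure_pmf.prob (coins_pmf L (N \<times> {t} \<times> {j})) {f. real (count_below N p t f j) < 2} \<le> 1/16"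
proof -
  let ?I = "N \<times> {t} \<times> {j}"
  define h where "h = (\<lambda>u f. if f (u, t, j) < p u then 1/2 else 1 :: real)"
  have h: "(\<Prod>u\<in>N. h u f) = (1/2) ^ count_below N p t f j" for f
    unfolding h_def using N by (subst prod.If_cases) (auto simp: count_below_def Int_def)
  have "measure_pmf.prob (coins_pmf L ?I) {f. real (count_below N p t f j) < 2} \<le>
      measure_pmf.expectation (coins_pmf L ?I) (\<lambda>f. \<Prod>u\<in>N. h u f) / (1/2)"
    unfolding h
  proof (rule prob_coins_markov)
    fix f assume "real (count_below N p t f j) < 2"
    hence "count_below N p t f j \<le> 1" by simp
    hence "(1/2) ^ 1 \<le> (1/2 :: real) ^ count_below N p t f j" by (intro power_decreasing) auto
    thus "1/2 \<le> (1/2 :: real) ^ count_below N p t f j" by simp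
  qed (use N in auto)
  also have "measure_pmf.expectation (coins_pmf L ?I) (\<lambda>f. \<Prod>u\<in>N. h u f) \<le> (\<Prod>u\<in>N. 1 - p u / 2)"
    unfolding coins_pmf_def
  proof (rule expectation_prod_disjoint_le[where J = "\<lambda>u. {(u, t, j)}"])
    fix u assume u: "u \<in> N"
    then obtain i where "i \<le> L" "p u = (1/2)^i" using p by blast
    thus "measure_pmf.expectation (Pi_pmf {(u, t, j)} 0 (\<lambda>_. grid L)) (h u) \<le> 1 - p u / 2"
      unfolding h_def coins_pmf_def[symmetric] by (simp add: expectation_coins_if prob_coins_less)
  qed (use N in \<open>auto simp: finite_set_grid h_def disjoint_family_on_def\<close>)
  also have "(\<Prod>u\<in>N. 1 - p u / 2) \<le> (\<Prod>u\<in>N. exp (- p u / 2))"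
  proof (rule prod_mono)
    fix u assume u: "u \<in> N"
    then obtain i where "p u = (1/2)^i" using p by blast
    hence "p u \<le> 1" by (simp add: power_le_one)
    thus "0 \<le> 1 - p u / 2 \<and> 1 - p u / 2 \<le> exp (- p u / 2)"
      using exp_ge_add_one_self[of "- p u / 2"] by auto
  qed
  also have "\<dots> = exp (- (\<Sum>u\<in>N. p u) / 2)"
    using N by (simp add: exp_sum sum_negf sum_divide_distrib[symmetric] flip: exp_sum)
  also have "\<dots> \<le> exp (- 5)" using assms by simp
  also have "exp (- 5 :: real) \<le> 1 / 32"
  proof -
    have "(2::real) ^ 5 \<le> exp 1 ^ 5" using exp_ge_add_one_self[of "1::real"] by (intro power_mono) auto
    also have "exp (1::real) ^ 5 = exp 5" by (simp flip: exp_of_nat_mult)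
    finally show ?thesis by (simp add: exp_minus field_simps)
  qed
  finally show ?thesis by simp
qed

text \<open>The factor 16 between mean and threshold brings Markov's bound for one repetition down
  to 1/16, and the majority vote turns this into \<open>(1/2)^k\<close>.\<close>

lemma prob_median_ge:
  fixes \<tau> :: real
  assumes N: "finite N" and p: "\<And>u. u \<in> N \<Longrightarrow> \<exists>i\<le>L. p u = (1/2)^i"
    and \<tau>: "0 < \<tau>" "(\<Sum>u\<in>N. p u) \<le> \<tau> / 16" and k: "1 \<le> k" and I: "finite I" "N \<times> {t} \<times> {1..k} \<subseteq> I"
  shows "measure_pmf.prob (coins_pmf L I)
    {f. \<tau> \<le> median (map (\<lambda>j. real (count_below N p t f j)) [1..<k+1])} \<le> (1/2)^k"
proof -
  have "measure_pmf.prob (coins_pmf L I)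
      {f. \<tau> \<le> median (map (\<lambda>j. real (count_below N p t f j)) [1..<k+1])} \<le>
    measure_pmf.prob (coins_pmf L I) {f. k \<le> 2 * card {j \<in> {1..k}. \<tau> \<le> real (count_below N p t f j)}}"
    by (intro measure_pmf.finite_measure_mono subsetI CollectI)
       (erule CollectE, erule median_ge_card[OF _ k], simp)
  also have "\<dots> \<le> (1/2)^k"
  proof (rule prob_half_bad[where J = "\<lambda>j. N \<times> {t} \<times> {j}"])
    fix j
    have "(\<Sum>u\<in>N. p u) / \<tau> \<le> 1/16" using \<tau> by (simp add: field_simps)
    moreover have "measure_pmf.prob (coins_pmf L (N \<times> {t} \<times> {j})) {f. \<tau> \<le> real (count_below N p t f j)}
        \<le> (\<Sum>u\<in>N. p u) / \<tau>"
      by (rule prob_count_ge) (use N p \<tau> in auto)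
    ultimately show "measure_pmf.prob (coins_pmf L (N \<times> {t} \<times> {j})) {f. \<tau> \<le> real (count_below N p t f j)} \<le> 1/16"
      by linarith
    fix f g :: coins assume "\<And>x. x \<in> N \<times> {t} \<times> {j} \<Longrightarrow> f x = g x"
    hence "count_below N p t f j = count_below N p t g j" by (intro count_below_cong) auto
    thus "(\<tau> \<le> real (count_below N p t f j)) = (\<tau> \<le> real (count_below N p t g j))" by simp
  qed (use I in \<open>auto simp: disjoint_family_on_def\<close>)
  finally show ?thesis .
qed

lemma prob_median_less_2:
  assumes N: "finite N" and p: "\<And>u. u \<in> N \<Longrightarrow> \<exists>i\<le>L. p u = (1/2)^i"
    and d: "10 \<le> (\<Sum>u\<in>N. p u)" and k: "1 \<le> k" and I: "finite I" "N \<times> {t} \<times> {1..k} \<subseteq> I"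
  shows "measure_pmf.prob (coins_pmf L I)
    {f. median (map (\<lambda>j. real (count_below N p t f j)) [1..<k+1]) < 2} \<le> (1/2)^k"
proof -
  have "measure_pmf.prob (coins_pmf L I)
      {f. median (map (\<lambda>j. real (count_below N p t f j)) [1..<k+1]) < 2} \<le>
    measure_pmf.prob (coins_pmf L I) {f. k \<le> 2 * card {j \<in> {1..k}. real (count_below N p t f j) < 2}}"
    by (intro measure_pmf.finite_measure_mono subsetI CollectI)
       (erule CollectE, erule median_less_card[OF _ k], simp)
  also have "\<dots> \<le> (1/2)^k"
  proof (rule prob_half_bad[where J = "\<lambda>j. N \<times> {t} \<times> {j}"])
    fix j
    show "measure_pmf.prob (coins_pmf L (N \<times> {t} \<times> {j})) {f. real (count_below N p t f j) < 2} \<le> 1/16"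
      by (rule prob_count_less_2[OF N p d])
    fix f g :: coins assume "\<And>x. x \<in> N \<times> {t} \<times> {j} \<Longrightarrow> f x = g x"
    hence "count_below N p t f j = count_below N p t g j" by (intro count_below_cong) auto
    thus "(real (count_below N p t f j) < 2) = (real (count_below N p t g j) < 2)" by simp
  qed (use I in \<open>auto simp: disjoint_family_on_def\<close>)
  finally show ?thesis .
qed

section \<open>Isolated marks\<close>

lemma one_minus_ge_exp:
  fixes x :: real
  assumes "0 \<le> x" "x \<le> 1/2"
  shows "exp (- 2 * x) \<le> 1 - x"
proof -
  have "x * x \<le> (1/2) * x" using assms by (intro mult_right_mono) auto
  hence "- 2 * x \<le> - x - 2 * x\<^sup>2" by (simp add: power2_eq_square)
  also have "\<dots> \<le> ln (1 - x)" by (rule ln_one_minus_pos_lower_bound) (use assms in auto)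
  finally show ?thesis using assms by (simp add: ln_ge_iff)
qed

lemma prob_coins_single_below:
  assumes I: "finite I" "x \<in> I" "K \<subseteq> I" "x \<notin> K"
    and q: "\<And>y. y \<in> insert x K \<Longrightarrow> \<exists>i\<le>L. q y = (1/2)^i"
  shows "measure_pmf.prob (coins_pmf L I) {f. f x < q x \<and> (\<forall>y\<in>K. \<not> f y < q y)} =
    q x * (\<Prod>y\<in>K. 1 - q y)"
proof -
  define B where "B = (\<lambda>y. if y = x then {..<q x} else if y \<in> K then - {..<q y} else UNIV)"
  have qp: "measure_pmf.prob (grid L) {..<q y} = q y" if "y \<in> insert x K" for y
    using q[OF that] by (auto simp: prob_grid_less)
  have "{f. f x < q x \<and> (\<forall>y\<in>K. \<not> f y < q y)} = Pi I B"
    using I by (fastforce simp: B_def Pi_def split: if_splits)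
  hence "measure_pmf.prob (coins_pmf L I) {f. f x < q x \<and> (\<forall>y\<in>K. \<not> f y < q y)} =
      (\<Prod>y\<in>I. measure_pmf.prob (grid L) (B y))"
    unfolding coins_pmf_def using I(1) by (simp add: measure_Pi_pmf_Pi)
  also have "\<dots> = (\<Prod>y\<in>insert x K. measure_pmf.prob (grid L) (B y))"
    by (rule prod.mono_neutral_right) (use I in \<open>auto simp: B_def\<close>)
  also have "\<dots> = measure_pmf.prob (grid L) (B x) * (\<Prod>y\<in>K. measure_pmf.prob (grid L) (B y))"
    using I finite_subset[of K I] by simp
  also have "measure_pmf.prob (grid L) (B x) = q x" by (simp add: B_def qp)
  also have "(\<Prod>y\<in>K. measure_pmf.prob (grid L) (B y)) = (\<Prod>y\<in>K. 1 - q y)"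
  proof (rule prod.cong[OF refl])
    fix y assume "y \<in> K"
    hence "measure_pmf.prob (grid L) (B y) = measure_pmf.prob (grid L) (- {..<q y})"
      using I by (auto simp: B_def)
    also have "\<dots> = 1 - q y"
      using \<open>y \<in> K\<close>
      by (subst measure_pmf.prob_compl[of "{..<q y}", simplified, folded Compl_eq_Diff_UNIV]) (auto simp: qp)
    finally show "measure_pmf.prob (grid L) (B y) = 1 - q y" .
  qed
  finally show ?thesis .
qed

text \<open>The event \<open>F u\<close> says that \<open>u\<close> is below its threshold while all
  its neighbours in \<open>M\<close> and all other members of \<open>Q\<close> are not. Excluding
  the rest of \<open>Q\<close> makes these events disjoint, so their probabilities add up. The
  excluded nodes have total probability at most 20 + 1, and \<open>1 - x \<ge> exp (- 2 * x)\<close>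
  turns this into the factor \<open>exp (- 42)\<close>.\<close>

lemma prob_some_isolated_mark:
  fixes E :: "nat rel" and t j :: nat
  assumes I: "finite I" "(\<lambda>w. (w, t, j)) ` (Q \<union> (E `` Q \<inter> M)) \<subseteq> I"
    and q: "\<And>w. \<exists>i. 1 \<le> i \<and> i \<le> L \<and> q w = (1/2)^i"
    and Q: "finite Q" "Q \<subseteq> M" "Q \<inter> St = {}" "(\<Sum>w\<in>Q. q w) \<le> 1"
    and M: "finite M" and E: "irrefl E"
    and deg: "\<And>u. u \<in> Q \<Longrightarrow> (\<Sum>w\<in>E `` {u} \<inter> M. q w) \<le> 20"
  shows "(\<Sum>w\<in>Q. q w) * exp (- 42) \<le> measure_pmf.prob (coins_pmf L I)
    {f. \<exists>u\<in>Q. u \<in> {w \<in> M. w \<notin> St \<and> f (w, t, j) < q w} \<and>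
           E `` {u} \<inter> {w \<in> M. w \<notin> St \<and> f (w, t, j) < q w} = {}}"
proof -
  define K where "K = (\<lambda>u. (E `` {u} \<inter> M \<union> Q) - {u})"
  define F where "F = (\<lambda>u. {f :: coins. f (u, t, j) < q u \<and> (\<forall>w\<in>K u. \<not> f (w, t, j) < q w)})"
  have q01: "0 < q w" "q w \<le> 1/2" for w
  proof -
    obtain i where i: "1 \<le> i" "q w = (1/2)^i" using q by blast
    have "(1/2 :: real)^i \<le> (1/2)^1" using i by (intro power_decreasing) auto
    with i show "0 < q w" "q w \<le> 1/2" by auto
  qed
  have F: "q u * exp (- 42) \<le> measure_pmf.prob (coins_pmf L I) (F u)" if u: "u \<in> Q" for u
  proof -
    let ?x = "\<lambda>w. (w, t, j)"
    have fK: "finite (K u)" using Q M by (auto simp: K_def)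
    have "F u = {f. f (?x u) < q (fst (?x u)) \<and> (\<forall>y\<in>?x ` K u. \<not> f y < q (fst y))}"
      by (auto simp: F_def)
    also have "measure_pmf.prob (coins_pmf L I) \<dots> = q (fst (?x u)) * (\<Prod>y\<in>?x ` K u. 1 - q (fst y))"
    proof (rule prob_coins_single_below)
      show "?x u \<in> I" using I(2) u by auto
      show "?x ` K u \<subseteq> I" using I(2) u by (auto simp: K_def)
      show "\<exists>i\<le>L. q (fst y) = (1/2)^i" for y :: "nat \<times> nat \<times> nat" using q by blast
    qed (use I in \<open>auto simp: K_def\<close>)
    also have "\<dots> = q u * (\<Prod>w\<in>K u. 1 - q w)"
      by (subst prod.reindex) (auto simp: inj_on_def)
    finally have eq: "measure_pmf.prob (coins_pmf L I) (F u) = q u * (\<Prod>w\<in>K u. 1 - q w)" .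
    have "(\<Sum>w\<in>K u. q w) \<le> (\<Sum>w\<in>E `` {u} \<inter> M \<union> Q. q w)"
      using Q M q01 by (intro sum_mono2) (auto simp: K_def less_imp_le)
    also have "\<dots> \<le> (\<Sum>w\<in>E `` {u} \<inter> M. q w) + (\<Sum>w\<in>Q. q w)"
      using Q M q01 by (subst sum_Un) (auto intro!: sum_nonneg simp: less_imp_le)
    also have "\<dots> \<le> 21" using deg[OF u] Q by linarith
    finally have "exp (- 42) \<le> exp (- 2 * (\<Sum>w\<in>K u. q w))" by simp
    also have "\<dots> = (\<Prod>w\<in>K u. exp (- 2 * q w))"
      using fK by (simp add: exp_sum[symmetric] sum_distrib_left sum_negf)
    also have "\<dots> \<le> (\<Prod>w\<in>K u. 1 - q w)"
    proof (rule prod_mono)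
      fix w
      have "exp (- 2 * q w) \<le> 1 - q w" using q01[of w] by (intro one_minus_ge_exp) auto
      thus "0 \<le> exp (- 2 * q w) \<and> exp (- 2 * q w) \<le> 1 - q w" by simp
    qed
    finally show ?thesis unfolding eq using q01[of u] by (intro mult_left_mono) auto
  qed
  have disj: "disjoint_family_on F Q"
    unfolding disjoint_family_on_def F_def K_def by auto
  have "(\<Sum>w\<in>Q. q w) * exp (- 42) \<le> (\<Sum>u\<in>Q. measure_pmf.prob (coins_pmf L I) (F u))"
    unfolding sum_distrib_right by (intro sum_mono F)
  also have "\<dots> = measure_pmf.prob (coins_pmf L I) (\<Union>u\<in>Q. F u)"
    using Q disj by (subst measure_pmf.finite_measure_finite_Union) auto
  also have "\<dots> \<le> measure_pmf.prob (coins_pmf L I)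
    {f. \<exists>u\<in>Q. u \<in> {w \<in> M. w \<notin> St \<and> f (w, t, j) < q w} \<and>
           E `` {u} \<inter> {w \<in> M. w \<notin> St \<and> f (w, t, j) < q w} = {}}"
  proof (rule measure_pmf.finite_measure_mono, rule subsetI)
    fix f assume "f \<in> (\<Union>u\<in>Q. F u)"
    then obtain u where u: "u \<in> Q" "f \<in> F u" by blast
    have "u \<notin> E `` {u}" using E by (auto simp: irrefl_def)
    with u have "u \<in> {w \<in> M. w \<notin> St \<and> f (w, t, j) < q w} \<and>
           E `` {u} \<inter> {w \<in> M. w \<notin> St \<and> f (w, t, j) < q w} = {}"
      using Q by (auto simp: F_def K_def)
    with u show "f \<in> {f. \<exists>u\<in>Q. u \<in> {w \<in> M. w \<notin> St \<and> f (w, t, j) < q w} \<and>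
           E `` {u} \<inter> {w \<in> M. w \<notin> St \<and> f (w, t, j) < q w} = {}}" by blast
  qed simp
  finally show ?thesis .
qed

text \<open>Greedy selection: an element is added only while the sum is at most 1/2, and it adds at
  most 1/2. This provides the cap 1 on the total probability of \<open>Q\<close> in
  \<open>prob_some_isolated_mark\<close>.\<close>

lemma sub_sum_half:
  fixes q :: "'a \<Rightarrow> real"
  assumes "finite N" "\<And>w. w \<in> N \<Longrightarrow> 0 \<le> q w" "\<And>w. w \<in> N \<Longrightarrow> q w \<le> 1/2"
  shows "\<exists>Q\<subseteq>N. (\<Sum>w\<in>Q. q w) \<le> 1 \<and> min (1/2) (\<Sum>w\<in>N. q w) \<le> (\<Sum>w\<in>Q. q w)"
  using assms
proof (induction N rule: finite_induct)
  case (insert x N)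
  then obtain Q where Q: "Q \<subseteq> N" "(\<Sum>w\<in>Q. q w) \<le> 1" "min (1/2) (\<Sum>w\<in>N. q w) \<le> (\<Sum>w\<in>Q. q w)"
    by auto
  have "finite Q" "x \<notin> Q" using Q insert.hyps finite_subset by auto
  show ?case
  proof (cases "(\<Sum>w\<in>Q. q w) \<le> 1/2")
    case True
    have x: "0 \<le> q x" "q x \<le> 1/2" using insert.prems by auto
    have "(\<Sum>w\<in>insert x Q. q w) = q x + (\<Sum>w\<in>Q. q w)"
      using \<open>finite Q\<close> \<open>x \<notin> Q\<close> by simp
    moreover have "(\<Sum>w\<in>insert x N. q w) = q x + (\<Sum>w\<in>N. q w)"
      using insert.hyps by simp
    ultimately show ?thesis
      using Q True x by (intro exI[of _ "insert x Q"] conjI) auto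
  next
    case False
    thus ?thesis using Q by (intro exI[of _ Q]) auto
  qed
qed auto

section \<open>Drift of the potential\<close>

text \<open>The factor 64 sets the scale: below 1/64 the degree no longer counts, and from 1/32 on
  the level is at least 1, so that a drop by 1/2 is not cut off by the maximum with 0. As
  \<open>log 2 0 = 0\<close>, degree 0 has level 0.\<close>

definition level :: "real \<Rightarrow> real" where
  "level x = max 0 (log 2 (64 * x))"

lemma level_nonneg: "0 \<le> level x" by (simp add: level_def)

lemma level_mono: "0 \<le> x \<Longrightarrow> x \<le> y \<Longrightarrow> level x \<le> level y"
  by (cases "x = 0") (auto simp: level_def log_def[of 2 0] le_max_iff_disj)

lemma level_double:
  assumes "0 \<le> x'" "x' \<le> 2 * x"
  shows "level x' \<le> level x + 1"
proof (cases "x' = 0")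
  case True
  thus ?thesis using level_nonneg[of x] by (simp add: level_def log_def)
next
  case False
  hence pos: "0 < x'" "0 < x" using assms by auto
  have "log 2 (64 * x') \<le> log 2 (2 * (64 * x))" using pos assms by simp
  also have "\<dots> = log 2 (64 * x) + 1" using pos by (subst log_mult) auto
  finally show ?thesis by (auto simp: level_def)
qed

lemma log2_13_20: "log 2 (13/20 :: real) \<le> - 1/2"
proof -
  have "2 * log 2 (13/20 :: real) = log 2 ((13/20)^2)" by (simp add: log_nat_power)
  also have "\<dots> \<le> log 2 (1/2)" by (subst log_le_cancel_iff) (auto simp: power2_eq_square)
  also have "\<dots> = - 1" by (simp add: log_divide)
  finally show ?thesis by simp
qed

lemma level_shrink:
  assumes "0 \<le> x'" "x' \<le> 13/20 * x"
  shows "level x' \<le> max 0 (level x - 1/2)"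
proof (cases "x' = 0")
  case True
  thus ?thesis by (simp add: level_def log_def)
next
  case False
  hence pos: "0 < x'" "0 < x" using assms by auto
  have "log 2 (64 * x') \<le> log 2 (13/20 * (64 * x))" using pos assms by simp
  also have "\<dots> = log 2 (64 * x) + log 2 (13/20)" using pos by (subst log_mult) auto
  finally show ?thesis using log2_13_20 by (auto simp: level_def)
qed

lemma level_small: "0 \<le> x \<Longrightarrow> x < 1/64 \<Longrightarrow> level x = 0"
  by (cases "x = 0") (auto simp: level_def log_def[of 2 0] max_def log_le_zero_cancel_iff)

lemma level_ge_1: "1/32 \<le> x \<Longrightarrow> 1 \<le> level x"
proof -
  assume "1/32 \<le> x"
  hence "log 2 (2 powr 1) \<le> log 2 (64 * x)" by (subst log_le_cancel_iff) auto
  thus ?thesis by (simp add: level_def)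
qed

lemma le_two_powr:
  fixes x :: real
  assumes "0 \<le> x"
  shows "x \<le> 2 powr x"
proof -
  define m where "m = nat \<lfloor>x\<rfloor>"
  have m: "real m \<le> x" "x < real m + 1" using assms by (auto simp: m_def)
  have "real m + 1 \<le> 2 ^ m"
    using less_exp[of m] by (metis Suc_leI of_nat_Suc add.commute of_nat_le_iff of_nat_numeral of_nat_power)
  also have "(2 :: real) ^ m = 2 powr m" by (simp add: powr_realpow)
  also have "\<dots> \<le> 2 powr x" using m by simp
  finally show ?thesis using m by simp
qed

text \<open>A weak Stirling bound, by induction from \<open>(1 + 1 / a) ^ a \<le> exp 1\<close>. It
  serves to bound the number of \<open>s\<close>-subsets of an \<open>n\<close>-set by
  \<open>(3 * n / s) ^ s\<close>.\<close>

lemma power_self_le_fact: "real a ^ a \<le> 3 ^ a * fact a"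
proof (induction a)
  case (Suc a)
  show ?case
  proof (cases "a = 0")
    case False
    have "(1 + 1 / real a) ^ a \<le> exp 1"
      by (rule exp_ge_one_plus_x_over_n_power_n) (use False in auto)
    also have "exp 1 \<le> (3 :: real)" by (rule exp_le)
    finally have e: "(1 + 1 / real a) ^ a \<le> 3" .
    have "real (Suc a) = real a * (1 + 1 / real a)" using False by (simp add: field_simps)
    hence "real (Suc a) ^ a = (real a * (1 + 1 / real a)) ^ a" by (rule arg_cong)
    also have "\<dots> = real a ^ a * (1 + 1 / real a) ^ a" by (rule power_mult_distrib)
    also have "\<dots> \<le> (3 ^ a * fact a) * 3" by (intro mult_mono Suc.IH e) auto
    finally have "real (Suc a) * real (Suc a) ^ a \<le> real (Suc a) * ((3 ^ a * fact a) * 3)"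
      by (intro mult_left_mono) auto
    thus ?thesis by (simp add: algebra_simps)
  qed simp
qed simp

text \<open>\<open>exp (- 42)\<close> is the price of isolation; 1/1280 is the guaranteed total
  probability of the candidates, a tenth of the least degree 1/128 that counts as golden.\<close>

definition join_const :: real where "join_const = exp (- 42) / 1280"

lemma join_const_bounds: "0 < join_const" "join_const < 1"
proof -
  have "exp (- 42 :: real) \<le> 1" by simp
  also have "(1 :: real) < 1280" by simp
  finally show "join_const < 1" by (simp add: join_const_def)
qed (simp add: join_const_def)

text \<open>In a golden iteration the exponent rises by at most 6: 5 from the potential and 1 from
  \<open>t\<close>. The chance of joining has to compensate for this. The cap 1/25 keeps the initial
  weight \<open>2 powr (\<theta> * (25 * lg))\<close> at most \<open>\<Delta>\<close>.\<close>

lemma exists_potential_base: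
  "\<exists>\<theta>>0. \<theta> \<le> 1/25 \<and> 2 powr (6 * \<theta>) * (1 - join_const) \<le> 1"
proof -
  define x where "x = 1 / (1 - join_const)"
  have x: "1 < x" using join_const_bounds by (simp add: x_def field_simps)
  define \<theta> where "\<theta> = min (1/25) (log 2 x / 6)"
  have "6 * \<theta> \<le> log 2 x" by (simp add: \<theta>_def)
  hence "2 powr (6 * \<theta>) \<le> 2 powr (log 2 x)" by (intro powr_mono) auto
  also have "\<dots> = x" using x by simp
  finally have "2 powr (6 * \<theta>) * (1 - join_const) \<le> x * (1 - join_const)"
    using join_const_bounds by (intro mult_right_mono) auto
  also have "\<dots> = 1" using join_const_bounds by (simp add: x_def)
  finally have "2 powr (6 * \<theta>) * (1 - join_const) \<le> 1" .
  moreover have "0 < \<theta>" "\<theta> \<le> 1/25" using x by (auto simp: \<theta>_def)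
  ultimately show ?thesis by blast
qed

section \<open>The algorithm on a fixed graph\<close>

locale sparsified_mis =
  fixes V :: "nat set" and E :: "nat rel" and \<alpha> C :: real and \<Delta> :: nat
  assumes graph: "simple_graph V E"
    and degree_le: "v \<in> V \<Longrightarrow> card (E `` {v}) \<le> \<Delta>"
    and \<Delta>_ge_2: "2 \<le> \<Delta>"
    and \<alpha>: "0 < \<alpha>" "\<alpha> < 1"
    and C_ge_1: "1 \<le> C"
begin

abbreviation "R \<equiv> phase_length \<alpha> \<Delta>"
abbreviation "reps \<equiv> num_reps C \<Delta>"
abbreviation "thr \<equiv> stall_threshold \<alpha> \<Delta>"
abbreviation "lg \<equiv> log 2 (real \<Delta>)"
abbreviation "estimate \<omega> t S v \<equiv> deg_estimate E reps \<omega> t S v"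
abbreviation "step \<equiv> mis_step E \<alpha> C \<Delta>"
abbreviation "run \<omega> t \<equiv> mis_run V E \<alpha> C \<Delta> \<omega> t"

lemma finite_V: "finite V" and E_sub: "E \<subseteq> V \<times> V" and symE: "sym E" and irreflE: "irrefl E"
  using graph by (auto simp: simple_graph_def)

lemma finite_neighbours: "finite (E `` X)"
  by (rule finite_subset[OF _ finite_V]) (use E_sub in auto)

lemma lg_ge_1: "1 \<le> lg"
proof -
  have "log 2 2 \<le> lg" using \<Delta>_ge_2 by (subst log_le_cancel_iff) auto
  thus ?thesis by simp
qed

lemma R_ge_1: "1 \<le> R"
proof -
  have "0 < \<alpha> * sqrt lg / 10" using \<alpha> lg_ge_1 by simp
  hence "0 < \<lceil>\<alpha> * sqrt lg / 10\<rceil>" by (simp add: zero_less_ceiling)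
  thus ?thesis unfolding phase_length_def by linarith
qed

lemma R_less: "real R < \<alpha> * sqrt lg / 10 + 1"
proof -
  have "0 < \<alpha> * sqrt lg / 10" using \<alpha> lg_ge_1 by simp
  hence "real R = of_int \<lceil>\<alpha> * sqrt lg / 10\<rceil>" by (simp add: phase_length_def)
  thus ?thesis by linarith
qed

lemma R_le_lg: "real R \<le> lg + 1"
proof -
  have "sqrt lg \<le> lg" using lg_ge_1
    by (simp add: real_le_lsqrt real_sqrt_le_iff' sqrt_le_D real_sqrt_ge_one power2_eq_square)
  hence "\<alpha> * sqrt lg \<le> 1 * lg" using \<alpha> lg_ge_1 by (intro mult_mono) auto
  thus ?thesis using R_less lg_ge_1 by linarith
qed

lemma thr_pos: "0 < thr" by (simp add: stall_threshold_def)

text \<open>At \<open>d = thr / 16\<close> the logarithm is already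
  \<open>2 + \<alpha> * sqrt lg / 5\<close>; the summand 2, which is \<open>log 2 (64 / 16)\<close>,
  absorbs the rounding in \<open>R < \<alpha> * sqrt lg / 10 + 1\<close>.\<close>

lemma level_of_staller:
  assumes "thr / 16 \<le> d"
  shows "2 * real R \<le> level d"
proof -
  have "2 * real R \<le> 2 + \<alpha> * sqrt lg / 5" using R_less by simp
  also have "\<dots> = log 2 (4 * thr)"
    by (subst log_mult) (auto simp: stall_threshold_def log_def ln_powr ln_realpow[of 2 2, simplified])
  also have "\<dots> \<le> log 2 (64 * d)" using assms thr_pos by simp
  finally show ?thesis by (simp add: level_def)
qed

definition nbrs :: "mis_state \<Rightarrow> nat \<Rightarrow> nat set" where
  "nbrs S v = E `` {v} \<inter> remaining S"

definition wdeg :: "mis_state \<Rightarrow> nat \<Rightarrow> real" where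
  "wdeg S v = (\<Sum>u\<in>nbrs S v. prb S u)"

text \<open>This and the next three definitions name the intermediate values of an iteration that
  \<open>mis_step\<close> binds by \<open>let\<close>; \<open>step_eq\<close> puts them together
  again.\<close>

definition stall :: "coins \<Rightarrow> nat \<Rightarrow> mis_state \<Rightarrow> nat set" where
  "stall \<omega> t S = (if R dvd t - 1 then {v \<in> remaining S. thr \<le> estimate \<omega> t S v} else stalling S)"

definition new_prb :: "coins \<Rightarrow> nat \<Rightarrow> mis_state \<Rightarrow> nat \<Rightarrow> real" where
  "new_prb \<omega> t S v = (if 2 \<le> estimate \<omega> t S v \<or> v \<in> stall \<omega> t S then prb S v / 2
     else min (2 * prb S v) (1 / 2))"

definition marked :: "coins \<Rightarrow> nat \<Rightarrow> mis_state \<Rightarrow> nat set" where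
  "marked \<omega> t S = {v \<in> remaining S. v \<notin> stall \<omega> t S \<and> \<omega> (v, t, 0) < new_prb \<omega> t S v}"

definition joined :: "coins \<Rightarrow> nat \<Rightarrow> mis_state \<Rightarrow> nat set" where
  "joined \<omega> t S = {v \<in> marked \<omega> t S. E `` {v} \<inter> marked \<omega> t S = {}}"

lemma step_eq:
  "step \<omega> t S = \<lparr>prb = new_prb \<omega> t S, remaining = remaining S - (joined \<omega> t S \<union> E `` joined \<omega> t S),
     stalling = stall \<omega> t S, indep = indep S \<union> joined \<omega> t S\<rparr>"
  unfolding mis_step_def Let_def joined_def marked_def new_prb_def[abs_def] stall_def by simp

lemma estimate_eq:
  "estimate \<omega> t S v = median (map (\<lambda>j. real (count_below (nbrs S v) (prb S) t \<omega> j)) [1..<reps + 1])"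
  unfolding deg_estimate_def sampled_nbrs_def count_below_def nbrs_def by (simp add: conj_assoc)

text \<open>New probabilities over the old neighbour set, that is, before removals. In this form the
  degree does not depend on the marking coins.\<close>

definition new_wdeg :: "coins \<Rightarrow> nat \<Rightarrow> mis_state \<Rightarrow> nat \<Rightarrow> real" where
  "new_wdeg \<omega> t S v = (\<Sum>u\<in>nbrs S v. new_prb \<omega> t S u)"

text \<open>The exponent bound ties the run to a grid of finite resolution. It covers removed nodes
  too, as \<open>prb\<close> is updated for them as well.\<close>

definition valid :: "nat \<Rightarrow> mis_state \<Rightarrow> bool" where
  "valid t S \<longleftrightarrow> remaining S \<subseteq> V \<and> (\<forall>v. \<exists>i. 1 \<le> i \<and> i \<le> t + 1 \<and> prb S v = (1/2)^i)"

lemma finite_nbrs: "finite (nbrs S v)"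
  by (simp add: nbrs_def finite_neighbours)

lemma valid_init: "valid 0 (init_state V)"
  by (auto simp: valid_def init_state_def intro: exI[of _ 1])

lemma new_prb_cases:
  assumes "valid t S"
  shows "\<exists>i. 1 \<le> i \<and> i \<le> t + 2 \<and> new_prb \<omega> t' S v = (1/2)^i"
proof -
  obtain i where i: "1 \<le> i" "i \<le> t + 1" "prb S v = (1/2)^i" using assms by (auto simp: valid_def)
  have "prb S v / 2 = (1/2)^(i+1)" using i by simp
  moreover have "min (2 * prb S v) (1/2) = (1/2)^(max 1 (i - 1))"
  proof (cases "i = 1")
    case False
    then obtain m where m: "i = Suc (Suc m)" using i by (metis One_nat_def not0_implies_Suc not_one_le_zero)
    have "(1/2)^m \<le> (1 :: real)" by (simp add: power_le_one)
    thus ?thesis using i m by (simp add: max_def)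
  qed (use i in auto)
  ultimately show ?thesis using i unfolding new_prb_def
    by (auto intro: exI[of _ "i + 1"] exI[of _ "max 1 (i - 1)"])
qed

lemma valid_step: "valid t S \<Longrightarrow> valid (Suc t) (step \<omega> t' S)"
  using new_prb_cases[of t S] unfolding valid_def step_eq by fastforce

lemma valid_run: "valid t (run \<omega> t)"
  by (induction t) (auto simp: valid_init valid_step)

lemma prb_pos: "valid t S \<Longrightarrow> 0 < prb S v"
  unfolding valid_def by (metis half_gt_zero_iff zero_less_one zero_less_power)

lemma prb_le_half:
  assumes "valid t S" shows "prb S v \<le> 1/2"
proof -
  obtain i where i: "1 \<le> i" "prb S v = (1/2)^i" using assms by (auto simp: valid_def)
  have "(1/2 :: real)^i \<le> (1/2)^1" using i by (intro power_decreasing) auto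
  with i show ?thesis by simp
qed

lemma new_prb_bounds:
  assumes "valid t S"
  shows "0 < new_prb \<omega> t' S v" "new_prb \<omega> t' S v \<le> 1/2" "new_prb \<omega> t' S v \<le> 2 * prb S v"
    "prb S v / 2 \<le> new_prb \<omega> t' S v"
  using prb_pos[OF assms, of v] prb_le_half[OF assms, of v] by (auto simp: new_prb_def)

lemma wdeg_nonneg: "valid t S \<Longrightarrow> 0 \<le> wdeg S v"
  unfolding wdeg_def by (intro sum_nonneg) (use prb_pos less_imp_le in blast)

lemma new_wdeg_nonneg: "valid t S \<Longrightarrow> 0 \<le> new_wdeg \<omega> t' S v"
  unfolding new_wdeg_def by (intro sum_nonneg) (use new_prb_bounds(1) less_imp_le in blast)

lemma new_wdeg_le: "valid t S \<Longrightarrow> new_wdeg \<omega> t' S v \<le> 2 * wdeg S v"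
  unfolding new_wdeg_def wdeg_def sum_distrib_left by (intro sum_mono new_prb_bounds(3))

section \<open>The potential and its change in one iteration\<close>

text \<open>Iteration \<open>t + 1\<close> opens a phase iff \<open>R dvd t\<close>. It then
  recomputes the stalling set, so the old flag is worth 0 at such \<open>t\<close>.\<close>

definition phase_rest :: "nat \<Rightarrow> bool \<Rightarrow> real" where
  "phase_rest t st = (if st \<and> \<not> R dvd t then real (R - t mod R) else 0)"

text \<open>\<open>phase_rest\<close> falls by 1 per iteration of a staller and the level by at
  least 1/2 where it matters; halving the former aligns the two. The factor 4 turns a drop of 1/2
  into 2, which covers a halving of \<open>p\<close> and leaves a net drop of 1.\<close>

definition potential :: "nat \<Rightarrow> real \<Rightarrow> real \<Rightarrow> bool \<Rightarrow> real" where
  "potential t p d st = - log 2 p + 4 * max (level d) (phase_rest t st / 2)"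

text \<open>Excludes just the errors that would spoil the drift: a neighbour of large degree that
  could pass for a riser, a failure of \<open>v\<close> to recognise a tiny degree, and stalling of
  \<open>v\<close> at a degree that cannot pay for a phase. Here 1/8 is 2/16, the analogue of
  \<open>thr / 16\<close> for the threshold 2.\<close>

definition reliable :: "coins \<Rightarrow> nat \<Rightarrow> mis_state \<Rightarrow> nat \<Rightarrow> bool" where
  "reliable \<omega> t S v \<longleftrightarrow> (\<forall>u\<in>nbrs S v. 10 \<le> wdeg S u \<longrightarrow> 2 \<le> estimate \<omega> t S u) \<and>
     (wdeg S v \<le> 1/8 \<longrightarrow> estimate \<omega> t S v < 2) \<and>
     (wdeg S v \<le> thr / 16 \<longrightarrow> estimate \<omega> t S v < thr)"

definition risers :: "coins \<Rightarrow> nat \<Rightarrow> mis_state \<Rightarrow> nat \<Rightarrow> nat set" where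
  "risers \<omega> t S v = {u \<in> nbrs S v. u \<notin> stall \<omega> t S \<and> estimate \<omega> t S u < 2}"

text \<open>Below 1/128 even a doubled degree has level 0, so risers need not be watched there. The
  second clause covers a \<open>v\<close> of small degree whose probability cannot be doubled
  because it is capped at 1/2.\<close>

definition golden :: "coins \<Rightarrow> nat \<Rightarrow> mis_state \<Rightarrow> nat \<Rightarrow> bool" where
  "golden \<omega> t S v \<longleftrightarrow>
     1/128 \<le> wdeg S v \<and> wdeg S v / 10 \<le> (\<Sum>u\<in>risers \<omega> t S v. prb S u) \<or>
     v \<notin> stall \<omega> t S \<and> new_prb \<omega> t S v = 1/2 \<and> wdeg S v < 1/32"

lemma phase_rest_Suc_start: "R dvd t \<Longrightarrow> phase_rest (Suc t) st \<le> real R - 1"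
  using R_ge_1 by (cases "R = 1") (auto simp: phase_rest_def mod_Suc of_nat_diff)

lemma phase_rest_Suc: "\<not> R dvd t \<Longrightarrow> st \<Longrightarrow> phase_rest (Suc t) st \<le> phase_rest t st - 1 \<and> 1 \<le> phase_rest t st"
proof -
  assume a: "\<not> R dvd t" "st"
  have "t mod R < R" using R_ge_1 by simp
  moreover have "t mod R \<noteq> 0" using a by (simp add: dvd_eq_mod_eq_0)
  ultimately show ?thesis using a
    by (auto simp: phase_rest_def mod_Suc of_nat_diff dvd_eq_mod_eq_0)
qed

lemma staller_level:
  assumes "reliable \<omega> (Suc t) S v" "R dvd t" "v \<in> stall \<omega> (Suc t) S"
  shows "2 * real R \<le> level (wdeg S v)"
proof (rule level_of_staller)
  have "thr \<le> estimate \<omega> (Suc t) S v" using assms by (simp add: stall_def)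
  thus "thr / 16 \<le> wdeg S v" using assms(1) unfolding reliable_def by linarith
qed

lemma log_new_prb_le:
  assumes "valid t S"
  shows "- log 2 (new_prb \<omega> t' S v) \<le> - log 2 (prb S v) + 1"
proof -
  have "log 2 (prb S v / 2) \<le> log 2 (new_prb \<omega> t' S v)"
    using new_prb_bounds[OF assms] prb_pos[OF assms] by simp
  moreover have "log 2 (prb S v / 2) = log 2 (prb S v) - 1"
    using prb_pos[OF assms, of v] by (subst log_divide) auto
  ultimately show ?thesis by linarith
qed

text \<open>The 5 is 1 for a halving of \<open>p\<close> and 4 for a doubling of the degree. The
  phase term cannot raise the maximum: a new staller has level at least \<open>2 * R\<close>, far
  above \<open>(R - 1) / 2\<close>, and for an old one the rest of the phase shrinks.\<close>

lemma potential_step_le: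
  assumes S: "valid t S" and rel: "reliable \<omega> (Suc t) S v"
  shows "potential (Suc t) (new_prb \<omega> (Suc t) S v) (new_wdeg \<omega> (Suc t) S v) (v \<in> stall \<omega> (Suc t) S)
    \<le> potential t (prb S v) (wdeg S v) (v \<in> stalling S) + 5"
proof -
  let ?d = "wdeg S v" and ?d' = "new_wdeg \<omega> (Suc t) S v" and ?st = "v \<in> stall \<omega> (Suc t) S"
  have "level ?d' \<le> level ?d + 1"
    by (rule level_double[OF new_wdeg_nonneg[OF S] new_wdeg_le[OF S]])
  moreover have "phase_rest (Suc t) ?st / 2 \<le> max (level ?d) (phase_rest t (v \<in> stalling S) / 2)"
  proof (cases ?st)
    case st: True
    show ?thesis
    proof (cases "R dvd t")
      case True
      thus ?thesis using staller_level[OF rel True st] phase_rest_Suc_start[OF True, of ?st] by linarith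
    next
      case False
      hence "v \<in> stalling S" using st by (simp add: stall_def)
      thus ?thesis using phase_rest_Suc[OF False, of True] st by auto
    qed
  next
    case False
    thus ?thesis using level_nonneg[of ?d] by (simp add: phase_rest_def)
  qed
  ultimately have "max (level ?d') (phase_rest (Suc t) ?st / 2) \<le>
      max (level ?d) (phase_rest t (v \<in> stalling S) / 2) + 1" by linarith
  thus ?thesis using log_new_prb_le[OF S, of \<omega> "Suc t" v] unfolding potential_def by linarith
qed

text \<open>Risers hold at most a tenth of the degree and at most double, all other neighbours
  halve: the new degree is at most \<open>3/2 * 1/10 + 1/2 = 13/20\<close> of the old one, and
  \<open>(13/20)^2 < 1/2\<close>.\<close>

lemma level_step:
  assumes S: "valid t S" and ng: "\<not> golden \<omega> t' S v"
  shows "level (new_wdeg \<omega> t' S v) \<le> max 0 (level (wdeg S v) - 1/2)"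
proof (cases "1/128 \<le> wdeg S v")
  case False
  hence "level (new_wdeg \<omega> t' S v) = 0"
    using new_wdeg_nonneg[OF S, of \<omega> t' v] new_wdeg_le[OF S, of \<omega> t' v] by (intro level_small) auto
  thus ?thesis by simp
next
  case True
  let ?Q = "risers \<omega> t' S v"
  have Q: "?Q \<subseteq> nbrs S v" by (auto simp: risers_def)
  have le: "(\<Sum>u\<in>?Q. prb S u) \<le> wdeg S v / 10" using True ng by (auto simp: golden_def)
  have sum_split: "(\<Sum>u\<in>nbrs S v. g u) = (\<Sum>u\<in>?Q. g u) + (\<Sum>u\<in>nbrs S v - ?Q. g u)" for g :: "nat \<Rightarrow> real"
    using sum.subset_diff[OF Q finite_nbrs, of g] by simp
  have "new_wdeg \<omega> t' S v = (\<Sum>u\<in>?Q. new_prb \<omega> t' S u) + (\<Sum>u\<in>nbrs S v - ?Q. new_prb \<omega> t' S u)"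
    unfolding new_wdeg_def by (rule sum_split)
  also have "(\<Sum>u\<in>?Q. new_prb \<omega> t' S u) \<le> (\<Sum>u\<in>?Q. 2 * prb S u)"
    by (intro sum_mono new_prb_bounds(3)[OF S])
  also have "(\<Sum>u\<in>nbrs S v - ?Q. new_prb \<omega> t' S u) = (\<Sum>u\<in>nbrs S v - ?Q. prb S u / 2)"
    by (rule sum.cong) (auto simp: risers_def new_prb_def)
  also have "(\<Sum>u\<in>?Q. 2 * prb S u) + (\<Sum>u\<in>nbrs S v - ?Q. prb S u / 2) =
      3/2 * (\<Sum>u\<in>?Q. prb S u) + wdeg S v / 2"
    unfolding wdeg_def sum_split[of "prb S"]
    by (simp only: sum_distrib_left[symmetric] sum_divide_distrib[symmetric]) (simp add: field_simps)
  finally have "new_wdeg \<omega> t' S v \<le> 13/20 * wdeg S v" using le by simp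
  thus ?thesis by (intro level_shrink new_wdeg_nonneg[OF S])
qed

text \<open>While \<open>v\<close> stalls or has degree at least 1/32, the maximum in the potential
  drops by 1/2, which outweighs a halving of \<open>p\<close>. Otherwise the maximum does not grow
  and \<open>p\<close> doubles.\<close>

lemma potential_step_decreases:
  assumes S: "valid t S" and rel: "reliable \<omega> (Suc t) S v" and ng: "\<not> golden \<omega> (Suc t) S v"
  shows "potential (Suc t) (new_prb \<omega> (Suc t) S v) (new_wdeg \<omega> (Suc t) S v) (v \<in> stall \<omega> (Suc t) S)
    \<le> potential t (prb S v) (wdeg S v) (v \<in> stalling S) - 1"
proof -
  let ?d = "wdeg S v" and ?d' = "new_wdeg \<omega> (Suc t) S v" and ?st = "v \<in> stall \<omega> (Suc t) S"
  have lev: "level ?d' \<le> max 0 (level ?d - 1/2)" by (rule level_step[OF S ng])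
  note lp = log_new_prb_le[OF S, of \<omega> "Suc t" v]
  consider (stall) ?st | (heavy) "\<not> ?st" "1/32 \<le> ?d" | (light) "\<not> ?st" "?d < 1/32" by linarith
  thus ?thesis
  proof cases
    case stall
    have "max (level ?d') (phase_rest (Suc t) ?st / 2) \<le>
      max (level ?d) (phase_rest t (v \<in> stalling S) / 2) - 1/2"
    proof (cases "R dvd t")
      case True
      thus ?thesis using staller_level[OF rel True stall] phase_rest_Suc_start[OF True, of ?st] lev R_ge_1
        by (simp add: max_def split: if_splits)
    next
      case False
      hence "v \<in> stalling S" using stall by (simp add: stall_def)
      thus ?thesis using phase_rest_Suc[OF False, of True] stall lev
        by (simp add: max_def split: if_splits)
    qed
    thus ?thesis using lp unfolding potential_def by linarith
  next
    case heavy
    have "max (level ?d') (phase_rest (Suc t) ?st / 2) \<le>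
      max (level ?d) (phase_rest t (v \<in> stalling S) / 2) - 1/2"
      using level_ge_1[OF heavy(2)] level_nonneg[of ?d] lev heavy(1) unfolding phase_rest_def[of "Suc t"]
      by (simp, linarith)
    thus ?thesis using lp unfolding potential_def by linarith
  next
    case light
    have "max (level ?d') (phase_rest (Suc t) ?st / 2) \<le>
      max (level ?d) (phase_rest t (v \<in> stalling S) / 2)"
      using level_nonneg[of ?d] lev light(1) unfolding phase_rest_def[of "Suc t"] by (simp, linarith)
    moreover have "estimate \<omega> (Suc t) S v < 2" using rel light unfolding reliable_def by auto
    \<comment> \<open>Were the doubling capped, the new probability would be 1/2 and the iteration
      golden.\<close>
    hence "new_prb \<omega> (Suc t) S v = 2 * prb S v"
      using ng light by (auto simp: golden_def new_prb_def min_def split: if_splits)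
    hence "log 2 (new_prb \<omega> (Suc t) S v) = log 2 (prb S v) + 1"
      using prb_pos[OF S, of v] by (simp add: log_mult)
    ultimately show ?thesis unfolding potential_def by linarith
  qed
qed

text \<open>Supplies the candidates for \<open>prob_some_isolated_mark\<close>: either
  \<open>v\<close> alone, or risers thinned out to total probability at most 1. Risers have degree
  below 10 by reliability, hence at most 20 after one update.\<close>

lemma golden_joiners:
  assumes S: "valid t S" and rel: "reliable \<omega> t' S v" and g: "golden \<omega> t' S v"
    and v: "v \<in> remaining S"
  shows "\<exists>Q. Q \<subseteq> insert v (nbrs S v) \<and> Q \<inter> stall \<omega> t' S = {} \<and> (\<Sum>u\<in>Q. new_prb \<omega> t' S u) \<le> 1 \<and>
    1/1280 \<le> (\<Sum>u\<in>Q. new_prb \<omega> t' S u) \<and> (\<forall>u\<in>Q. new_wdeg \<omega> t' S u \<le> 20)"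
  using g unfolding golden_def
proof
  assume a: "v \<notin> stall \<omega> t' S \<and> new_prb \<omega> t' S v = 1/2 \<and> wdeg S v < 1/32"
  thus ?thesis using new_wdeg_le[OF S, of \<omega> t' v] by (intro exI[of _ "{v}"]) auto
next
  let ?N = "risers \<omega> t' S v"
  assume a: "1/128 \<le> wdeg S v \<and> wdeg S v / 10 \<le> (\<Sum>u\<in>?N. prb S u)"
  have fin: "finite ?N" by (rule finite_subset[OF _ finite_nbrs[of S v]]) (auto simp: risers_def)
  have "\<exists>Q\<subseteq>?N. (\<Sum>w\<in>Q. new_prb \<omega> t' S w) \<le> 1 \<and>
      min (1/2) (\<Sum>w\<in>?N. new_prb \<omega> t' S w) \<le> (\<Sum>w\<in>Q. new_prb \<omega> t' S w)"
    by (rule sub_sum_half[OF fin]) (use new_prb_bounds[OF S] less_imp_le in blast)+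
  then obtain Q where Q: "Q \<subseteq> ?N" "(\<Sum>w\<in>Q. new_prb \<omega> t' S w) \<le> 1"
      "min (1/2) (\<Sum>w\<in>?N. new_prb \<omega> t' S w) \<le> (\<Sum>w\<in>Q. new_prb \<omega> t' S w)" by blast
  have "(\<Sum>u\<in>?N. prb S u) \<le> (\<Sum>w\<in>?N. new_prb \<omega> t' S w)"
  proof (rule sum_mono)
    fix u assume "u \<in> ?N"
    thus "prb S u \<le> new_prb \<omega> t' S u"
      using prb_pos[OF S, of u] prb_le_half[OF S, of u] by (auto simp: risers_def new_prb_def)
  qed
  hence "1/1280 \<le> (\<Sum>w\<in>Q. new_prb \<omega> t' S w)" using Q a by linarith
  moreover have "new_wdeg \<omega> t' S u \<le> 20" if "u \<in> Q" for u
  proof -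
    have "u \<in> nbrs S v" "estimate \<omega> t' S u < 2" using that Q by (auto simp: risers_def)
    hence "wdeg S u < 10" using rel unfolding reliable_def by force
    thus ?thesis using new_wdeg_le[OF S, of \<omega> t' u] by linarith
  qed
  ultimately show ?thesis using Q by (intro exI[of _ Q]) (auto simp: risers_def)
qed

subsection \<open>One iteration\<close>

text \<open>Index 0 is absent: estimates ignore the marking coins, which is what permits averaging
  over those separately.\<close>

lemma estimate_cong:
  assumes "\<And>u j. u \<in> nbrs S v \<Longrightarrow> 1 \<le> j \<Longrightarrow> j \<le> reps \<Longrightarrow> \<omega> (u, t, j) = \<omega>' (u, t, j)"
  shows "estimate \<omega> t S v = estimate \<omega>' t S v"
proof -
  have "map (\<lambda>j. real (count_below (nbrs S v) (prb S) t \<omega> j)) [1..<reps + 1] =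
      map (\<lambda>j. real (count_below (nbrs S v) (prb S) t \<omega>' j)) [1..<reps + 1]"
  proof (rule map_cong[OF refl])
    fix j assume "j \<in> set [1..<reps + 1]"
    hence j: "1 \<le> j" "j \<le> reps" by auto
    show "real (count_below (nbrs S v) (prb S) t \<omega> j) = real (count_below (nbrs S v) (prb S) t \<omega>' j)"
      by (intro arg_cong[where f = real] count_below_cong assms j)
  qed
  thus ?thesis by (simp only: estimate_eq)
qed

lemma nbrs_two_hop: "u \<in> insert v (nbrs S v) \<Longrightarrow> nbrs S u \<subseteq> two_hop E v"
  by (auto simp: nbrs_def two_hop_def)

lemma stall_cong: "estimate \<omega> t S v = estimate \<omega>' t S v \<Longrightarrow> v \<in> stall \<omega> t S \<longleftrightarrow> v \<in> stall \<omega>' t S"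
  by (simp add: stall_def)

lemma new_prb_cong: "estimate \<omega> t S v = estimate \<omega>' t S v \<Longrightarrow> new_prb \<omega> t S v = new_prb \<omega>' t S v"
  using stall_cong[of \<omega> t S v \<omega>'] by (simp add: new_prb_def)

lemma new_wdeg_cong:
  "(\<And>u. u \<in> nbrs S v \<Longrightarrow> estimate \<omega> t S u = estimate \<omega>' t S u) \<Longrightarrow> new_wdeg \<omega> t S v = new_wdeg \<omega>' t S v"
  unfolding new_wdeg_def by (rule sum.cong[OF refl]) (rule new_prb_cong)

lemma reliable_cong:
  assumes "\<And>u. u \<in> insert v (nbrs S v) \<Longrightarrow> estimate \<omega> t S u = estimate \<omega>' t S u"
  shows "reliable \<omega> t S v \<longleftrightarrow> reliable \<omega>' t S v"
proof -
  have "(10 \<le> wdeg S u \<longrightarrow> 2 \<le> estimate \<omega> t S u) = (10 \<le> wdeg S u \<longrightarrow> 2 \<le> estimate \<omega>' t S u)"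
    if "u \<in> nbrs S v" for u unfolding assms[OF insertI2[OF that]] by (rule refl)
  thus ?thesis
    unfolding reliable_def assms[OF insertI1] by (intro conj_cong ball_cong refl)
qed

section \<open>Exponential weights\<close>

definition weight :: "real \<Rightarrow> nat \<Rightarrow> mis_state \<Rightarrow> nat \<Rightarrow> real" where
  "weight \<theta> t S v = (if v \<in> remaining S
     then 2 powr (\<theta> * (t + potential t (prb S v) (wdeg S v) (v \<in> stalling S))) else 0)"

text \<open>A bound for the weight after the iteration. Once the sampling coins are fixed, only
  \<open>joined\<close> is still random in it.\<close>

definition new_weight :: "real \<Rightarrow> coins \<Rightarrow> nat \<Rightarrow> mis_state \<Rightarrow> nat \<Rightarrow> real" where
  "new_weight \<theta> \<omega> t S v = (if v \<in> remaining S \<and> insert v (E `` {v}) \<inter> joined \<omega> t S = {}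
     then 2 powr (\<theta> * (t + potential t (new_prb \<omega> t S v) (new_wdeg \<omega> t S v) (v \<in> stall \<omega> t S))) else 0)"

text \<open>Crude bound used when estimates fail: \<open>t\<close> and \<open>- log 2 p\<close>
  contribute at most \<open>2 * T + 1\<close>, the rest at most \<open>4 * (5 + lg)\<close>, and
  \<open>21 + 4 * lg \<le> 25 * lg\<close>.\<close>

definition max_weight :: "real \<Rightarrow> nat \<Rightarrow> real" where
  "max_weight \<theta> T = 2 powr (\<theta> * (2 * T + 25 * lg))"

lemma weight_nonneg: "0 \<le> weight \<theta> t S v" by (simp add: weight_def)
lemma new_weight_nonneg: "0 \<le> new_weight \<theta> \<omega> t S v" by (simp add: new_weight_def)
lemma max_weight_nonneg: "0 \<le> max_weight \<theta> T" by (simp add: max_weight_def)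

text \<open>Removals can only lower the degree of a survivor, and a removed \<open>v\<close> has
  weight 0.\<close>

lemma weight_step_le:
  assumes S: "valid t S" and \<theta>: "0 \<le> \<theta>"
  shows "weight \<theta> (Suc t) (step \<omega> (Suc t) S) v \<le> new_weight \<theta> \<omega> (Suc t) S v"
proof (cases "v \<in> remaining (step \<omega> (Suc t) S)")
  case True
  have rem: "v \<in> remaining S" "v \<notin> joined \<omega> (Suc t) S" "v \<notin> E `` joined \<omega> (Suc t) S"
    using True by (auto simp: step_eq)
  have "E `` {v} \<inter> joined \<omega> (Suc t) S = {}" using rem(3) symE by (auto dest: symD)
  moreover have "wdeg (step \<omega> (Suc t) S) v \<le> new_wdeg \<omega> (Suc t) S v"
  proof -
    have "wdeg (step \<omega> (Suc t) S) v = (\<Sum>u\<in>nbrs (step \<omega> (Suc t) S) v. new_prb \<omega> (Suc t) S u)"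
      by (simp add: wdeg_def step_eq)
    also have "\<dots> \<le> new_wdeg \<omega> (Suc t) S v"
      unfolding new_wdeg_def using new_prb_bounds(1)[OF S]
      by (intro sum_mono2 finite_nbrs) (auto simp: nbrs_def step_eq less_imp_le)
    finally show ?thesis .
  qed
  hence "level (wdeg (step \<omega> (Suc t) S) v) \<le> level (new_wdeg \<omega> (Suc t) S v)"
    by (intro level_mono wdeg_nonneg[OF valid_step[OF S]])
  hence "potential (Suc t) (prb (step \<omega> (Suc t) S) v) (wdeg (step \<omega> (Suc t) S) v) (v \<in> stalling (step \<omega> (Suc t) S)) \<le>
      potential (Suc t) (new_prb \<omega> (Suc t) S v) (new_wdeg \<omega> (Suc t) S v) (v \<in> stall \<omega> (Suc t) S)"
    by (simp add: potential_def step_eq)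
  ultimately show ?thesis using rem \<theta> True
    by (auto simp: weight_def new_weight_def intro!: mult_left_mono)
qed (auto simp: weight_def new_weight_def)

lemma new_wdeg_le_degree:
  assumes S: "valid t S" and v: "v \<in> V"
  shows "new_wdeg \<omega> t' S v \<le> real \<Delta> / 2"
proof -
  have "new_wdeg \<omega> t' S v \<le> (\<Sum>u\<in>nbrs S v. 1/2)"
    unfolding new_wdeg_def by (intro sum_mono new_prb_bounds(2)[OF S])
  also have "\<dots> = real (card (nbrs S v)) / 2" by simp
  also have "card (nbrs S v) \<le> card (E `` {v})"
    by (intro card_mono finite_neighbours) (auto simp: nbrs_def)
  also have "\<dots> \<le> \<Delta>" by (rule degree_le[OF v])
  finally show ?thesis by simp
qed

lemma new_weight_le_max:
  assumes S: "valid t S" and v: "v \<in> V" and \<theta>: "0 \<le> \<theta>" and T: "Suc t \<le> T"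
  shows "new_weight \<theta> \<omega> (Suc t) S v \<le> max_weight \<theta> T"
proof -
  let ?d = "new_wdeg \<omega> (Suc t) S v" and ?p = "new_prb \<omega> (Suc t) S v"
  obtain i where i: "1 \<le> i" "i \<le> t + 2" "?p = (1/2)^i" using new_prb_cases[OF S] by blast
  have "- log 2 ?p = real i" unfolding i(3) by (simp add: log_nat_power log_divide)
  hence p: "- log 2 ?p \<le> real T + 1" using i T by simp
  have "level ?d \<le> level (real \<Delta> / 2)"
    by (intro level_mono new_wdeg_nonneg[OF S] new_wdeg_le_degree[OF S v])
  also have "\<dots> = max 0 (log 2 (2^5 * real \<Delta>))" by (simp add: level_def)
  also have "log 2 (2^5 * real \<Delta>) = 5 + lg"
    using \<Delta>_ge_2 log_pow_cancel[of 2 5] by (subst log_mult) auto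
  finally have d: "level ?d \<le> 5 + lg" using lg_ge_1 by simp
  have "phase_rest (Suc t) (v \<in> stall \<omega> (Suc t) S) \<le> real R" by (simp add: phase_rest_def)
  hence r: "phase_rest (Suc t) (v \<in> stall \<omega> (Suc t) S) / 2 \<le> 5 + lg" using R_le_lg lg_ge_1 by linarith
  have "real (Suc t) + potential (Suc t) ?p ?d (v \<in> stall \<omega> (Suc t) S) \<le> T + (T + 1 + 4 * (5 + lg))"
    unfolding potential_def using p d r T by simp
  also have "\<dots> \<le> 2 * T + 25 * lg" using lg_ge_1 by simp
  finally show ?thesis using \<theta> unfolding new_weight_def max_weight_def
    by (auto intro!: mult_left_mono)
qed

text \<open>Marking coins are averaged with the sampling coins \<open>g\<close> fixed, because whether a node at
  distance 2 from \<open>v\<close> marks itself depends on sampling coins at distance 3.\<close>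

lemma expectation_marks_le:
  fixes \<omega> :: "coins \<Rightarrow> coins"
  assumes S: "valid t S" and v: "v \<in> V" and \<theta>: "0 \<le> \<theta>" "2 powr (6 * \<theta>) * (1 - join_const) \<le> 1"
    and T: "Suc t \<le> T" and L: "T + 1 \<le> L"
    and I: "finite I" "two_hop E v \<times> {Suc t} \<times> {0} \<subseteq> I"
    and same: "\<And>f u j. 1 \<le> j \<Longrightarrow> \<omega> f (u, Suc t, j) = g (u, Suc t, j)"
    and own: "\<And>f u. u \<in> two_hop E v \<Longrightarrow> \<omega> f (u, Suc t, 0) = f (u, Suc t, 0)"
  shows "measure_pmf.expectation (coins_pmf L I) (\<lambda>f. new_weight \<theta> (\<omega> f) (Suc t) S v) \<le>
    (if reliable g (Suc t) S v then weight \<theta> t S v else max_weight \<theta> T)" (is "?E \<le> _")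
proof (cases "v \<in> remaining S")
  case False
  thus ?thesis by (simp add: new_weight_def weight_nonneg max_weight_nonneg)
next
  case vr: True
  have est: "estimate (\<omega> f) (Suc t) S u = estimate g (Suc t) S u" for f u
    by (rule estimate_cong) (simp add: same)
  have st: "stall (\<omega> f) (Suc t) S = stall g (Suc t) S" for f
    using stall_cong[OF est] by blast
  have np: "new_prb (\<omega> f) (Suc t) S u = new_prb g (Suc t) S u" for f u
    by (rule new_prb_cong[OF est])
  have nd: "new_wdeg (\<omega> f) (Suc t) S u = new_wdeg g (Suc t) S u" for f u
    by (rule new_wdeg_cong[OF est])
  have le_const: "?E \<le> c" if "\<And>f. new_weight \<theta> (\<omega> f) (Suc t) S v \<le> c" for c
  proof -
    have "?E \<le> measure_pmf.expectation (coins_pmf L I) (\<lambda>f. c)"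
      by (intro integral_mono integrable_coins_pmf I(1) that)
    thus ?thesis by simp
  qed
  define X where "X = 2 powr (\<theta> * (Suc t + potential (Suc t) (new_prb g (Suc t) S v)
      (new_wdeg g (Suc t) S v) (v \<in> stall g (Suc t) S)))"
  \<comment> \<open>With the sampling coins fixed, the new weight is a constant times the indicator
    that nobody in the closed neighbourhood of \<open>v\<close> joins.\<close>
  have nw: "new_weight \<theta> (\<omega> f) (Suc t) S v =
      (if insert v (E `` {v}) \<inter> joined (\<omega> f) (Suc t) S = {} then X else 0)" for f
    using vr by (simp add: new_weight_def st np nd X_def)
  have w: "weight \<theta> t S v = 2 powr (\<theta> * (t + potential t (prb S v) (wdeg S v) (v \<in> stalling S)))"
    using vr by (simp add: weight_def)
  show ?thesis
  proof (cases "reliable g (Suc t) S v")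
    case False
    thus ?thesis using new_weight_le_max[OF S v \<theta>(1) T] by (simp add: le_const)
  next
    case rel: True
    show ?thesis
    proof (cases "golden g (Suc t) S v")
      case False
      have "X \<le> weight \<theta> t S v"
        unfolding X_def w using potential_step_decreases[OF S rel False] \<theta>(1)
        by (auto intro!: mult_left_mono)
      hence "new_weight \<theta> (\<omega> f) (Suc t) S v \<le> weight \<theta> t S v" for f
        unfolding nw using weight_nonneg[of \<theta> t S v] by auto
      thus ?thesis using rel by (simp add: le_const)
    next
      case True
      obtain Q where Q: "Q \<subseteq> insert v (nbrs S v)" "Q \<inter> stall g (Suc t) S = {}"
          "(\<Sum>u\<in>Q. new_prb g (Suc t) S u) \<le> 1" "1/1280 \<le> (\<Sum>u\<in>Q. new_prb g (Suc t) S u)"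
          "\<And>u. u \<in> Q \<Longrightarrow> new_wdeg g (Suc t) S u \<le> 20"
        using golden_joiners[OF S rel True vr] by blast
      \<comment> \<open>\<open>\<omega> f\<close> follows \<open>f\<close> only inside the 2-hop
        neighbourhood, so marks are compared only there. This suffices, since candidates and their
        remaining neighbours all lie inside it.\<close>
      define mk where "mk = (\<lambda>f :: coins. {w \<in> remaining S. w \<notin> stall g (Suc t) S \<and>
          f (w, Suc t, 0) < new_prb g (Suc t) S w})"
      have Qv: "Q \<subseteq> insert v (E `` {v})" "Q \<subseteq> remaining S" using Q(1) vr by (auto simp: nbrs_def)
      have hop: "Q \<union> (E `` Q \<inter> remaining S) \<subseteq> two_hop E v"
        using Qv by (auto simp: two_hop_def)
      have mk: "marked (\<omega> f) (Suc t) S \<inter> two_hop E v = mk f \<inter> two_hop E v" for f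
        unfolding marked_def mk_def st np using own by auto
      have "1/1280 * exp (- 42) \<le> (\<Sum>w\<in>Q. new_prb g (Suc t) S w) * exp (- 42)"
        using Q(4) by (intro mult_right_mono) auto
      also have "\<dots> \<le> measure_pmf.prob (coins_pmf L I) {f. \<exists>u\<in>Q. u \<in> mk f \<and> E `` {u} \<inter> mk f = {}}"
        unfolding mk_def
      proof (rule prob_some_isolated_mark)
        show "(\<lambda>w. (w, Suc t, 0)) ` (Q \<union> (E `` Q \<inter> remaining S)) \<subseteq> I"
          using hop I(2) by blast
        show "\<exists>i\<ge>1. i \<le> L \<and> new_prb g (Suc t) S w = (1/2)^i" for w
          using new_prb_cases[OF S, of g "Suc t" w] T L by force
        show "finite Q" using Q(1) finite_nbrs finite_subset by blast
        show "finite (remaining S)" using S finite_V finite_subset by (auto simp: valid_def)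
        show "(\<Sum>w\<in>E `` {u} \<inter> remaining S. new_prb g (Suc t) S w) \<le> 20" if "u \<in> Q" for u
          using Q(5)[OF that] by (simp add: new_wdeg_def nbrs_def)
      qed (use I Q Qv irreflE in auto)
      also have "\<dots> \<le> measure_pmf.prob (coins_pmf L I) {f. insert v (E `` {v}) \<inter> joined (\<omega> f) (Suc t) S \<noteq> {}}"
      proof (rule measure_pmf.finite_measure_mono, rule subsetI, unfold mem_Collect_eq)
        fix f assume "\<exists>u\<in>Q. u \<in> mk f \<and> E `` {u} \<inter> mk f = {}"
        then obtain u where u: "u \<in> Q" "u \<in> mk f" "E `` {u} \<inter> mk f = {}" by blast
        have "u \<in> marked (\<omega> f) (Suc t) S" using u hop mk[of f] by blast
        moreover have "E `` {u} \<inter> marked (\<omega> f) (Suc t) S = {}"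
        proof -
          have "E `` {u} \<inter> marked (\<omega> f) (Suc t) S \<subseteq> two_hop E v"
            using hop u(1) by (auto simp: marked_def)
          thus ?thesis using u(3) mk[of f] by blast
        qed
        ultimately have "u \<in> joined (\<omega> f) (Suc t) S" by (simp add: joined_def)
        thus "insert v (E `` {v}) \<inter> joined (\<omega> f) (Suc t) S \<noteq> {}" using u Qv by blast
      qed simp
      finally have cov: "join_const \<le> measure_pmf.prob (coins_pmf L I)
          {f. insert v (E `` {v}) \<inter> joined (\<omega> f) (Suc t) S \<noteq> {}}" by (simp add: join_const_def)
      have "?E = X - X * measure_pmf.prob (coins_pmf L I)
          {f. insert v (E `` {v}) \<inter> joined (\<omega> f) (Suc t) S \<noteq> {}}"
      proof -
        have "?E = measure_pmf.expectation (coins_pmf L I)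
            (\<lambda>f. if insert v (E `` {v}) \<inter> joined (\<omega> f) (Suc t) S \<noteq> {} then 0 else X)"
          unfolding nw by (rule arg_cong[where f = "measure_pmf.expectation _"]) auto
        also have "\<dots> = X + (0 - X) * measure_pmf.prob (coins_pmf L I)
            {f. insert v (E `` {v}) \<inter> joined (\<omega> f) (Suc t) S \<noteq> {}}"
          by (rule expectation_coins_if[OF I(1)])
        finally show ?thesis by simp
      qed
      also have "\<dots> \<le> X * (1 - join_const)"
      proof -
        have "X * join_const \<le> X * measure_pmf.prob (coins_pmf L I)
            {f. insert v (E `` {v}) \<inter> joined (\<omega> f) (Suc t) S \<noteq> {}}"
          using cov by (intro mult_left_mono) (auto simp: X_def)
        thus ?thesis by (simp add: right_diff_distrib)
      qed
      also have "\<dots> \<le> (weight \<theta> t S v * 2 powr (6 * \<theta>)) * (1 - join_const)"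
      proof (rule mult_right_mono)
        have "weight \<theta> t S v * 2 powr (6 * \<theta>) =
            2 powr (\<theta> * (t + potential t (prb S v) (wdeg S v) (v \<in> stalling S) + 6))"
          unfolding w powr_add[symmetric] by (simp add: algebra_simps)
        thus "X \<le> weight \<theta> t S v * 2 powr (6 * \<theta>)"
          using potential_step_le[OF S rel] \<theta>(1) unfolding X_def by (auto intro!: mult_left_mono)
        show "0 \<le> 1 - join_const" using join_const_bounds by simp
      qed
      also have "\<dots> = weight \<theta> t S v * (2 powr (6 * \<theta>) * (1 - join_const))" by simp
      also have "\<dots> \<le> weight \<theta> t S v * 1"
        by (intro mult_left_mono \<theta>(2) weight_nonneg)
      finally show ?thesis using rel by simp
    qed
  qed
qed

text \<open>One failing median for each of at most \<open>\<Delta>\<close> neighbours and two for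
  \<open>v\<close> itself.\<close>

definition fail_prob :: real where "fail_prob = (real \<Delta> + 2) * (1/2) ^ reps"

lemma reps_ge_1: "1 \<le> reps"
proof -
  have "0 < 12 * C * lg" using C_ge_1 lg_ge_1 by (intro mult_pos_pos) auto
  thus ?thesis unfolding num_reps_def by linarith
qed

lemma prob_unreliable:
  assumes S: "valid t S" and v: "v \<in> V" and L: "t + 1 \<le> L"
    and I: "finite I" "two_hop E v \<times> {t'} \<times> {1..reps} \<subseteq> I"
  shows "measure_pmf.prob (coins_pmf L I) {f. \<not> reliable f t' S v} \<le> fail_prob"
proof -
  let ?P = "\<lambda>A. measure_pmf.prob (coins_pmf L I) A"
  define B where "B = (\<lambda>u. {f. 10 \<le> wdeg S u \<and> estimate f t' S u < 2})"
  define B1 where "B1 = {f. wdeg S v \<le> 1/8 \<and> 2 \<le> estimate f t' S v}"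
  define B2 where "B2 = {f. wdeg S v \<le> thr / 16 \<and> thr \<le> estimate f t' S v}"
  have p: "\<exists>i\<le>L. prb S u = (1/2)^i" for u using S L unfolding valid_def by (meson le_trans)
  have sub: "nbrs S u \<times> {t'} \<times> {1..reps} \<subseteq> I" if "u \<in> insert v (nbrs S v)" for u
    using nbrs_two_hop[OF that] I(2) by blast
  have B: "?P (B u) \<le> (1/2)^reps" if u: "u \<in> nbrs S v" for u
  proof (cases "10 \<le> wdeg S u")
    case True
    thus ?thesis unfolding B_def estimate_eq wdeg_def
      using prob_median_less_2[OF finite_nbrs p _ reps_ge_1 I(1) sub] u by simp
  qed (simp add: B_def)
  have ge: "?P {f. wdeg S v \<le> \<tau> / 16 \<and> \<tau> \<le> estimate f t' S v} \<le> (1/2)^reps" if "0 < \<tau>" for \<tau>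
  proof (cases "wdeg S v \<le> \<tau> / 16")
    case True
    thus ?thesis unfolding estimate_eq wdeg_def
      using prob_median_ge[OF finite_nbrs p that _ reps_ge_1 I(1) sub] by simp
  qed simp
  have B1: "?P B1 \<le> (1/2)^reps" using ge[of 2] by (simp add: B1_def)
  have B2: "?P B2 \<le> (1/2)^reps" unfolding B2_def by (rule ge[OF thr_pos])
  have "?P {f. \<not> reliable f t' S v} \<le> ?P ((\<Union>u\<in>nbrs S v. B u) \<union> (B1 \<union> B2))"
    by (rule measure_pmf.finite_measure_mono) (auto simp: reliable_def B_def B1_def B2_def)
  also have "\<dots> \<le> ?P (\<Union>u\<in>nbrs S v. B u) + (?P B1 + ?P B2)"
    by (intro order_trans[OF measure_Un_le] add_left_mono measure_Un_le) auto
  also have "?P (\<Union>u\<in>nbrs S v. B u) \<le> (\<Sum>u\<in>nbrs S v. ?P (B u))"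
    by (rule measure_pmf.finite_measure_subadditive_finite) (auto simp: finite_nbrs)
  also have "\<dots> \<le> (\<Sum>u\<in>nbrs S v. (1/2)^reps)" by (intro sum_mono B)
  also have "\<dots> = real (card (nbrs S v)) * (1/2)^reps" by simp
  also have "\<dots> \<le> real \<Delta> * (1/2)^reps"
  proof (intro mult_right_mono of_nat_mono)
    have "card (nbrs S v) \<le> card (E `` {v})"
      by (intro card_mono finite_neighbours) (auto simp: nbrs_def)
    thus "card (nbrs S v) \<le> \<Delta>" using degree_le[OF v] by simp
  qed auto
  finally show ?thesis using B1 B2 by (simp add: fail_prob_def algebra_simps)
qed

text \<open>The constant \<open>c\<close> stands for the error to be spent in later iterations.
  Inside the factors it lets the bound be iterated without expanding the product.\<close>

lemma expectation_step_le:
  assumes S: "valid t S" and \<theta>: "0 \<le> \<theta>" "2 powr (6 * \<theta>) * (1 - join_const) \<le> 1"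
    and T: "Suc t \<le> T" and L: "T + 1 \<le> L"
    and A: "finite A" "A \<subseteq> V" "disjoint_family_on (two_hop E) A"
    and U: "finite U" "\<And>v. v \<in> A \<Longrightarrow> two_hop E v \<subseteq> U"
    and c: "0 \<le> c"
  shows "measure_pmf.expectation (coins_pmf L (U \<times> {Suc t} \<times> {0..reps}))
      (\<lambda>f. \<Prod>v\<in>A. new_weight \<theta> (override_on \<xi> f (U \<times> {Suc t} \<times> {0..reps})) (Suc t) S v + c) \<le>
    (\<Prod>v\<in>A. weight \<theta> t S v + fail_prob * max_weight \<theta> T + c)"
proof -
  define Im where "Im = U \<times> {Suc t} \<times> {0 :: nat}"
  define Is where "Is = U \<times> {Suc t} \<times> {1..reps}"
  have I: "U \<times> {Suc t} \<times> {0..reps} - Im = Is" "Im \<subseteq> U \<times> {Suc t} \<times> {0..reps}"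
    by (auto simp: Im_def Is_def)
  have fin: "finite Im" "finite Is" using U by (auto simp: Im_def Is_def)
  let ?r = "\<lambda>g v. if reliable (override_on \<xi> g Is) (Suc t) S v then weight \<theta> t S v else max_weight \<theta> T"
  have ov: "override_on \<xi> (override_on g f Im) (U \<times> {Suc t} \<times> {0..reps}) =
      override_on (override_on \<xi> g Is) f Im" for f g
    by (auto simp: override_on_def Im_def Is_def)
  have est_marks: "estimate (override_on g f Im) (Suc t) S u =
      estimate (override_on g f' Im) (Suc t) S u" for f f' g u
    by (rule estimate_cong) (auto simp: override_on_def Im_def)
  have "measure_pmf.expectation (coins_pmf L (U \<times> {Suc t} \<times> {0..reps}))
      (\<lambda>f. \<Prod>v\<in>A. new_weight \<theta> (override_on \<xi> f (U \<times> {Suc t} \<times> {0..reps})) (Suc t) S v + c) =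
    measure_pmf.expectation (coins_pmf L (U \<times> {Suc t} \<times> {0..reps} - Im)) (\<lambda>g. measure_pmf.expectation (coins_pmf L Im)
      (\<lambda>f. \<Prod>v\<in>A. new_weight \<theta> (override_on \<xi> (override_on g f Im) (U \<times> {Suc t} \<times> {0..reps})) (Suc t) S v + c))"
    unfolding coins_pmf_def
    by (rule expectation_Pi_pmf_split) (use U(1) I(2) finite_set_grid in auto)
  also have "\<dots> = measure_pmf.expectation (coins_pmf L Is) (\<lambda>g. measure_pmf.expectation (coins_pmf L Im)
      (\<lambda>f. \<Prod>v\<in>A. new_weight \<theta> (override_on (override_on \<xi> g Is) f Im) (Suc t) S v + c))"
    by (simp only: I(1) ov)
  \<comment> \<open>For fixed sampling coins the factors read marking coins of disjoint 2-hop
    neighbourhoods, even though the marking thresholds may depend on sampling coins further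
    away.\<close>
  also have "\<dots> \<le> measure_pmf.expectation (coins_pmf L Is) (\<lambda>g. \<Prod>v\<in>A. ?r g v + c)"
  proof (rule integral_mono[OF integrable_coins_pmf[OF fin(2)] integrable_coins_pmf[OF fin(2)]])
    fix g
    define g' where "g' = override_on \<xi> g Is"
    show "measure_pmf.expectation (coins_pmf L Im)
      (\<lambda>f. \<Prod>v\<in>A. new_weight \<theta> (override_on g' f Im) (Suc t) S v + c) \<le> (\<Prod>v\<in>A.
        (if reliable g' (Suc t) S v then weight \<theta> t S v else max_weight \<theta> T) + c)"
      unfolding coins_pmf_def
    proof (rule expectation_prod_disjoint_le[where J = "\<lambda>v. two_hop E v \<times> {Suc t} \<times> {0}"])
      fix v assume v: "v \<in> A"
      show "two_hop E v \<times> {Suc t} \<times> {0} \<subseteq> Im" using U(2)[OF v] by (auto simp: Im_def)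
      have finJ: "finite (two_hop E v \<times> {Suc t} \<times> {0 :: nat})"
        using finite_subset[OF U(2)[OF v] U(1)] by simp
      have "measure_pmf.expectation (coins_pmf L (two_hop E v \<times> {Suc t} \<times> {0}))
          (\<lambda>f. new_weight \<theta> (override_on g' f Im) (Suc t) S v) \<le>
        (if reliable g' (Suc t) S v then weight \<theta> t S v else max_weight \<theta> T)"
        by (rule expectation_marks_le[OF S _ \<theta> T L finJ])
           (use A(2) v U(2)[OF v] in \<open>auto simp: override_on_def Im_def\<close>)
      moreover have "measure_pmf.expectation (coins_pmf L (two_hop E v \<times> {Suc t} \<times> {0}))
          (\<lambda>f. new_weight \<theta> (override_on g' f Im) (Suc t) S v + c) =
        measure_pmf.expectation (coins_pmf L (two_hop E v \<times> {Suc t} \<times> {0}))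
          (\<lambda>f. new_weight \<theta> (override_on g' f Im) (Suc t) S v) + c"
        using finJ by (subst Bochner_Integration.integral_add) auto
      ultimately show "measure_pmf.expectation (Pi_pmf (two_hop E v \<times> {Suc t} \<times> {0}) 0 (\<lambda>_. grid L))
          (\<lambda>f. new_weight \<theta> (override_on g' f Im) (Suc t) S v + c) \<le>
        (if reliable g' (Suc t) S v then weight \<theta> t S v else max_weight \<theta> T) + c"
        unfolding coins_pmf_def by simp
      fix f f' :: coins assume eq: "\<And>x. x \<in> two_hop E v \<times> {Suc t} \<times> {0} \<Longrightarrow> f x = f' x"
      let ?o = "override_on g' f Im" and ?o' = "override_on g' f' Im"
      have st: "stall ?o (Suc t) S = stall ?o' (Suc t) S" using stall_cong[OF est_marks] by blast
      have np: "new_prb ?o (Suc t) S u = new_prb ?o' (Suc t) S u" for u by (rule new_prb_cong[OF est_marks])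
      have nd: "new_wdeg ?o (Suc t) S u = new_wdeg ?o' (Suc t) S u" for u by (rule new_wdeg_cong[OF est_marks])
      have "u \<in> marked ?o (Suc t) S \<longleftrightarrow> u \<in> marked ?o' (Suc t) S" if "u \<in> two_hop E v" for u
      proof -
        have "?o (u, Suc t, 0) = ?o' (u, Suc t, 0)" using that eq by (simp add: override_on_def)
        thus ?thesis by (simp add: marked_def st np)
      qed
      hence mk: "marked ?o (Suc t) S \<inter> two_hop E v = marked ?o' (Suc t) S \<inter> two_hop E v" by blast
      have "u \<in> joined ?o (Suc t) S \<longleftrightarrow> u \<in> joined ?o' (Suc t) S" if u: "u \<in> insert v (E `` {v})" for u
      proof -
        have "E `` {u} \<subseteq> two_hop E v" "u \<in> two_hop E v" using u by (auto simp: two_hop_def)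
        thus ?thesis unfolding joined_def using mk by blast
      qed
      hence "insert v (E `` {v}) \<inter> joined ?o (Suc t) S = insert v (E `` {v}) \<inter> joined ?o' (Suc t) S" by blast
      thus "new_weight \<theta> ?o (Suc t) S v + c = new_weight \<theta> ?o' (Suc t) S v + c"
        unfolding new_weight_def st np nd by simp
    next
      show "disjoint_family_on (\<lambda>v. two_hop E v \<times> {Suc t} \<times> {0}) A"
        using A(3) by (simp add: disjoint_family_on_def Times_Int_Times)
      show "0 \<le> new_weight \<theta> (override_on g' f Im) (Suc t) S v + c" for v f
        using new_weight_nonneg[of \<theta> "override_on g' f Im" "Suc t" S v] c by linarith
    qed (rule A fin finite_set_grid)+
  qed
  \<comment> \<open>Reliability reads only sampling coins within two hops, so the remaining factors
    are independent as well.\<close>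
  also have "\<dots> \<le> (\<Prod>v\<in>A. weight \<theta> t S v + fail_prob * max_weight \<theta> T + c)"
    unfolding coins_pmf_def
  proof (rule expectation_prod_disjoint_le[where J = "\<lambda>v. two_hop E v \<times> {Suc t} \<times> {1..reps}"])
    fix v assume v: "v \<in> A"
    let ?J = "two_hop E v \<times> {Suc t} \<times> {1..reps}"
    show sub: "?J \<subseteq> Is" using U(2)[OF v] by (auto simp: Is_def)
    then have finJ: "finite ?J" by (rule finite_subset[OF _ fin(2)])
    have rel: "reliable (override_on \<xi> f Is) (Suc t) S v \<longleftrightarrow> reliable f' (Suc t) S v"
      if "\<And>x. x \<in> ?J \<Longrightarrow> override_on \<xi> f Is x = f' x" for f f'
    proof (intro reliable_cong estimate_cong)
      fix u w j assume "u \<in> insert v (nbrs S v)" "w \<in> nbrs S u" "1 \<le> j" "j \<le> reps"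
      hence "(w, Suc t, j) \<in> ?J" using nbrs_two_hop by auto
      thus "override_on \<xi> f Is (w, Suc t, j) = f' (w, Suc t, j)" by (rule that)
    qed
    show "?r f v + c = ?r f' v + c" if "\<And>x. x \<in> ?J \<Longrightarrow> f x = f' x" for f f'
    proof -
      have "reliable (override_on \<xi> f Is) (Suc t) S v \<longleftrightarrow> reliable (override_on \<xi> f' Is) (Suc t) S v"
        by (rule rel) (use that in \<open>auto simp: override_on_def\<close>)
      thus ?thesis by simp
    qed
    have "measure_pmf.expectation (coins_pmf L ?J) (\<lambda>f. ?r f v + c) =
        measure_pmf.expectation (coins_pmf L ?J)
          (\<lambda>f. if \<not> reliable f (Suc t) S v then max_weight \<theta> T + c else weight \<theta> t S v + c)"
    proof (rule arg_cong[where f = "measure_pmf.expectation _"], rule ext)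
      fix f
      have "reliable (override_on \<xi> f Is) (Suc t) S v \<longleftrightarrow> reliable f (Suc t) S v"
        by (rule rel) (use sub in \<open>auto simp: override_on_def\<close>)
      thus "?r f v + c = (if \<not> reliable f (Suc t) S v then max_weight \<theta> T + c else weight \<theta> t S v + c)"
        by simp
    qed
    also have "\<dots> = weight \<theta> t S v + c + (max_weight \<theta> T - weight \<theta> t S v) *
        measure_pmf.prob (coins_pmf L ?J) {f. \<not> reliable f (Suc t) S v}"
      by (subst expectation_coins_if[OF finJ]) simp
    also have "\<dots> \<le> weight \<theta> t S v + c + max_weight \<theta> T * fail_prob"
    proof -
      have "(max_weight \<theta> T - weight \<theta> t S v) * measure_pmf.prob (coins_pmf L ?J) {f. \<not> reliable f (Suc t) S v}
        \<le> max_weight \<theta> T * measure_pmf.prob (coins_pmf L ?J) {f. \<not> reliable f (Suc t) S v}"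
        by (intro mult_right_mono) (auto simp: weight_nonneg)
      also have "\<dots> \<le> max_weight \<theta> T * fail_prob"
        by (intro mult_left_mono max_weight_nonneg prob_unreliable[OF S _ _ finJ])
           (use A(2) v T L in auto)
      finally show ?thesis by simp
    qed
    finally show "measure_pmf.expectation (Pi_pmf ?J 0 (\<lambda>_. grid L)) (\<lambda>f. ?r f v + c) \<le>
        weight \<theta> t S v + fail_prob * max_weight \<theta> T + c"
      unfolding coins_pmf_def by (simp add: mult.commute)
  next
    show "disjoint_family_on (\<lambda>v. two_hop E v \<times> {Suc t} \<times> {1..reps}) A"
      using A(3) by (simp add: disjoint_family_on_def Times_Int_Times)
    show "0 \<le> ?r g v + c" for v g
      using weight_nonneg[of \<theta> t S v] max_weight_nonneg[of \<theta> T] c by simp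
  qed (rule A fin finite_set_grid)+
  finally show ?thesis .
qed

subsection \<open>Many iterations\<close>

text \<open>A run consults its coins only through comparisons with powers of 1/2; at iteration
  \<open>s\<close> the exponents reach \<open>s + 1\<close>. This covers both coins that agree and
  coins that agree after rounding.\<close>

lemma run_threshold_cong:
  assumes "\<And>u s j i. u \<in> V \<Longrightarrow> 1 \<le> s \<Longrightarrow> s \<le> t \<Longrightarrow> j \<le> reps \<Longrightarrow> i \<le> t + 1 \<Longrightarrow>
    \<omega> (u, s, j) < (1/2)^i \<longleftrightarrow> \<omega>' (u, s, j) < (1/2)^i"
  shows "run \<omega> t = run \<omega>' t"
  using assms
proof (induction t)
  case (Suc t)
  have IH: "run \<omega> t = run \<omega>' t"
    by (rule Suc.IH) (rule Suc.prems; simp)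
  define S where "S = run \<omega> t"
  have S: "valid t S" unfolding S_def by (rule valid_run)
  have coin: "\<omega> (u, Suc t, j) < (1/2)^i \<longleftrightarrow> \<omega>' (u, Suc t, j) < (1/2)^i"
    if "u \<in> V" "j \<le> reps" "i \<le> t + 2" for u j i
    by (rule Suc.prems) (use that in auto)
  have cnt: "count_below (nbrs S v) (prb S) (Suc t) \<omega> j = count_below (nbrs S v) (prb S) (Suc t) \<omega>' j"
    if "j \<le> reps" for v j
  proof -
    have "\<omega> (u, Suc t, j) < prb S u \<longleftrightarrow> \<omega>' (u, Suc t, j) < prb S u" if u: "u \<in> nbrs S v" for u
    proof -
      obtain i where i: "i \<le> t + 1" "prb S u = (1/2)^i" using S by (auto simp: valid_def)
      have "u \<in> V" using u E_sub by (auto simp: nbrs_def)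
      thus ?thesis using coin[of u j i] i \<open>j \<le> reps\<close> by simp
    qed
    thus ?thesis unfolding count_below_def by (intro arg_cong[where f = card]) blast
  qed
  have est: "estimate \<omega> (Suc t) S v = estimate \<omega>' (Suc t) S v" for v
  proof -
    have "map (\<lambda>j. real (count_below (nbrs S v) (prb S) (Suc t) \<omega> j)) [1..<reps + 1] =
        map (\<lambda>j. real (count_below (nbrs S v) (prb S) (Suc t) \<omega>' j)) [1..<reps + 1]"
      by (rule map_cong[OF refl]) (rule arg_cong[where f = real], rule cnt, auto)
    thus ?thesis by (simp only: estimate_eq)
  qed
  have st: "stall \<omega> (Suc t) S = stall \<omega>' (Suc t) S" using stall_cong[OF est] by blast
  have np: "new_prb \<omega> (Suc t) S = new_prb \<omega>' (Suc t) S" using new_prb_cong[OF est] by blast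
  have "v \<in> marked \<omega> (Suc t) S \<longleftrightarrow> v \<in> marked \<omega>' (Suc t) S" for v
  proof (cases "v \<in> remaining S")
    case True
    hence v: "v \<in> V" using S by (auto simp: valid_def)
    obtain i where i: "i \<le> t + 2" "new_prb \<omega>' (Suc t) S v = (1/2)^i" using new_prb_cases[OF S] by blast
    show ?thesis using coin[OF v _ i(1), of 0] i(2) by (simp add: marked_def st np)
  qed (simp add: marked_def)
  hence mk: "marked \<omega> (Suc t) S = marked \<omega>' (Suc t) S" by blast
  have "step \<omega> (Suc t) S = step \<omega>' (Suc t) S"
    by (simp add: step_eq st np joined_def mk)
  thus ?case unfolding mis_run.simps IH[symmetric] S_def[symmetric] .
qed simp

lemma run_cong:
  assumes "\<And>u s j. u \<in> V \<Longrightarrow> 1 \<le> s \<Longrightarrow> s \<le> t \<Longrightarrow> j \<le> reps \<Longrightarrow> \<omega> (u, s, j) = \<omega>' (u, s, j)"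
  shows "run \<omega> t = run \<omega>' t"
  by (rule run_threshold_cong) (simp add: assms)

text \<open>The bridge from the original coin space to the grid. \<open>P\<close> is arbitrary, as
  only finitely many comparisons decide the final state.\<close>

lemma measure_coin_space_run:
  assumes U: "finite U" and L: "T + 1 \<le> L"
  shows "measure (coin_space U T reps)
      {\<omega> \<in> space (coin_space U T reps). P (run (override_on \<xi> \<omega> (coin_index U T reps)) T)} =
    measure_pmf.prob (coins_pmf L (coin_index U T reps))
      {\<omega>. P (run (override_on \<xi> \<omega> (coin_index U T reps)) T)}"
  unfolding coin_space_def unit_coin_def[symmetric]
proof (rule measure_PiM_unit_coin)
  show "finite (coin_index U T reps)" using U by (simp add: coin_index_def)
  fix \<omega> \<omega>' :: coins
  assume eq: "\<And>x. x \<in> coin_index U T reps \<Longrightarrow> grid_index L (\<omega> x) = grid_index L (\<omega>' x)"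
  have "run (override_on \<xi> \<omega> (coin_index U T reps)) T = run (override_on \<xi> \<omega>' (coin_index U T reps)) T"
  proof (rule run_threshold_cong)
    fix u s j i assume "i \<le> T + 1"
    thus "override_on \<xi> \<omega> (coin_index U T reps) (u, s, j) < (1/2)^i \<longleftrightarrow>
        override_on \<xi> \<omega>' (coin_index U T reps) (u, s, j) < (1/2)^i"
      using less_half_power_grid_index[OF eq, of "(u, s, j)" i] L
      by (cases "(u, s, j) \<in> coin_index U T reps") auto
  qed
  thus "P (run (override_on \<xi> \<omega> (coin_index U T reps)) T) = P (run (override_on \<xi> \<omega>' (coin_index U T reps)) T)"
    by simp
qed

lemma remaining_antimono: "s \<le> t \<Longrightarrow> remaining (run \<omega> t) \<subseteq> remaining (run \<omega> s)"
  by (induction t rule: dec_induct) (auto simp: step_eq)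

lemma remaining_sub: "remaining (run \<omega> t) \<subseteq> V"
  using valid_run[of t \<omega>] by (simp add: valid_def)

lemma remaining_iff:
  assumes "v \<in> V"
  shows "v \<in> remaining (run \<omega> t) \<longleftrightarrow> insert v (E `` {v}) \<inter> indep (run \<omega> t) = {}"
proof (induction t)
  case 0
  show ?case using assms by (simp add: init_state_def)
next
  case (Suc t)
  have "E `` {v} \<inter> J = {} \<longleftrightarrow> v \<notin> E `` J" for J using symE by (auto dest: symD)
  thus ?case using Suc by (auto simp: step_eq)
qed

lemma covered_iff: "v \<in> V \<Longrightarrow> covered V E \<alpha> C \<Delta> t v \<omega> \<longleftrightarrow> v \<notin> remaining (run \<omega> t)"
  by (simp add: covered_def remaining_iff)

lemma fail_prob_nonneg: "0 \<le> fail_prob" by (simp add: fail_prob_def)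

text \<open>The initial degree is at most \<open>\<Delta> / 2\<close>, so its level is at most
  \<open>log 2 (2^5 * \<Delta>)\<close> and the potential at most
  \<open>1 + 4 * (5 + lg) \<le> 25 * lg\<close>.\<close>

lemma initial_weight_le:
  assumes \<theta>: "0 \<le> \<theta>" and v: "v \<in> V"
  shows "weight \<theta> 0 (init_state V) v \<le> 2 powr (\<theta> * (25 * lg))"
proof -
  have "wdeg (init_state V) v \<le> real \<Delta> / 2"
  proof -
    have "wdeg (init_state V) v = real (card (nbrs (init_state V) v)) / 2"
      by (simp add: wdeg_def init_state_def)
    moreover have "card (nbrs (init_state V) v) \<le> card (E `` {v})"
      by (intro card_mono finite_neighbours) (auto simp: nbrs_def)
    ultimately show ?thesis using degree_le[OF v] by simp
  qed
  hence "level (wdeg (init_state V) v) \<le> level (real \<Delta> / 2)"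
    by (intro level_mono wdeg_nonneg[OF valid_init])
  also have "\<dots> = max 0 (log 2 (2^5 * real \<Delta>))" by (simp add: level_def)
  also have "log 2 (2^5 * real \<Delta>) = 5 + lg"
    using \<Delta>_ge_2 log_pow_cancel[of 2 5] by (subst log_mult) auto
  finally have "level (wdeg (init_state V) v) \<le> 5 + lg" using lg_ge_1 by simp
  hence "potential 0 (1/2) (wdeg (init_state V) v) False \<le> 25 * lg"
    using lg_ge_1 level_nonneg[of "wdeg (init_state V) v"]
    by (simp add: potential_def phase_rest_def log_divide)
  thus ?thesis using \<theta> v by (auto simp: weight_def init_state_def intro!: mult_left_mono)
qed

text \<open>Only the coins of iteration \<open>Suc t\<close> are redrawn: earlier ones determine the
  state, later ones are not yet read. Granting each factor one error term per outstanding iteration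
  makes the expectation decrease exactly.\<close>

lemma expectation_run_step:
  fixes \<xi> :: coins
  assumes \<theta>: "0 \<le> \<theta>" "2 powr (6 * \<theta>) * (1 - join_const) \<le> 1"
    and t: "Suc t \<le> T" "T \<le> T'" and L: "T + 1 \<le> L"
    and A: "finite A" "A \<subseteq> V" "disjoint_family_on (two_hop E) A"
    and U: "finite U" "\<And>v. v \<in> A \<Longrightarrow> two_hop E v \<subseteq> U"
  defines "I \<equiv> coin_index U T' reps"
  defines "Y \<equiv> \<lambda>t f. \<Prod>v\<in>A. weight \<theta> t (run (override_on \<xi> f I) t) v +
      real (T - t) * (fail_prob * max_weight \<theta> T)"
  shows "measure_pmf.expectation (coins_pmf L I) (Y (Suc t)) \<le> measure_pmf.expectation (coins_pmf L I) (Y t)"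
proof -
  define J where "J = U \<times> {Suc t} \<times> {0..reps}"
  define c where "c = real (T - Suc t) * (fail_prob * max_weight \<theta> T)"
  have J: "J \<subseteq> I" using t by (auto simp: J_def I_def coin_index_def)
  have fin: "finite I" "finite J" "finite (I - J)" using U by (auto simp: I_def J_def coin_index_def)
  have c: "0 \<le> c" by (simp add: c_def fail_prob_nonneg max_weight_nonneg)
  have split: "measure_pmf.expectation (coins_pmf L I) h =
      measure_pmf.expectation (coins_pmf L (I - J)) (\<lambda>g. measure_pmf.expectation (coins_pmf L J)
        (\<lambda>f. h (override_on g f J)))" for h :: "coins \<Rightarrow> real"
    unfolding coins_pmf_def
    by (rule expectation_Pi_pmf_split) (use fin J finite_set_grid in auto)
  have ov: "override_on \<xi> (override_on g f J) I = override_on (override_on \<xi> g (I - J)) f J" for f g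
    using J by (auto simp: override_on_def fun_eq_iff)
  have run_t: "run (override_on h f J) t = run h t" for h f
    by (rule run_cong) (auto simp: override_on_def J_def)
  have "measure_pmf.expectation (coins_pmf L J) (\<lambda>f. Y (Suc t) (override_on g f J)) \<le>
      measure_pmf.expectation (coins_pmf L J) (\<lambda>f. Y t (override_on g f J))" for g
  proof -
    define g' where "g' = override_on \<xi> g (I - J)"
    define S where "S = run g' t"
    have S: "valid t S" unfolding S_def by (rule valid_run)
    have "measure_pmf.expectation (coins_pmf L J) (\<lambda>f. Y (Suc t) (override_on g f J)) \<le>
        measure_pmf.expectation (coins_pmf L J) (\<lambda>f. \<Prod>v\<in>A. new_weight \<theta> (override_on g' f J) (Suc t) S v + c)"
    proof (rule integral_mono[OF integrable_coins_pmf[OF fin(2)] integrable_coins_pmf[OF fin(2)]])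
      fix f
      have "run (override_on g' f J) (Suc t) = step (override_on g' f J) (Suc t) S"
        by (simp add: run_t S_def)
      moreover have "weight \<theta> (Suc t) (step (override_on g' f J) (Suc t) S) v \<le>
          new_weight \<theta> (override_on g' f J) (Suc t) S v" for v
        by (rule weight_step_le[OF S \<theta>(1)])
      ultimately show "Y (Suc t) (override_on g f J) \<le> (\<Prod>v\<in>A. new_weight \<theta> (override_on g' f J) (Suc t) S v + c)"
        unfolding Y_def ov g'_def[symmetric] c_def[symmetric]
        using c weight_nonneg by (intro prod_mono conjI add_nonneg_nonneg add_right_mono) auto
    qed
    also have "\<dots> \<le> (\<Prod>v\<in>A. weight \<theta> t S v + fail_prob * max_weight \<theta> T + c)"
      unfolding J_def by (rule expectation_step_le[OF S \<theta> t(1) L A U c])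
    also have "\<dots> = measure_pmf.expectation (coins_pmf L J) (\<lambda>f. Y t (override_on g f J))"
    proof -
      have "real (T - t) = 1 + real (T - Suc t)" using t by simp
      hence "Y t (override_on g f J) = (\<Prod>v\<in>A. weight \<theta> t S v + fail_prob * max_weight \<theta> T + c)" for f
        unfolding Y_def ov g'_def[symmetric] run_t S_def[symmetric] c_def by (simp add: algebra_simps)
      thus ?thesis by simp
    qed
    finally show ?thesis .
  qed
  thus ?thesis unfolding split
    by (rule integral_mono[OF integrable_coins_pmf[OF fin(3)] integrable_coins_pmf[OF fin(3)]])
qed

text \<open>The potential of a remaining node is nonnegative, so on the event every factor is at
  least \<open>2 powr (\<theta> * T)\<close>, and Markov's inequality applies. The horizon
  \<open>T\<close> may lie before the end \<open>T'\<close> of the run: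
  \<open>max_weight \<theta> T / 2 powr (\<theta> * T)\<close> grows with \<open>T\<close>, whereas
  \<open>fail_prob\<close> does not improve.\<close>

lemma prob_all_remaining_le:
  assumes \<theta>: "0 \<le> \<theta>" "2 powr (6 * \<theta>) * (1 - join_const) \<le> 1"
    and T: "T \<le> T'" and L: "T + 1 \<le> L"
    and A: "finite A" "A \<subseteq> V" "disjoint_family_on (two_hop E) A"
    and U: "finite U" "\<And>v. v \<in> A \<Longrightarrow> two_hop E v \<subseteq> U"
  shows "measure_pmf.prob (coins_pmf L (coin_index U T' reps))
      {f. A \<subseteq> remaining (run (override_on \<xi> f (coin_index U T' reps)) T')} \<le>
    ((2 powr (\<theta> * (25 * lg)) + T * (fail_prob * max_weight \<theta> T)) / 2 powr (\<theta> * T)) ^ card A"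
proof -
  define I where "I = coin_index U T' reps"
  have fin: "finite I" using U by (simp add: I_def coin_index_def)
  define Y where "Y = (\<lambda>t f. \<Prod>v\<in>A. weight \<theta> t (run (override_on \<xi> f I) t) v +
      real (T - t) * (fail_prob * max_weight \<theta> T))"
  have "measure_pmf.expectation (coins_pmf L I) (Y t) \<le> measure_pmf.expectation (coins_pmf L I) (Y 0)"
    if "t \<le> T" for t
    using that
  proof (induction t)
    case (Suc t)
    have "measure_pmf.expectation (coins_pmf L I) (Y (Suc t)) \<le> measure_pmf.expectation (coins_pmf L I) (Y t)"
      unfolding I_def Y_def by (rule expectation_run_step[OF \<theta> Suc.prems T L A U])
    with Suc show ?case by simp
  qed simp
  hence "measure_pmf.expectation (coins_pmf L I) (Y T) \<le> measure_pmf.expectation (coins_pmf L I) (Y 0)"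
    by simp
  also have "\<dots> \<le> measure_pmf.expectation (coins_pmf L I)
      (\<lambda>_. (2 powr (\<theta> * (25 * lg)) + T * (fail_prob * max_weight \<theta> T)) ^ card A)"
  proof (rule integral_mono[OF integrable_coins_pmf[OF fin] integrable_coins_pmf[OF fin]])
    fix f
    have "Y 0 f \<le> (\<Prod>v\<in>A. 2 powr (\<theta> * (25 * lg)) + T * (fail_prob * max_weight \<theta> T))"
      unfolding Y_def
    proof (rule prod_mono)
      fix v assume "v \<in> A"
      hence "weight \<theta> 0 (init_state V) v \<le> 2 powr (\<theta> * (25 * lg))"
        using A(2) by (intro initial_weight_le[OF \<theta>(1)]) auto
      thus "0 \<le> weight \<theta> 0 (run (override_on \<xi> f I) 0) v + real (T - 0) * (fail_prob * max_weight \<theta> T) \<and>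
        weight \<theta> 0 (run (override_on \<xi> f I) 0) v + real (T - 0) * (fail_prob * max_weight \<theta> T) \<le>
        2 powr (\<theta> * (25 * lg)) + T * (fail_prob * max_weight \<theta> T)"
        using weight_nonneg[of \<theta> 0 "init_state V" v] fail_prob_nonneg max_weight_nonneg[of \<theta> T] by simp
    qed
    thus "Y 0 f \<le> (2 powr (\<theta> * (25 * lg)) + T * (fail_prob * max_weight \<theta> T)) ^ card A" by simp
  qed
  finally have YT: "measure_pmf.expectation (coins_pmf L I) (Y T) \<le>
      (2 powr (\<theta> * (25 * lg)) + T * (fail_prob * max_weight \<theta> T)) ^ card A" by simp
  have "measure_pmf.prob (coins_pmf L I) {f. A \<subseteq> remaining (run (override_on \<xi> f I) T')} \<le>
      measure_pmf.expectation (coins_pmf L I) (Y T) / (2 powr (\<theta> * T)) ^ card A"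
  proof (rule prob_coins_markov[OF fin])
    show "0 \<le> Y T f" for f unfolding Y_def by (intro prod_nonneg) (simp add: weight_nonneg)
    fix f assume "A \<subseteq> remaining (run (override_on \<xi> f I) T')"
    hence rem: "A \<subseteq> remaining (run (override_on \<xi> f I) T)" using remaining_antimono[OF T] by blast
    have "(\<Prod>v\<in>A. 2 powr (\<theta> * T)) \<le> Y T f"
      unfolding Y_def
    proof (rule prod_mono)
      fix v assume v: "v \<in> A"
      let ?S = "run (override_on \<xi> f I) T"
      have "0 \<le> potential T (prb ?S v) (wdeg ?S v) (v \<in> stalling ?S)"
      proof -
        have "log 2 (prb ?S v) \<le> 0"
          using prb_pos[OF valid_run[of T "override_on \<xi> f I"], of v]
            prb_le_half[OF valid_run[of T "override_on \<xi> f I"], of v]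
          by (subst log_le_zero_cancel_iff) auto
        thus ?thesis using level_nonneg[of "wdeg ?S v"] unfolding potential_def by linarith
      qed
      hence "2 powr (\<theta> * T) \<le> weight \<theta> T ?S v"
        using v rem \<theta>(1) by (auto simp: weight_def intro!: mult_left_mono)
      thus "0 \<le> 2 powr (\<theta> * T) \<and> 2 powr (\<theta> * T) \<le> weight \<theta> T ?S v + real (T - T) * (fail_prob * max_weight \<theta> T)"
        by simp
    qed
    thus "(2 powr (\<theta> * T)) ^ card A \<le> Y T f" by simp
  qed simp
  also have "\<dots> \<le> (2 powr (\<theta> * (25 * lg)) + T * (fail_prob * max_weight \<theta> T)) ^ card A / (2 powr (\<theta> * T)) ^ card A"
    by (intro divide_right_mono YT) simp
  finally show ?thesis by (simp add: I_def power_divide)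
qed

text \<open>With \<open>T\<close> about \<open>(C + 2) / \<theta> * lg\<close> the gain is
  \<open>\<Delta> powr (C + 2)\<close>, of which the initial weight uses one power of
  \<open>\<Delta>\<close> and the sum of the two terms another. In the error term the
  \<open>12 * C * lg\<close> repetitions outweigh the length of the run and the maximal
  weight.\<close>

lemma remaining_bound_le:
  assumes \<theta>: "0 < \<theta>" "\<theta> \<le> 1/25" and C: "2 \<le> C" "1 / \<theta> \<le> 2 powr C"
    and T: "T = num_iterations ((C + 2) / \<theta>) \<Delta>"
  shows "(2 powr (\<theta> * (25 * lg)) + T * (fail_prob * max_weight \<theta> T)) / 2 powr (\<theta> * T) \<le> real \<Delta> powr (- C)"
proof -
  have \<Delta>: "real \<Delta> = 2 powr lg" using \<Delta>_ge_2 by simp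
  have lg: "1 \<le> lg" by (rule lg_ge_1)
  have T_real: "(C + 2) / \<theta> * lg \<le> T" "T \<le> (C + 2) / \<theta> * lg + 1"
  proof -
    have "0 \<le> (C + 2) / \<theta> * lg" using \<theta> C lg by simp
    hence "real T = of_int \<lceil>(C + 2) / \<theta> * lg\<rceil>" using T by (simp add: num_iterations_def)
    thus "(C + 2) / \<theta> * lg \<le> T" "T \<le> (C + 2) / \<theta> * lg + 1" by linarith+
  qed
  have "\<theta> * ((C + 2) / \<theta> * lg) = (C + 2) * lg" using \<theta> by simp
  hence \<theta>T: "(C + 2) * lg \<le> \<theta> * T" "\<theta> * T \<le> (C + 2) * lg + \<theta>"
    using mult_left_mono[OF T_real(1), of \<theta>] mult_left_mono[OF T_real(2), of \<theta>] \<theta>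
    by (auto simp: algebra_simps)
  have \<theta>lg: "\<theta> * (25 * lg) \<le> lg" using mult_right_mono[OF \<theta>(2), of "25 * lg"] lg by simp
  have "2 powr (\<theta> * (25 * lg)) / 2 powr (\<theta> * T) = 2 powr (\<theta> * (25 * lg) - \<theta> * T)"
    by (simp add: powr_diff)
  also have "\<dots> \<le> 2 powr (- (C + 1) * lg)" using \<theta>T \<theta>lg by (simp add: algebra_simps)
  finally have first: "2 powr (\<theta> * (25 * lg)) / 2 powr (\<theta> * T) \<le> 2 powr (- (C + 1) * lg)" .
  \<comment> \<open>Here \<open>1 / \<theta> \<le> 2 powr C\<close> is needed: the factor
    \<open>1 / \<theta>\<close> in the number of iterations must not exceed what the repetitions pay
    for.\<close>
  have Tle: "T \<le> 2 powr ((2 * C + 3) + lg)"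
  proof -
    have "T \<le> (C + 2) * lg / \<theta> + lg / \<theta>"
    proof -
      have "1 \<le> lg / \<theta>" using \<theta> lg by simp
      thus ?thesis using T_real(2) by simp
    qed
    also have "\<dots> = ((C + 3) * lg) * (1 / \<theta>)" using \<theta> by (simp add: field_simps)
    also have "\<dots> \<le> (2 powr (C + 3) * 2 powr lg) * 2 powr C"
    proof (intro mult_mono C)
      show "C + 3 \<le> 2 powr (C + 3)" "lg \<le> 2 powr lg" using C lg by (auto intro!: le_two_powr)
    qed (use \<theta> C lg in auto)
    also have "\<dots> = 2 powr ((2 * C + 3) + lg)" by (simp add: powr_add[symmetric] algebra_simps)
    finally show ?thesis .
  qed
  have fail: "fail_prob \<le> 2 powr (2 * lg - 12 * C * lg)"
  proof -
    have reps: "12 * C * lg \<le> reps" by (simp add: num_reps_def of_nat_ceiling)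
    have "(1/2 :: real)^reps = 2 powr (- real reps)"
      by (simp add: powr_minus powr_realpow power_one_over inverse_eq_divide)
    also have "\<dots> \<le> 2 powr (- (12 * C * lg))" using reps by simp
    finally have "fail_prob \<le> (real \<Delta> + 2) * 2 powr (- (12 * C * lg))"
      unfolding fail_prob_def by (intro mult_left_mono) auto
    also have "\<dots> \<le> (2 powr lg * 2 powr lg) * 2 powr (- (12 * C * lg))"
    proof (rule mult_right_mono)
      have "real \<Delta> + 2 \<le> 2 * real \<Delta>" using \<Delta>_ge_2 by simp
      also have "\<dots> \<le> real \<Delta> * real \<Delta>" using \<Delta>_ge_2 by (intro mult_right_mono) auto
      finally show "real \<Delta> + 2 \<le> 2 powr lg * 2 powr lg" by (simp only: \<Delta>[symmetric])
    qed simp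
    also have "\<dots> = 2 powr (2 * lg - 12 * C * lg)" by (simp add: powr_add[symmetric] powr_diff)
    finally show ?thesis .
  qed
  have "max_weight \<theta> T / 2 powr (\<theta> * T) = 2 powr (\<theta> * T + \<theta> * (25 * lg))"
    by (simp add: max_weight_def powr_diff[symmetric] algebra_simps)
  also have "\<dots> \<le> 2 powr ((C + 4) * lg)"
  proof -
    have "\<theta> * T + \<theta> * (25 * lg) \<le> (C + 2) * lg + 2 * lg" using \<theta>T(2) \<theta>lg \<theta>(2) lg by linarith
    thus ?thesis by (simp add: algebra_simps)
  qed
  finally have mw: "max_weight \<theta> T / 2 powr (\<theta> * T) \<le> 2 powr ((C + 4) * lg)" .
  have "T * (fail_prob * max_weight \<theta> T) / 2 powr (\<theta> * T) =
      T * (fail_prob * (max_weight \<theta> T / 2 powr (\<theta> * T)))" by simp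
  also have "\<dots> \<le> 2 powr ((2 * C + 3) + lg) * (2 powr (2 * lg - 12 * C * lg) * 2 powr ((C + 4) * lg))"
    by (intro mult_mono Tle fail mw mult_nonneg_nonneg) (auto simp: fail_prob_nonneg max_weight_nonneg)
  also have "\<dots> = 2 powr ((2 * C + 3) + (7 - 11 * C) * lg)"
    by (simp add: powr_add[symmetric] algebra_simps)
  also have "\<dots> \<le> 2 powr (- (C + 1) * lg)"
  proof -
    have "2 * C + 3 \<le> (10 * C - 8) * 1" using C by simp
    also have "\<dots> \<le> (10 * C - 8) * lg" using C lg by (intro mult_left_mono) auto
    finally show ?thesis by (simp add: algebra_simps)
  qed
  finally have "(2 powr (\<theta> * (25 * lg)) + T * (fail_prob * max_weight \<theta> T)) / 2 powr (\<theta> * T)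
      \<le> 2 * 2 powr (- (C + 1) * lg)" using first by (simp add: add_divide_distrib)
  also have "\<dots> \<le> 2 powr lg * 2 powr (- (C + 1) * lg)"
    using \<Delta>_ge_2 \<Delta> by (intro mult_right_mono) auto
  also have "\<dots> = real \<Delta> powr (- C)"
    by (subst \<Delta>) (simp add: powr_powr powr_add[symmetric] algebra_simps)
  finally show ?thesis .
qed

subsection \<open>Sparse sets of remaining nodes\<close>

lemma card_nbrs_le: "card (E `` {v}) \<le> \<Delta>"
proof (cases "v \<in> V")
  case False
  hence "E `` {v} = {}" using E_sub by auto
  thus ?thesis by simp
qed (rule degree_le)

section \<open>Balls in the graph metric\<close>

definition nball :: "nat \<Rightarrow> nat \<Rightarrow> nat set" where
  "nball r x = {y. \<exists>i\<le>r. (x, y) \<in> E ^^ i}"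

lemma nball_0: "nball 0 x = {x}" by (simp add: nball_def)

lemma nball_Suc: "nball (Suc r) x = insert x (E `` nball r x)"
proof (intro set_eqI iffI)
  fix y assume "y \<in> nball (Suc r) x"
  then obtain i where i: "i \<le> Suc r" "(x, y) \<in> E ^^ i" by (auto simp: nball_def)
  show "y \<in> insert x (E `` nball r x)"
  proof (cases i)
    case (Suc m)
    then obtain z where "(x, z) \<in> E ^^ m" "(z, y) \<in> E" using i by auto
    thus ?thesis using i Suc by (auto simp: nball_def)
  qed (use i in auto)
next
  fix y assume "y \<in> insert x (E `` nball r x)"
  thus "y \<in> nball (Suc r) x"
  proof
    assume "y = x"
    thus ?thesis by (auto simp: nball_def intro: exI[of _ 0])
  next
    assume "y \<in> E `` nball r x"
    then obtain z i where "i \<le> r" "(x, z) \<in> E ^^ i" "(z, y) \<in> E" by (auto simp: nball_def)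
    thus ?thesis by (auto simp: nball_def intro!: exI[of _ "Suc i"])
  qed
qed

lemma nball_refl: "x \<in> nball r x"
  by (auto simp: nball_def intro: exI[of _ 0])

lemma nball_sym: "y \<in> nball r x \<longleftrightarrow> x \<in> nball r y"
proof -
  have "(a, b) \<in> E ^^ i \<Longrightarrow> (b, a) \<in> E ^^ i" for a b i
  proof (induction i arbitrary: b)
    case (Suc i)
    then obtain c where "(a, c) \<in> E ^^ i" "(c, b) \<in> E" by auto
    hence "(c, a) \<in> E ^^ i" "(b, c) \<in> E" using Suc.IH symE by (auto dest: symD)
    thus ?case by (rule relpow_Suc_I2[rotated])
  qed auto
  thus ?thesis unfolding nball_def by blast
qed

lemma two_hop_eq: "two_hop E v = nball 2 v"
  by (auto simp: two_hop_def nball_Suc nball_0 numeral_2_eq_2)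

lemma nball_add: "y \<in> nball r x \<Longrightarrow> z \<in> nball s y \<Longrightarrow> z \<in> nball (r + s) x"
proof -
  assume "y \<in> nball r x" "z \<in> nball s y"
  then obtain i j where "i \<le> r" "j \<le> s" "(x, y) \<in> E ^^ i" "(y, z) \<in> E ^^ j" by (auto simp: nball_def)
  hence "i + j \<le> r + s" "(x, z) \<in> E ^^ (i + j)" by (auto simp: relpow_add)
  thus ?thesis by (auto simp: nball_def)
qed

lemma two_hop_disjoint: "y \<notin> nball 4 x \<Longrightarrow> two_hop E x \<inter> two_hop E y = {}"
  using nball_add[of _ 2 x y 2] nball_sym by (auto simp: two_hop_eq)

lemma finite_nball: "finite (nball r x)"
  by (induction r) (auto simp: nball_0 nball_Suc finite_neighbours)

lemma card_nball_Suc: "card (nball (Suc r) x) \<le> 1 + card (nball r x) * \<Delta>"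
proof -
  have "card (E `` nball r x) = card (\<Union>y\<in>nball r x. E `` {y})"
    by (rule arg_cong[where f = card]) auto
  also have "\<dots> \<le> (\<Sum>y\<in>nball r x. card (E `` {y}))" by (rule card_UN_le[OF finite_nball])
  also have "\<dots> \<le> card (nball r x) * \<Delta>"
    using sum_bounded_above[of "nball r x" "\<lambda>y. card (E `` {y})" \<Delta>] card_nbrs_le by simp
  finally show ?thesis by (simp add: nball_Suc card_insert_if finite_neighbours)
qed

lemma card_nball_le: "card (nball r x) \<le> (r + 1) * \<Delta> ^ r"
proof (induction r)
  case (Suc r)
  have "card (nball (Suc r) x) \<le> 1 + ((r + 1) * \<Delta> ^ r) * \<Delta>"
    using card_nball_Suc[of r x] Suc by (meson add_left_mono le_trans mult_right_mono zero_le)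
  also have "\<dots> \<le> \<Delta> ^ Suc r + ((r + 1) * \<Delta> ^ r) * \<Delta>" using \<Delta>_ge_2 by simp
  also have "\<dots> = (Suc r + 1) * \<Delta> ^ Suc r" by (simp add: algebra_simps)
  finally show ?case .
qed (simp add: nball_0)

lemma disjoint_insert_two_hop:
  assumes "disjoint_family_on (two_hop E) A" "\<And>x. x \<in> A \<Longrightarrow> y \<notin> nball 4 x"
  shows "disjoint_family_on (two_hop E) (insert y A)"
proof (unfold disjoint_family_on_def, intro ballI impI)
  fix a b assume ab: "a \<in> insert y A" "b \<in> insert y A" "a \<noteq> b"
  consider "a \<in> A" "b \<in> A" | "a = y" "b \<in> A" | "a \<in> A" "b = y" using ab by blast
  thus "two_hop E a \<inter> two_hop E b = {}"
    using assms(1) ab(3) two_hop_disjoint[OF assms(2)]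
    by cases (simp_all add: disjoint_family_on_def Int_commute)
qed

lemma card_UN_nball_le:
  assumes "finite A"
  shows "card (\<Union>x\<in>A. nball 4 x) \<le> card A * (5 * \<Delta> ^ 4)"
proof -
  have "card (\<Union>x\<in>A. nball 4 x) \<le> (\<Sum>x\<in>A. card (nball 4 x))" by (rule card_UN_le[OF assms])
  also have "\<dots> \<le> (\<Sum>x\<in>A. 5 * \<Delta> ^ 4)" using card_nball_le[of 4] by (intro sum_mono) simp
  finally show ?thesis by simp
qed

section \<open>Sparse walks and sparse subsets\<close>

text \<open>As long as the 4-balls around the chosen nodes do not cover the component, some edge of
  the component leaves their union \<open>N\<close>. Its outer end \<open>y\<close> is far from all
  chosen nodes, yet within distance 5 of one of them.\<close>

lemma exists_sparse_walk:
  assumes "m * (5 * \<Delta> ^ 4) < card ((Restr E B)\<^sup>* `` {u})" (is "_ < card ?S")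
  shows "\<exists>w. set w \<subseteq> ?S \<and> u \<in> set w \<and> card (set w) = Suc m \<and> disjoint_family_on (two_hop E) (set w) \<and>
    length w = Suc (2 * m) \<and> successively (\<lambda>x y. y \<in> nball 5 x) w"
  using assms
proof (induction m)
  case 0
  show ?case by (intro exI[of _ "[u]"]) (auto simp: disjoint_family_on_def)
next
  case (Suc m)
  have "m * (5 * \<Delta> ^ 4) < card ?S" using Suc.prems by simp
  from Suc.IH[OF this] obtain w where w: "set w \<subseteq> ?S" "u \<in> set w" "card (set w) = Suc m"
      "disjoint_family_on (two_hop E) (set w)" "length w = Suc (2 * m)"
      "successively (\<lambda>x y. y \<in> nball 5 x) w"
    by blast
  define N where "N = (\<Union>x\<in>set w. nball 4 x)"
  have finN: "finite N" by (simp add: N_def finite_nball)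
  have "card N < card ?S" using card_UN_nball_le[of "set w"] w(3) Suc.prems by (simp add: N_def)
  hence nsub: "\<not> ?S \<subseteq> N" using card_mono[OF finN, of ?S] by linarith
  have "\<exists>z y. z \<in> N \<and> (u, z) \<in> (Restr E B)\<^sup>* \<and> (z, y) \<in> Restr E B \<and> y \<notin> N"
  proof (rule ccontr)
    assume no: "\<not> ?thesis"
    have "y \<in> N" if "(u, y) \<in> (Restr E B)\<^sup>*" for y
      using that
    proof (induction rule: rtrancl_induct)
      case base
      show ?case using w(2) nball_refl by (auto simp: N_def)
    next
      case (step z y)
      thus ?case using no by blast
    qed
    thus False using nsub by blast
  qed
  then obtain z y where zy: "z \<in> N" "(u, z) \<in> (Restr E B)\<^sup>*" "(z, y) \<in> Restr E B" "y \<notin> N" by blast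
  obtain x where x: "x \<in> set w" "z \<in> nball 4 x" using zy(1) by (auto simp: N_def)
  have y5: "y \<in> nball 5 x" using nball_Suc[of 4 x] x zy(3) by auto
  have yS: "y \<in> ?S" using zy(2,3) by (auto intro: rtrancl_into_rtrancl)
  have y4: "y \<notin> nball 4 x'" if "x' \<in> set w" for x' using zy(4) that by (auto simp: N_def)
  have yw: "y \<notin> set w" using y4 nball_refl by blast
  obtain w1 w2 where w12: "w = w1 @ x # w2" using x(1) by (auto dest: split_list)
  \<comment> \<open>A detour to \<open>y\<close> and back: each new node costs two steps, hence the
    length \<open>Suc (2 * m)\<close>.\<close>
  let ?w = "w1 @ x # y # x # w2"
  have set_w: "set ?w = insert y (set w)" using w12 by auto
  show ?case
  proof (intro exI[of _ ?w] conjI)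
    show "successively (\<lambda>x y. y \<in> nball 5 x) ?w"
      using w(6) y5 nball_sym[of y 5 x] unfolding w12 by (auto simp: successively_append_iff successively_Cons)
    show "disjoint_family_on (two_hop E) (set ?w)"
      unfolding set_w by (rule disjoint_insert_two_hop[OF w(4) y4])
    show "card (set ?w) = Suc (Suc m)" unfolding set_w using yw w(3) by simp
    show "length ?w = Suc (2 * Suc m)" using w(5) w12 by simp
    show "set ?w \<subseteq> ?S" unfolding set_w using w(1) yS by blast
    show "u \<in> set ?w" unfolding set_w using w(2) by blast
  qed
qed

lemma exists_sparse_subset:
  assumes "m * (5 * \<Delta> ^ 4) < card B"
  shows "\<exists>A\<subseteq>B. card A = Suc m \<and> disjoint_family_on (two_hop E) A"
  using assms
proof (induction m)
  case 0
  then obtain y where "y \<in> B" by fastforce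
  thus ?case by (intro exI[of _ "{y}"]) (auto simp: disjoint_family_on_def)
next
  case (Suc m)
  have "m * (5 * \<Delta> ^ 4) < card B" using Suc.prems by simp
  from Suc.IH[OF this] obtain A where A: "A \<subseteq> B" "card A = Suc m" "disjoint_family_on (two_hop E) A"
    by blast
  have finA: "finite A" using A(2) card.infinite by fastforce
  define N where "N = (\<Union>x\<in>A. nball 4 x)"
  have finN: "finite N" by (simp add: N_def finite_nball finA)
  have "card N < card B" using card_UN_nball_le[OF finA] A(2) Suc.prems by (simp add: N_def)
  hence "\<not> B \<subseteq> N" using card_mono[OF finN, of B] by linarith
  then obtain y where y: "y \<in> B" "y \<notin> N" by blast
  have y4: "y \<notin> nball 4 x" if "x \<in> A" for x using y that by (auto simp: N_def)
  hence "y \<notin> A" using nball_refl by blast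
  thus ?case using A y finA disjoint_insert_two_hop[OF A(3) y4]
    by (intro exI[of _ "insert y A"]) auto
qed

text \<open>Walks encode sparse sets cheaply: only the start costs a factor \<open>card V\<close>,
  while every step has at most \<open>6 * \<Delta> ^ 5\<close> options. The argument counts steps,
  so lists have one more entry.\<close>

definition walks :: "nat \<Rightarrow> nat list set" where
  "walks m = {w. length w = Suc m \<and> set w \<subseteq> V \<and> successively (\<lambda>x y. y \<in> nball 5 x) w}"

lemma card_walks: "finite (walks m) \<and> card (walks m) \<le> card V * (6 * \<Delta> ^ 5) ^ m"
proof (induction m)
  case 0
  have "walks 0 \<subseteq> (\<lambda>x. [x]) ` V" by (auto simp: walks_def length_Suc_conv)
  hence "finite (walks 0)" "card (walks 0) \<le> card ((\<lambda>x. [x]) ` V)"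
    using finite_V by (auto intro: finite_subset card_mono)
  thus ?case using card_image_le[OF finite_V, of "\<lambda>x. [x]"] by simp
next
  case (Suc m)
  define X where "X = Sigma (walks m) (\<lambda>w. nball 5 (hd w))"
  have fin: "finite X" using Suc by (auto simp: X_def finite_nball)
  have sub: "walks (Suc m) \<subseteq> (\<lambda>(w, x). x # w) ` X"
  proof
    fix w assume w: "w \<in> walks (Suc m)"
    then obtain x w' where xw: "w = x # w'" "length w' = Suc m" by (auto simp: walks_def length_Suc_conv)
    hence "hd w' \<in> nball 5 x" "w' \<in> walks m"
      using w by (auto simp: walks_def successively_Cons)
    hence "(w', x) \<in> X" using nball_sym by (auto simp: X_def)
    thus "w \<in> (\<lambda>(w, x). x # w) ` X" using xw by force
  qed
  have "card (walks (Suc m)) \<le> card ((\<lambda>(w, x). x # w) ` X)" by (rule card_mono) (use fin sub in auto)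
  also have "\<dots> \<le> card X" by (rule card_image_le[OF fin])
  also have "card X = (\<Sum>w\<in>walks m. card (nball 5 (hd w)))"
    unfolding X_def using Suc by (simp add: card_SigmaI finite_nball)
  also have "\<dots> \<le> card (walks m) * (6 * \<Delta> ^ 5)"
    using sum_bounded_above[of "walks m" "\<lambda>w. card (nball 5 (hd w))" "6 * \<Delta> ^ 5"] card_nball_le[of 5] by simp
  also have "\<dots> \<le> (card V * (6 * \<Delta> ^ 5) ^ m) * (6 * \<Delta> ^ 5)" using Suc by (intro mult_right_mono) auto
  finally show ?case using finite_subset[OF sub] fin by (simp add: algebra_simps)
qed

section \<open>Union bounds\<close>

text \<open>A component that is too large carries a sparse walk visiting
  \<open>Suc m \<ge> log \<Delta> n\<close> nodes. Two steps per node give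
  \<open>(6 * \<Delta> ^ 5)^2 \<le> \<Delta> ^ 16\<close> choices against a survival bound of
  \<open>\<Delta> powr (- C)\<close>; the start adds the factor \<open>n\<close>.\<close>

lemma prob_large_component:
  fixes D :: "'a pmf"
  assumes Rem: "\<And>f. Rem f \<subseteq> V"
    and prob: "\<And>A. A \<subseteq> V \<Longrightarrow> disjoint_family_on (two_hop E) A \<Longrightarrow>
      measure_pmf.prob D {f. A \<subseteq> Rem f} \<le> (real \<Delta> powr (- C)) ^ card A"
    and C: "16 \<le> C" and n: "2 \<le> card V"
  shows "measure_pmf.prob D {f. \<exists>S \<in> induced_components E (Rem f).
      5 * (log (real \<Delta>) (real (card V)) * real \<Delta> ^ 4) < real (card S)} \<le> real (card V) powr (17 - C)"
proof -
  let ?n = "real (card V)" and ?d = "real \<Delta>"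
  \<comment> \<open>The predecessor of the rounded-up logarithm: \<open>m\<close> lies strictly
    below it, so that the component is large enough, and \<open>Suc m\<close> reaches it, so that
    the bound is small enough.\<close>
  define m where "m = nat \<lceil>log ?d ?n\<rceil> - 1"
  have d: "2 \<le> ?d" using \<Delta>_ge_2 by simp
  have "0 < log ?d ?n" using d n by simp
  hence m: "real m < log ?d ?n" "log ?d ?n \<le> real (Suc m)" unfolding m_def by linarith+
  define W where "W = {w \<in> walks (2 * m). card (set w) = Suc m \<and> disjoint_family_on (two_hop E) (set w)}"
  have W: "finite W" "card W \<le> card (walks (2 * m))"
    using card_walks by (auto simp: W_def intro: card_mono)
  have "measure_pmf.prob D {f. \<exists>S \<in> induced_components E (Rem f). 5 * (log ?d ?n * ?d ^ 4) < real (card S)}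
      \<le> measure_pmf.prob D (\<Union>w\<in>W. {f. set w \<subseteq> Rem f})"
  proof (rule measure_pmf.finite_measure_mono, rule subsetI)
    fix f assume "f \<in> {f. \<exists>S \<in> induced_components E (Rem f). 5 * (log ?d ?n * ?d ^ 4) < real (card S)}"
    then obtain u where u: "u \<in> Rem f"
        "5 * (log ?d ?n * ?d ^ 4) < real (card ((Restr E (Rem f))\<^sup>* `` {u}))"
      by (auto simp: induced_components_def)
    have "real (m * (5 * \<Delta> ^ 4)) \<le> 5 * (log ?d ?n * ?d ^ 4)"
      using mult_right_mono[OF less_imp_le[OF m(1)], of "?d ^ 4"] by simp
    hence "real (m * (5 * \<Delta> ^ 4)) < real (card ((Restr E (Rem f))\<^sup>* `` {u}))" using u(2) by linarith
    hence "m * (5 * \<Delta> ^ 4) < card ((Restr E (Rem f))\<^sup>* `` {u})" by (simp only: of_nat_less_iff)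
    from exists_sparse_walk[OF this] obtain w where w: "set w \<subseteq> (Restr E (Rem f))\<^sup>* `` {u}"
        "card (set w) = Suc m" "disjoint_family_on (two_hop E) (set w)"
        "length w = Suc (2 * m)" "successively (\<lambda>x y. y \<in> nball 5 x) w" by blast
    have "(Restr E (Rem f))\<^sup>* `` {u} \<subseteq> Rem f"
    proof
      fix y assume "y \<in> (Restr E (Rem f))\<^sup>* `` {u}"
      hence "(u, y) \<in> (Restr E (Rem f))\<^sup>*" by simp
      thus "y \<in> Rem f" by (induction rule: rtrancl_induct) (use u in auto)
    qed
    hence "set w \<subseteq> Rem f" using w(1) by blast
    moreover from this have "w \<in> W" using w Rem[of f] by (auto simp: W_def walks_def)
    ultimately show "f \<in> (\<Union>w\<in>W. {f. set w \<subseteq> Rem f})" by blast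
  qed simp
  also have "\<dots> \<le> (\<Sum>w\<in>W. measure_pmf.prob D {f. set w \<subseteq> Rem f})"
    by (rule measure_pmf.finite_measure_subadditive_finite) (use W in auto)
  also have "\<dots> \<le> (\<Sum>w\<in>W. (?d powr (- C)) ^ Suc m)"
  proof (rule sum_mono)
    fix w assume "w \<in> W"
    thus "measure_pmf.prob D {f. set w \<subseteq> Rem f} \<le> (?d powr (- C)) ^ Suc m"
      using prob[of "set w"] by (auto simp: W_def walks_def)
  qed
  also have "\<dots> = card W * (?d powr (- C)) ^ Suc m" by simp
  also have "\<dots> \<le> (?n * (?d ^ 16) ^ Suc m) * (?d powr (- C)) ^ Suc m"
  proof (rule mult_right_mono)
    have "real (card W) \<le> real (card V * (6 * \<Delta> ^ 5) ^ (2 * m))"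
      using W card_walks[of "2 * m"] by (intro of_nat_mono) auto
    also have "\<dots> = ?n * ((6 * ?d ^ 5) ^ 2) ^ m"
      unfolding power_mult[symmetric] by simp
    also have "\<dots> \<le> ?n * (?d ^ 16) ^ Suc m"
    proof (rule mult_left_mono)
      have "(2::real) ^ 3 \<le> ?d ^ 3" using d by (intro power_mono) auto
      hence "6 * ?d ^ 5 \<le> ?d ^ 3 * ?d ^ 5" by (intro mult_right_mono) auto
      also have "\<dots> = ?d ^ 8" using power_add[of ?d 3 5] by simp
      finally have "(6 * ?d ^ 5) ^ 2 \<le> (?d ^ 8) ^ 2" by (rule power_mono) simp
      also have "\<dots> = ?d ^ 16" using power_mult[of ?d 8 2] by simp
      finally have "((6 * ?d ^ 5) ^ 2) ^ m \<le> (?d ^ 16) ^ m" by (rule power_mono) simp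
      also have "\<dots> \<le> (?d ^ 16) ^ Suc m"
        by (rule power_increasing) (use d in \<open>simp_all add: one_le_power\<close>)
      finally show "((6 * ?d ^ 5) ^ 2) ^ m \<le> (?d ^ 16) ^ Suc m" .
    qed simp
    finally show "real (card W) \<le> ?n * (?d ^ 16) ^ Suc m" .
  qed simp
  also have "\<dots> = ?n * (?d powr (16 - C)) ^ Suc m"
  proof -
    have "?d ^ 16 * ?d powr (- C) = ?d powr (16 - C)"
      using d powr_add[of ?d 16 "- C"] by simp
    thus ?thesis by (simp only: mult.assoc power_mult_distrib[symmetric])
  qed
  also have "(?d powr (16 - C)) ^ Suc m = (?d powr (16 - C)) powr real (Suc m)"
    by (rule powr_realpow[symmetric]) (use d in simp)
  also have "\<dots> = (?d powr real (Suc m)) powr (16 - C)"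
    unfolding powr_powr by (simp only: mult.commute)
  also have "\<dots> \<le> ?n powr (16 - C)"
  proof (rule powr_mono2')
    have "?n = ?d powr (log ?d ?n)" using d n by simp
    also have "\<dots> \<le> ?d powr real (Suc m)" using d m(2) by (intro powr_mono) auto
    finally show "?n \<le> ?d powr real (Suc m)" .
  qed (use C n in auto)
  also have "?n * ?n powr (16 - C) = ?n powr (17 - C)"
    using n powr_add[of ?n 1 "16 - C"] by simp
  finally show ?thesis by (simp add: mult_left_mono)
qed

text \<open>Dividing \<open>n / \<Delta> ^ 10\<close> by the size \<open>5 * \<Delta> ^ 4\<close> of
  a 4-ball leaves a sparse set of \<open>s \<ge> n / (5 * \<Delta> ^ 14)\<close> nodes. There are at
  most \<open>(15 * \<Delta> ^ 14) ^ s \<le> (\<Delta> ^ 18) ^ s\<close> candidates for it, each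
  surviving with probability at most \<open>\<Delta> powr (- C * s)\<close>.\<close>

lemma prob_many_remaining:
  fixes D :: "'a pmf"
  assumes prob: "\<And>A. A \<subseteq> V \<Longrightarrow> disjoint_family_on (two_hop E) A \<Longrightarrow>
      measure_pmf.prob D {f. A \<subseteq> Rem f} \<le> (real \<Delta> powr (- C)) ^ card A"
    and Rem: "\<And>f. Rem f \<subseteq> V"
    and C: "374 \<le> C" and n: "2 \<le> card V" and large: "real \<Delta> powr C < real (card V) ^ 11"
  shows "measure_pmf.prob D {f. real (card V) / real \<Delta> ^ 10 < real (card (Rem f))}
    \<le> real (card V) powr (- 11)"
proof -
  let ?n = "real (card V)" and ?d = "real \<Delta>"
  define m where "m = nat \<lceil>?n / (5 * ?d ^ 14)\<rceil> - 1"
  have d: "2 \<le> ?d" using \<Delta>_ge_2 by simp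
  have "0 < ?n / (5 * ?d ^ 14)" using d n by (intro divide_pos_pos) auto
  hence m: "real m < ?n / (5 * ?d ^ 14)" "?n / (5 * ?d ^ 14) \<le> real (Suc m)" unfolding m_def by linarith+
  define W where "W = {A. A \<subseteq> V \<and> card A = Suc m}"
  have W: "finite W" "card W = card V choose Suc m"
    using finite_V by (auto simp: W_def n_subsets)
  define W' where "W' = {A \<in> W. disjoint_family_on (two_hop E) A}"
  have W': "finite W'" "card W' \<le> card W" using W(1) by (auto simp: W'_def intro: card_mono)
  have "measure_pmf.prob D {f. ?n / ?d ^ 10 < real (card (Rem f))}
      \<le> measure_pmf.prob D (\<Union>A\<in>W'. {f. A \<subseteq> Rem f})"
  proof (rule measure_pmf.finite_measure_mono, rule subsetI)
    fix f assume "f \<in> {f. ?n / ?d ^ 10 < real (card (Rem f))}"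
    hence f: "?n / ?d ^ 10 < real (card (Rem f))" by simp
    have "real (m * (5 * \<Delta> ^ 4)) = real m * (5 * ?d ^ 4)" by simp
    also have "\<dots> \<le> ?n / (5 * ?d ^ 14) * (5 * ?d ^ 4)" using m(1) by (intro mult_right_mono) auto
    also have "\<dots> = ?n / ?d ^ 10" using d power_add[of ?d 4 10] by (simp add: divide_simps)
    finally have "real (m * (5 * \<Delta> ^ 4)) < real (card (Rem f))" using f by linarith
    hence "m * (5 * \<Delta> ^ 4) < card (Rem f)" by (simp only: of_nat_less_iff)
    from exists_sparse_subset[OF this] obtain A where
      "A \<subseteq> Rem f" "card A = Suc m" "disjoint_family_on (two_hop E) A" by blast
    thus "f \<in> (\<Union>A\<in>W'. {f. A \<subseteq> Rem f})" using Rem[of f] by (auto simp: W'_def W_def)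
  qed simp
  also have "\<dots> \<le> (\<Sum>A\<in>W'. measure_pmf.prob D {f. A \<subseteq> Rem f})"
    by (rule measure_pmf.finite_measure_subadditive_finite) (use W' in auto)
  also have "\<dots> \<le> (\<Sum>A\<in>W'. (?d powr (- C)) ^ Suc m)"
  proof (rule sum_mono)
    fix A assume "A \<in> W'"
    thus "measure_pmf.prob D {f. A \<subseteq> Rem f} \<le> (?d powr (- C)) ^ Suc m"
      using prob[of A] by (auto simp: W'_def W_def)
  qed
  also have "\<dots> = card W' * (?d powr (- C)) ^ Suc m" by simp
  also have "\<dots> \<le> (?d ^ 18) ^ Suc m * (?d powr (- C)) ^ Suc m"
  proof (rule mult_right_mono)
    have "real (card W') * fact (Suc m) \<le> real (card V choose Suc m) * fact (Suc m)"
      using W W' by (intro mult_right_mono) auto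
    also have "\<dots> = real ((card V choose Suc m) * fact (Suc m))" by (simp only: of_nat_mult of_nat_fact)
    also have "\<dots> \<le> real (card V ^ Suc m)" by (intro of_nat_mono binomial_fact_pow)
    also have "\<dots> = ?n ^ Suc m" by simp
    also have "\<dots> \<le> (5 * ?d ^ 14 * real (Suc m)) ^ Suc m"
    proof (rule power_mono)
      show "?n \<le> 5 * ?d ^ 14 * real (Suc m)"
        using m(2) d by (simp add: divide_le_eq mult.commute del: of_nat_Suc)
    qed simp
    also have "\<dots> = (5 * ?d ^ 14) ^ Suc m * real (Suc m) ^ Suc m" by (rule power_mult_distrib)
    also have "\<dots> \<le> (5 * ?d ^ 14) ^ Suc m * (3 ^ Suc m * fact (Suc m))"
      by (intro mult_left_mono power_self_le_fact) simp
    also have "\<dots> = (15 * ?d ^ 14) ^ Suc m * fact (Suc m)"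
      unfolding mult.assoc[symmetric] power_mult_distrib[symmetric] by simp
    finally have "real (card W') \<le> (15 * ?d ^ 14) ^ Suc m"
      by (rule mult_right_le_imp_le) simp
    also have "\<dots> \<le> (?d ^ 18) ^ Suc m"
    proof (rule power_mono)
      have "(2::real) ^ 4 \<le> ?d ^ 4" using d by (intro power_mono) auto
      hence "15 * ?d ^ 14 \<le> ?d ^ 4 * ?d ^ 14" by (intro mult_right_mono) auto
      also have "\<dots> = ?d ^ 18" using power_add[of ?d 4 14] by simp
      finally show "15 * ?d ^ 14 \<le> ?d ^ 18" .
    qed simp
    finally show "real (card W') \<le> (?d ^ 18) ^ Suc m" .
  qed simp
  also have "\<dots> = (?d powr (18 - C)) ^ Suc m"
  proof -
    have "?d ^ 18 * ?d powr (- C) = ?d powr (18 - C)"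
      using d powr_add[of ?d 18 "- C"] by simp
    thus ?thesis by (simp only: power_mult_distrib[symmetric])
  qed
  also have "\<dots> \<le> (2 powr (18 - C)) ^ Suc m"
    using C d by (intro power_mono powr_mono2') auto
  also have "\<dots> = (2 powr (18 - C)) powr real (Suc m)"
    by (rule powr_realpow[symmetric]) simp
  also have "\<dots> = 2 powr ((18 - C) * real (Suc m))" by (rule powr_powr)
  \<comment> \<open>As \<open>\<Delta> ^ 34 < n\<close>, the number of sparse nodes is at least
    \<open>sqrt n\<close>, and \<open>11 * log 2 n \<le> 22 * sqrt n\<close>; so an exponent linear
    in that number is enough.\<close>
  also have "\<dots> \<le> 2 powr (- 11 * log 2 ?n)"
  proof -
    have "?d powr 374 < ?n ^ 11"
      using large powr_mono[of 374 C ?d] C d by linarith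
    hence "(?d ^ 34) ^ 11 < ?n ^ 11" using d power_mult[of ?d 34 11] by simp
    hence "?d ^ 34 < ?n" by (rule power_less_imp_less_base) simp
    hence "?d ^ 17 < sqrt ?n" using power_mult[of ?d 17 2] by (intro real_less_rsqrt) simp
    have "sqrt ?n * (5 * ?d ^ 14) \<le> sqrt ?n * ?d ^ 17"
    proof (rule mult_left_mono)
      have "(2::real) ^ 3 \<le> ?d ^ 3" using d by (intro power_mono) auto
      hence "5 * ?d ^ 14 \<le> ?d ^ 3 * ?d ^ 14" by (intro mult_right_mono) auto
      also have "\<dots> = ?d ^ 17" using power_add[of ?d 3 14] by simp
      finally show "5 * ?d ^ 14 \<le> ?d ^ 17" .
    qed simp
    also have "\<dots> \<le> sqrt ?n * sqrt ?n" using \<open>?d ^ 17 < sqrt ?n\<close> by (intro mult_left_mono) auto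
    finally have "sqrt ?n * (5 * ?d ^ 14) \<le> ?n" by simp
    hence "sqrt ?n \<le> ?n / (5 * ?d ^ 14)" using d by (subst pos_le_divide_eq) auto
    hence sq: "sqrt ?n \<le> real (Suc m)" using m(2) by linarith
    have "log 2 ?n = 2 * log 2 (sqrt ?n)" using n by (simp add: log_def ln_sqrt)
    also have "log 2 (sqrt ?n) \<le> sqrt ?n"
      using le_two_powr[of "sqrt ?n"] n by (subst log_le_iff) auto
    finally have "11 * log 2 ?n \<le> 22 * sqrt ?n" by simp
    also have "\<dots> \<le> (C - 18) * real (Suc m)" using C sq by (intro mult_mono) auto
    finally show ?thesis by (simp add: algebra_simps)
  qed
  also have "\<dots> = ?n powr (- 11)" using n by (simp add: powr_def log_def)
  finally show ?thesis .
qed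

lemma prob_good_remaining:
  fixes D :: "'a pmf"
  assumes prob: "\<And>A. A \<subseteq> V \<Longrightarrow> disjoint_family_on (two_hop E) A \<Longrightarrow>
      measure_pmf.prob D {f. A \<subseteq> Rem f} \<le> (real \<Delta> powr (- C)) ^ card A"
    and Rem: "\<And>f. Rem f \<subseteq> V"
    and C: "374 \<le> C" "44 / \<alpha> \<le> C"
  shows "1 - 1 / real (card V) ^ 10 \<le> measure_pmf.prob D {f.
      (\<forall>S \<in> induced_components E (Rem f).
        real (card S) \<le> 5 * (log (real \<Delta>) (real (card V)) * real \<Delta> ^ 4)) \<and>
      real (card (Rem f)) \<le> real (card V) / real \<Delta> ^ 10 \<and>
      (real (card V) powr (\<alpha> / 4) < real \<Delta> \<longrightarrow> Rem f = {})}" (is "_ \<le> measure_pmf.prob D ?G")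
proof -
  let ?n = "real (card V)" and ?d = "real \<Delta>"
  have d: "2 \<le> ?d" using \<Delta>_ge_2 by simp
  have "measure_pmf.prob D (- ?G) \<le> 1 / ?n ^ 10"
  proof (cases "?n ^ 11 \<le> ?d powr C")
    case True
    \<comment> \<open>All three properties hold trivially when nothing remains.\<close>
    have "measure_pmf.prob D (- ?G) \<le> measure_pmf.prob D (\<Union>v\<in>V. {f. {v} \<subseteq> Rem f})"
    proof (rule measure_pmf.finite_measure_mono, rule subsetI)
      fix f assume "f \<in> - ?G"
      hence "Rem f \<noteq> {}" by (auto simp: induced_components_def)
      thus "f \<in> (\<Union>v\<in>V. {f. {v} \<subseteq> Rem f})" using Rem[of f] by auto
    qed simp
    also have "\<dots> \<le> (\<Sum>v\<in>V. measure_pmf.prob D {f. {v} \<subseteq> Rem f})"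
      by (rule measure_pmf.finite_measure_subadditive_finite) (use finite_V in auto)
    also have "\<dots> \<le> (\<Sum>v\<in>V. ?d powr (- C))"
    proof (rule sum_mono)
      fix v assume "v \<in> V"
      thus "measure_pmf.prob D {f. {v} \<subseteq> Rem f} \<le> ?d powr (- C)"
        using prob[of "{v}"] by (simp add: disjoint_family_on_def)
    qed
    also have "\<dots> = ?n / ?d powr C" by (simp add: powr_minus_divide)
    also have "\<dots> \<le> 1 / ?n ^ 10"
    \<comment> \<open>Division by zero yields 0, so both sides vanish for an empty graph.\<close>
    proof (cases "card V = 0")
      case False
      have "?n * ?n ^ 10 \<le> ?d powr C" using True power_Suc[of ?n 10] by simp
      thus ?thesis using False d by (simp add: divide_simps mult.commute)
    qed simp
    finally show ?thesis .
  next
    case False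
    hence large: "?d powr C < ?n ^ 11" by simp
    have "1 \<le> ?d powr C" using d C by (intro ge_one_powr_ge_zero) auto
    hence n1: "1 < ?n ^ 11" using large by linarith
    have n: "2 \<le> card V"
    proof (rule ccontr)
      assume "\<not> 2 \<le> card V"
      hence "?n ^ 11 \<le> 1" by (intro power_le_one) auto
      thus False using n1 by linarith
    qed
    \<comment> \<open>The third property is vacuous in this case:
      \<open>\<Delta> > n powr (\<alpha> / 4)\<close> would give
      \<open>\<Delta> powr C \<ge> n powr 11\<close>.\<close>
    have small: "?d \<le> ?n powr (\<alpha> / 4)"
    proof (rule ccontr)
      assume "\<not> ?thesis"
      hence "(?n powr (\<alpha> / 4)) powr C \<le> ?d powr C" using C by (intro powr_mono2) auto
      moreover have "?n powr 11 \<le> ?n powr (\<alpha> / 4 * C)"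
      proof (rule powr_mono)
        show "11 \<le> \<alpha> / 4 * C" using C(2) \<alpha> by (simp add: field_simps)
      qed (use n in simp)
      ultimately have "?n powr 11 \<le> ?d powr C" by (simp add: powr_powr)
      thus False using large n powr_realpow[of ?n 11] by simp
    qed
    have "measure_pmf.prob D (- ?G) \<le> measure_pmf.prob D
        ({f. \<exists>S \<in> induced_components E (Rem f). 5 * (log ?d ?n * ?d ^ 4) < real (card S)} \<union>
         {f. ?n / ?d ^ 10 < real (card (Rem f))})"
      by (rule measure_pmf.finite_measure_mono) (use small in \<open>auto simp: not_le\<close>)
    also have "\<dots> \<le> ?n powr (17 - C) + ?n powr (- 11)"
    proof (rule order_trans[OF measure_Un_le add_mono])
      show "measure_pmf.prob D {f. \<exists>S \<in> induced_components E (Rem f). 5 * (log ?d ?n * ?d ^ 4) < real (card S)}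
          \<le> ?n powr (17 - C)"
        by (rule prob_large_component[OF Rem prob]) (use C n in auto)
      show "measure_pmf.prob D {f. ?n / ?d ^ 10 < real (card (Rem f))} \<le> ?n powr (- 11)"
        by (rule prob_many_remaining[OF prob Rem C(1) n large])
    qed auto
    also have "?n powr (17 - C) \<le> ?n powr (- 11)" using n C by (intro powr_mono) auto
    also have "?n powr (- 11) + ?n powr (- 11) \<le> ?n * ?n powr (- 11)"
      using n mult_right_mono[of 2 ?n "?n powr (- 11)"] by simp
    also have "\<dots> = ?n powr (- 10)"
      using n powr_add[of ?n 1 "- 11"] by simp
    also have "\<dots> = 1 / ?n ^ 10" using n powr_realpow[of ?n 10] by (simp add: powr_minus_divide)
    finally show ?thesis by simp
  qed
  moreover have "measure_pmf.prob D (- ?G) = 1 - measure_pmf.prob D ?G"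
    using measure_pmf.prob_compl[of ?G D] by (simp add: Compl_eq_Diff_UNIV)
  ultimately show ?thesis by linarith
qed

subsection \<open>Conclusion\<close>

lemma num_iterations_mono: "c \<le> c' \<Longrightarrow> num_iterations c \<Delta> \<le> num_iterations c' \<Delta>"
  unfolding num_iterations_def using lg_ge_1
  by (intro nat_mono ceiling_mono mult_right_mono) auto

text \<open>The bound holds at the horizon \<open>T0\<close>; it passes to every longer run because
  the set of remaining nodes shrinks.\<close>

lemma prob_all_remaining_powr:
  assumes \<theta>: "0 < \<theta>" "\<theta> \<le> 1/25" "2 powr (6 * \<theta>) * (1 - join_const) \<le> 1"
    and C: "2 \<le> C" "1 / \<theta> \<le> 2 powr C"
    and T: "num_iterations ((C + 2) / \<theta>) \<Delta> \<le> T"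
    and A: "A \<subseteq> V" "disjoint_family_on (two_hop E) A"
    and U: "finite U" "\<And>v. v \<in> A \<Longrightarrow> two_hop E v \<subseteq> U"
  shows "measure_pmf.prob (coins_pmf (T + 1) (coin_index U T reps))
      {f. A \<subseteq> remaining (run (override_on \<xi> f (coin_index U T reps)) T)} \<le>
    (real \<Delta> powr (- C)) ^ card A"
proof -
  define T0 where "T0 = num_iterations ((C + 2) / \<theta>) \<Delta>"
  have "measure_pmf.prob (coins_pmf (T + 1) (coin_index U T reps))
      {f. A \<subseteq> remaining (run (override_on \<xi> f (coin_index U T reps)) T)} \<le>
    ((2 powr (\<theta> * (25 * lg)) + T0 * (fail_prob * max_weight \<theta> T0)) / 2 powr (\<theta> * T0)) ^ card A"
    by (rule prob_all_remaining_le)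
       (use \<theta> T A U finite_subset[OF A(1) finite_V] in \<open>auto simp: T0_def\<close>)
  also have "\<dots> \<le> (real \<Delta> powr (- C)) ^ card A"
    by (intro power_mono remaining_bound_le[OF \<theta>(1,2) C T0_def] divide_nonneg_nonneg
        add_nonneg_nonneg mult_nonneg_nonneg fail_prob_nonneg max_weight_nonneg) auto
  finally show ?thesis .
qed

text \<open>Choosing \<open>U\<close> to be all of \<open>V\<close> gives the unconditional
  guarantee; choosing the 2-hop neighbourhood of \<open>v\<close>, with arbitrary
  \<open>\<xi>\<close> outside, gives independence of the distant randomness.\<close>

lemma measure_covered_ge:
  assumes \<theta>: "0 < \<theta>" "\<theta> \<le> 1/25" "2 powr (6 * \<theta>) * (1 - join_const) \<le> 1"
    and C: "2 \<le> C" "1 / \<theta> \<le> 2 powr C"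
    and T: "num_iterations ((C + 2) / \<theta>) \<Delta> \<le> T"
    and v: "v \<in> V" and U: "finite U" "two_hop E v \<subseteq> U"
  shows "1 - 1 / real \<Delta> powr C \<le> measure (coin_space U T reps)
    {\<omega> \<in> space (coin_space U T reps). covered V E \<alpha> C \<Delta> T v (override_on \<xi> \<omega> (coin_index U T reps))}"
proof -
  let ?P = "measure_pmf.prob (coins_pmf (T + 1) (coin_index U T reps))"
  let ?B = "{f. {v} \<subseteq> remaining (run (override_on \<xi> f (coin_index U T reps)) T)}"
  have "?P ?B \<le> (real \<Delta> powr (- C)) ^ card {v}"
    by (rule prob_all_remaining_powr[OF \<theta> C T]) (use v U in \<open>auto simp: disjoint_family_on_def\<close>)
  hence "1 - 1 / real \<Delta> powr C \<le> 1 - ?P ?B" by (simp add: powr_minus_divide)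
  also have "\<dots> = ?P (- ?B)"
    using measure_pmf.prob_compl[of ?B "coins_pmf (T + 1) (coin_index U T reps)"]
    by (simp add: Compl_eq_Diff_UNIV)
  also have "- ?B = {f. v \<notin> remaining (run (override_on \<xi> f (coin_index U T reps)) T)}" by auto
  also have "?P \<dots> = measure (coin_space U T reps) {\<omega> \<in> space (coin_space U T reps).
      v \<notin> remaining (run (override_on \<xi> \<omega> (coin_index U T reps)) T)}"
    by (rule measure_coin_space_run[symmetric, OF U(1)]) simp
  finally show ?thesis by (simp only: covered_iff[OF v])
qed

lemma measure_good_remaining_ge:
  assumes \<theta>: "0 < \<theta>" "\<theta> \<le> 1/25" "2 powr (6 * \<theta>) * (1 - join_const) \<le> 1"
    and C: "374 \<le> C" "44 / \<alpha> \<le> C" "1 / \<theta> \<le> 2 powr C"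
    and T: "num_iterations ((C + 2) / \<theta>) \<Delta> \<le> T"
  shows "1 - 1 / real (card V) ^ 10 \<le> measure (coin_space V T reps)
    {\<omega> \<in> space (coin_space V T reps). (let B = remaining (run (override_on \<xi> \<omega> (coin_index V T reps)) T) in
      (\<forall>S \<in> induced_components E B. real (card S) \<le> 5 * (log (real \<Delta>) (real (card V)) * real \<Delta> ^ 4)) \<and>
      real (card B) \<le> real (card V) / real \<Delta> ^ 10 \<and>
      (real \<Delta> > real (card V) powr (\<alpha> / 4) \<longrightarrow> B = {}))}"
proof -
  have "1 - 1 / real (card V) ^ 10 \<le> measure_pmf.prob (coins_pmf (T + 1) (coin_index V T reps))
    {\<omega>. let B = remaining (run (override_on \<xi> \<omega> (coin_index V T reps)) T) in
      (\<forall>S \<in> induced_components E B. real (card S) \<le> 5 * (log (real \<Delta>) (real (card V)) * real \<Delta> ^ 4)) \<and>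
      real (card B) \<le> real (card V) / real \<Delta> ^ 10 \<and>
      (real \<Delta> > real (card V) powr (\<alpha> / 4) \<longrightarrow> B = {})}"
    unfolding Let_def
  proof (rule prob_good_remaining[OF _ remaining_sub C(1,2)])
    fix A assume A: "A \<subseteq> V" "disjoint_family_on (two_hop E) A"
    show "measure_pmf.prob (coins_pmf (T + 1) (coin_index V T reps))
        {f. A \<subseteq> remaining (run (override_on \<xi> f (coin_index V T reps)) T)} \<le> (real \<Delta> powr (- C)) ^ card A"
      by (rule prob_all_remaining_powr[OF \<theta> _ C(3) T A finite_V])
         (use C A E_sub in \<open>auto simp: two_hop_def\<close>)
  qed
  also have "\<dots> = measure (coin_space V T reps) {\<omega> \<in> space (coin_space V T reps).
    (let B = remaining (run (override_on \<xi> \<omega> (coin_index V T reps)) T) in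
      (\<forall>S \<in> induced_components E B. real (card S) \<le> 5 * (log (real \<Delta>) (real (card V)) * real \<Delta> ^ 4)) \<and>
      real (card B) \<le> real (card V) / real \<Delta> ^ 10 \<and>
      (real \<Delta> > real (card V) powr (\<alpha> / 4) \<longrightarrow> B = {}))}"
    by (rule measure_coin_space_run[symmetric, OF finite_V]) simp
  finally show ?thesis .
qed

end

theorem theorem3p1:
  fixes \<alpha> :: real
  assumes "0 < \<alpha>" and "\<alpha> < 1"
  shows "\<exists>C0>0. \<forall>C\<ge>C0. \<exists>c0>0. \<forall>c\<ge>c0. \<exists>K>0.
    \<forall>(V :: nat set) (E :: nat rel) (n :: nat) (\<Delta> :: nat) (T :: nat) (k :: nat).
      simple_graph V E \<and> n = card V \<and> \<Delta> = max_degree V E \<and> \<Delta> \<ge> 2 \<and>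
      T = num_iterations c \<Delta> \<and> k = num_reps C \<Delta> \<longrightarrow>
      (\<forall>v\<in>V.
        measure (coin_space V T k)
            {\<omega> \<in> space (coin_space V T k). covered V E \<alpha> C \<Delta> T v \<omega>}
          \<ge> 1 - 1 / real \<Delta> powr C \<and>
        (\<forall>\<xi> \<in> space (coin_space (V - two_hop E v) T k).
          measure (coin_space (two_hop E v) T k)
              {\<omega> \<in> space (coin_space (two_hop E v) T k).
                covered V E \<alpha> C \<Delta> T v
                  (merge (coin_index (two_hop E v) T k) (coin_index (V - two_hop E v) T k) (\<omega>, \<xi>))}
            \<ge> 1 - 1 / real \<Delta> powr C)) \<and>
      measure (coin_space V T k)
          {\<omega> \<in> space (coin_space V T k).
            (let B = remaining (mis_run V E \<alpha> C \<Delta> \<omega> T) in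
              (\<forall>S \<in> induced_components E B.
                 real (card S) \<le> K * (log (real \<Delta>) (real n) * real \<Delta> ^ 4)) \<and>
              real (card B) \<le> real n / real \<Delta> ^ 10 \<and>
              (real \<Delta> > real n powr (\<alpha> / 4) \<longrightarrow> B = {}))}
        \<ge> 1 - 1 / real n ^ 10"
    (is "\<exists>C0>0. \<forall>C\<ge>C0. \<exists>c0>0. \<forall>c\<ge>c0. \<exists>K>0. ?P C c K")
proof -
  obtain \<theta> where \<theta>: "0 < \<theta>" "\<theta> \<le> 1/25" "2 powr (6 * \<theta>) * (1 - join_const) \<le> 1"
    using exists_potential_base by blast
  define C0 where "C0 = max (max 374 (44 / \<alpha>)) (log 2 (1 / \<theta>))"
    \<comment> \<open>\<open>374 = 11 * 34\<close>: then \<open>n ^ 11 > \<Delta> powr C\<close> gives \<open>\<Delta> ^ 34 < n\<close>; and \<open>44 / \<alpha>\<close> makes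
      \<open>\<Delta> > n powr (\<alpha> / 4)\<close> imply \<open>n ^ 11 \<le> \<Delta> powr C\<close>.\<close>
  show ?thesis
  proof (rule exI[of _ C0], intro conjI allI impI)
    show "0 < C0" by (simp add: C0_def)
    fix C assume "C0 \<le> C"
    hence C: "374 \<le> C" "44 / \<alpha> \<le> C" "log 2 (1 / \<theta>) \<le> C" by (auto simp: C0_def)
    have C\<theta>: "1 / \<theta> \<le> 2 powr C" using C(3) \<theta> by (subst (asm) log_le_iff) auto
    show "\<exists>c0>0. \<forall>c\<ge>c0. \<exists>K>0. ?P C c K"
    proof (rule exI[of _ "(C + 2) / \<theta>"], intro conjI allI impI)
      show "0 < (C + 2) / \<theta>" using C(1) \<theta>(1) by simp
      fix c assume c: "(C + 2) / \<theta> \<le> c"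
      show "\<exists>K>0. ?P C c K"
      \<comment> \<open>The 5 is the constant in the bound \<open>5 * \<Delta> ^ 4\<close> for the
        size of a 4-ball.\<close>
      proof (rule exI[of _ 5], intro conjI allI impI ballI)
        fix V :: "nat set" and E :: "nat rel" and n \<Delta> T k :: nat
        assume asm: "simple_graph V E \<and> n = card V \<and> \<Delta> = max_degree V E \<and> \<Delta> \<ge> 2 \<and>
          T = num_iterations c \<Delta> \<and> k = num_reps C \<Delta>"
        interpret sparsified_mis V E \<alpha> C \<Delta>
        proof
          show "card (E `` {v}) \<le> \<Delta>" if "v \<in> V" for v
            using asm that by (auto simp: max_degree_def simple_graph_def intro!: Max_ge)
        qed (use asm assms C in auto)
        have k: "k = num_reps C \<Delta>" using asm by simp
        have T: "num_iterations ((C + 2) / \<theta>) \<Delta> \<le> T" using asm num_iterations_mono[OF c] by simp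
        have C2: "2 \<le> C" using C(1) by simp
        note cov = measure_covered_ge[OF \<theta> C2 C\<theta> T, folded k]
        have hop: "two_hop E v \<subseteq> V" if "v \<in> V" for v using that E_sub by (auto simp: two_hop_def)
        {
          fix v assume v: "v \<in> V"
          show "1 - 1 / real \<Delta> powr C \<le> measure (coin_space V T k)
              {\<omega> \<in> space (coin_space V T k). covered V E \<alpha> C \<Delta> T v \<omega>}"
            using cov[OF v finite_V hop[OF v], of "\<lambda>_. undefined"]
            by (simp add: override_on_coin_space cong: conj_cong)
          fix \<xi> assume "\<xi> \<in> space (coin_space (V - two_hop E v) T k)"
          let ?I = "coin_index (two_hop E v) T k" and ?J = "coin_index (V - two_hop E v) T k"
          \<comment> \<open>Merging overrides the fixed outer coins on the 2-hop indices, so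
            \<open>cov\<close> applies with the 2-hop neighbourhood as \<open>U\<close>.\<close>
          have "merge ?I ?J (\<omega>, \<xi>) = override_on (\<lambda>x. if x \<in> ?J then \<xi> x else undefined) \<omega> ?I" for \<omega>
            by (auto simp: merge_def override_on_def)
          thus "1 - 1 / real \<Delta> powr C \<le> measure (coin_space (two_hop E v) T k)
              {\<omega> \<in> space (coin_space (two_hop E v) T k).
                covered V E \<alpha> C \<Delta> T v (merge ?I ?J (\<omega>, \<xi>))}"
            using cov[OF v finite_subset[OF hop[OF v] finite_V] subset_refl] by simp
        next
          show "1 - 1 / real n ^ 10 \<le> measure (coin_space V T k)
            {\<omega> \<in> space (coin_space V T k).
              (let B = remaining (mis_run V E \<alpha> C \<Delta> \<omega> T) in
              (\<forall>S \<in> induced_components E B.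
                 real (card S) \<le> 5 * (log (real \<Delta>) (real n) * real \<Delta> ^ 4)) \<and>
              real (card B) \<le> real n / real \<Delta> ^ 10 \<and>
              (real \<Delta> > real n powr (\<alpha> / 4) \<longrightarrow> B = {}))}"
            using measure_good_remaining_ge[OF \<theta> C(1,2) C\<theta> T, of "\<lambda>_. undefined", folded k] asm
            by (simp add: override_on_coin_space cong: conj_cong)
        }
      qed simp
    qed
  qed
qed

end
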